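(* Let $p\ge2$ and let $\mathcal M$ be a Riemannian manifold. If $R$ is a $p$-th order retraction on $\mathcal M$, then $R$ is $p$-th order nice on every compact subset of $\mathcal T\mathcal M$. In particular, if $\mathcal M$ is compact and $f\in C^{p}(\mathcal M)$, then $R$ is $p$-th order nice on the set of increments $\{v_i\}$ generated by $p$-RAR applied to $f$ with retraction $R$.
   Context: $\pi:\mathcal T\mathcal M\to\mathcal M$ is the projection. A retraction is a smooth map $R:\mathcal T\mathcal M\to\mathcal M$ with $R(0_x)=x$ and $d(R|_{\mathcal T_x\mathcal M})_{0_x}=\mathrm{Id}$; it is $p$-th order if for all $v\in\mathcal T\mathcal M$ and $2\le i\le p$ the curve $\gamma(t)=R(tv)$ satisfies $\frac{D^{i-1}}{dt^{i-1}}\gamma'(t)|_{t=0}=0$ (covariant derivatives along $\gamma$). For $v,\dot v\in\mathcal T_x\mathcal M$ put $\gamma_v(\dot v;t)=R(v+t\dot v)$ and let $\gamma_v'(\dot v;t)$ be its velocity in $t$. A retraction $R$ is $p$-th order nice on $\mathcal V\subseteq\mathcal T\mathcal M$ if there are constants $c_0,\dots,c_p$ such that for all $v\in\mathcal V$ and $\dot v\in\mathcal T_{\pi(v)}\mathcal M$: (1) for all $t\in[0,1]$, $\|\gamma'_{tv}(\dot v;0)\|\le c_0\|\dot v\|$; (2) for all $t\in[0,1]$, $\left\|\frac{D}{ds}\gamma'_{sv}(\dot v;0)\big|_{s=t}\right\|\le c_1\|v\|\|\dot v\|$, the covariant derivative being along $s\mapsto R(sv)$; (3) for $2\le i\le p$,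 $\left\|\frac{D^{i-1}}{dt^{i-1}}\gamma_v'(\dot v;t)\big|_{t=0}\right\|\le c_i\|v\|\|\dot v\|^i$. $p$-RAR: with $\hat f_x=f\circ R|_{\mathcal T_x\mathcal M}$, $T_p\hat f_x(0,v)=\sum_{j=0}^p\frac1{j!}D^j\hat f_x(0)[v^{\otimes j}]$ and $m_p(\alpha,x;v)=T_p\hat f_x(0,v)+\frac{\alpha}{p+1}\|v\|_x^{p+1}$, parameters $\epsilon_1,\theta>0$ (and $\epsilon_2>0$ in second-order mode), $0<\alpha_{\min}\le\alpha_0$, $0<\eta_1\le\eta_2<1$, $0<\gamma_1<1<\gamma_2<\gamma_3$ and $x_0\in\mathcal M$, iterate as follows until $\|\operatorname{grad}f(x_i)\|\le\epsilon_1$ (and, in second-order mode, also $\lambda_{\min}[\operatorname{Hess}f(x_i)]\ge-\epsilon_2$). Select $v_i\in\mathcal T_{x_i}\mathcal M$ with $m_p(\alpha_i,x_i;v_i)\le m_p(\alpha_i,x_i;0)$ and $\|Dm_p(\alpha_i,x_i;v_i)\|_{op}\le\theta\|v_i\|^p$ (and, in second-order mode, $\lambda_{\min}(D^2m_p(\alpha_i,x_i;v_i))\ge-\theta\|v_i\|^{p-1}$); let $\rho_i=\frac{f(x_i)-f(R(v_i))}{f(x_i)-T_p\hat f_{x_i}(0,v_i)}$; set $x_{i+1}=R(v_i)$ if $\rho_i\ge\eta_1$, else $x_{i+1}=x_i$; choose $\alpha_{i+1}\in[\max\{\alpha_{\min},\gamma_1\alpha_i\},\alpha_i]$ if $\rho_i\ge\eta_2$,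 $\alpha_{i+1}\in[\alpha_i,\gamma_2\alpha_i]$ if $\eta_1\le\rho_i<\eta_2$, $\alpha_{i+1}\in[\gamma_2\alpha_i,\gamma_3\alpha_i]$ if $\rho_i<\eta_1$. *)

theory Defs
  imports "HOL-Analysis.Analysis"
begin

section \<open>Higher derivatives in Euclidean spaces\<close>

text \<open>\<open>C\<^sup>k\<close> functions on an open set, by recursion on directional components of the Frechet
  derivative.\<close>

primrec Ck_on :: "nat \<Rightarrow> 'a::euclidean_space set \<Rightarrow> ('a \<Rightarrow> 'b::euclidean_space) \<Rightarrow> bool" where
  "Ck_on 0 S f \<longleftrightarrow> continuous_on S f"
| "Ck_on (Suc k) S f \<longleftrightarrow>
     (\<forall>x\<in>S. f differentiable (at x)) \<and> (\<forall>u. Ck_on k S (\<lambda>x. frechet_derivative f (at x) u))"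

definition smooth_on :: "'a::euclidean_space set \<Rightarrow> ('a \<Rightarrow> 'b::euclidean_space) \<Rightarrow> bool" where
  "smooth_on S f \<longleftrightarrow> (\<forall>k. Ck_on k S f)"

text \<open>\<open>iter_frechet f [u\<^sub>1, \<dots>, u\<^sub>j] y\<close> is \<open>D\<^sup>jf(y)[u\<^sub>1, \<dots>, u\<^sub>j]\<close>.\<close>

primrec iter_frechet :: "('a::euclidean_space \<Rightarrow> real) \<Rightarrow> 'a list \<Rightarrow> 'a \<Rightarrow> real" where
  "iter_frechet f [] y = f y"
| "iter_frechet f (u # us) y = frechet_derivative (\<lambda>z. iter_frechet f us z) (at y) u"

section \<open>Smooth manifolds\<close>

text \<open>A chart is a pair \<open>(U, \<phi>)\<close>; only the values of \<open>\<phi>\<close> on \<open>U\<close> matter.\<close>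

type_synonym ('a, 'e) chart = "'a set \<times> ('a \<Rightarrow> 'e)"

abbreviation chart_inv :: "('a, 'e) chart \<Rightarrow> 'e \<Rightarrow> 'a" where
  "chart_inv c \<equiv> inv_into (fst c) (snd c)"

text \<open>The atlas is not required to be maximal: all notions below depend only on the smooth
  structure that it generates.\<close>

definition smooth_manifold :: "'a topology \<Rightarrow> ('a, 'e::euclidean_space) chart set \<Rightarrow> bool" where
  "smooth_manifold X A \<longleftrightarrow>
     Hausdorff_space X \<and> second_countable X \<and> topspace X = (\<Union>c\<in>A. fst c) \<and>
     (\<forall>c\<in>A. openin X (fst c) \<and> open (snd c ` fst c) \<and>
        homeomorphic_map (subtopology X (fst c)) (top_of_set (snd c ` fst c)) (snd c)) \<and>
     (\<forall>c\<in>A. \<forall>d\<in>A. smooth_on (snd c ` (fst c \<inter> fst d)) (snd d \<circ> chart_inv c))"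

definition smooth_map ::
  "'a topology \<Rightarrow> ('a, 'e::euclidean_space) chart set \<Rightarrow>
   'b topology \<Rightarrow> ('b, 'h::euclidean_space) chart set \<Rightarrow> ('a \<Rightarrow> 'b) \<Rightarrow> bool" where
  "smooth_map X A Y B F \<longleftrightarrow>
     continuous_map X Y F \<and>
     (\<forall>c\<in>A. \<forall>d\<in>B. smooth_on (snd c ` {x \<in> fst c. F x \<in> fst d}) (snd d \<circ> F \<circ> chart_inv c))"

section \<open>Tangent bundle\<close>

text \<open>A tangent vector at \<open>x\<close> is the family of its coordinate vectors in all charts around \<open>x\<close>
  (and \<open>0\<close> for the other charts), transforming by the derivatives of the transition maps.\<close>

type_synonym ('a, 'e) tvec = "('a, 'e) chart \<Rightarrow> 'e"

record ('a, 'e) riemannian =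
  mtop :: "'a topology"
  atlas :: "('a, 'e) chart set"
  metric :: "'a \<Rightarrow> ('a, 'e) tvec \<Rightarrow> ('a, 'e) tvec \<Rightarrow> real"

definition charts_at :: "('a, 'e) riemannian \<Rightarrow> 'a \<Rightarrow> ('a, 'e) chart set" where
  "charts_at M x = {c \<in> atlas M. x \<in> fst c}"

text \<open>Used only where the result does not depend on the choice.\<close>

definition chart_at :: "('a, 'e) riemannian \<Rightarrow> 'a \<Rightarrow> ('a, 'e) chart" where
  "chart_at M x = (SOME c. c \<in> charts_at M x)"

definition tzero :: "('a, 'e::euclidean_space) tvec" where
  "tzero = (\<lambda>c. 0)"

definition tadd :: "('a, 'e::euclidean_space) tvec \<Rightarrow> ('a, 'e) tvec \<Rightarrow> ('a, 'e) tvec" where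
  "tadd v w = (\<lambda>c. v c + w c)"

definition tscale :: "real \<Rightarrow> ('a, 'e::euclidean_space) tvec \<Rightarrow> ('a, 'e) tvec" where
  "tscale r v = (\<lambda>c. r *\<^sub>R v c)"

definition tangent_space :: "('a, 'e::euclidean_space) riemannian \<Rightarrow> 'a \<Rightarrow> ('a, 'e) tvec set" where
  "tangent_space M x =
     {v. (\<forall>c. c \<notin> charts_at M x \<longrightarrow> v c = 0) \<and>
         (\<forall>c\<in>charts_at M x. \<forall>d\<in>charts_at M x.
            v d = frechet_derivative (snd d \<circ> chart_inv c) (at (snd c x)) (v c))}"

text \<open>The tangent vector at \<open>x\<close> with coordinates \<open>a\<close> in the chart \<open>c\<close>.\<close>

definition tvec_of ::
  "('a, 'e::euclidean_space) riemannian \<Rightarrow> ('a, 'e) chart \<Rightarrow> 'a \<Rightarrow> 'e \<Rightarrow> ('a, 'e) tvec" where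
  "tvec_of M c x a = (\<lambda>d. if d \<in> charts_at M x
     then frechet_derivative (snd d \<circ> chart_inv c) (at (snd c x)) a else 0)"

definition tangent_bundle ::
  "('a, 'e::euclidean_space) riemannian \<Rightarrow> ('a \<times> ('a, 'e) tvec) set" where
  "tangent_bundle M = Sigma (topspace (mtop M)) (tangent_space M)"

definition tangent_chart ::
  "('a, 'e::euclidean_space) riemannian \<Rightarrow> ('a, 'e) chart \<Rightarrow>
   ('a \<times> ('a, 'e) tvec, 'e \<times> 'e) chart" where
  "tangent_chart M c = (Sigma (fst c) (tangent_space M), \<lambda>(x, v). (snd c x, v c))"

definition TM_atlas ::
  "('a, 'e::euclidean_space) riemannian \<Rightarrow> ('a \<times> ('a, 'e) tvec, 'e \<times> 'e) chart set" where
  "TM_atlas M = tangent_chart M ` atlas M"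

definition TM_top ::
  "('a, 'e::euclidean_space) riemannian \<Rightarrow> ('a \<times> ('a, 'e) tvec) topology" where
  "TM_top M = topology_generated_by
     {{w \<in> fst C. snd C w \<in> Q} | C Q. C \<in> TM_atlas M \<and> open Q}"

section \<open>Riemannian manifolds\<close>

definition metric_coord ::
  "('a, 'e::euclidean_space) riemannian \<Rightarrow> ('a, 'e) chart \<Rightarrow> 'e \<Rightarrow> 'e \<Rightarrow> 'e \<Rightarrow> real" where
  "metric_coord M c y a b =
     metric M (chart_inv c y) (tvec_of M c (chart_inv c y) a) (tvec_of M c (chart_inv c y) b)"

definition riemannian_manifold :: "('a, 'e::euclidean_space) riemannian \<Rightarrow> bool" where
  "riemannian_manifold M \<longleftrightarrow>
     smooth_manifold (mtop M) (atlas M) \<and>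
     (\<forall>x\<in>topspace (mtop M). \<forall>u\<in>tangent_space M x.
        (\<forall>v\<in>tangent_space M x. metric M x u v = metric M x v u) \<and>
        (\<forall>v\<in>tangent_space M x. \<forall>w\<in>tangent_space M x.
           metric M x (tadd u v) w = metric M x u w + metric M x v w) \<and>
        (\<forall>r. \<forall>w\<in>tangent_space M x. metric M x (tscale r u) w = r * metric M x u w) \<and>
        (u \<noteq> tzero \<longrightarrow> metric M x u u > 0)) \<and>
     (\<forall>c\<in>atlas M. \<forall>a b. smooth_on (snd c ` fst c) (\<lambda>y. metric_coord M c y a b))"

definition tnorm :: "('a, 'e) riemannian \<Rightarrow> 'a \<Rightarrow> ('a, 'e) tvec \<Rightarrow> real" where
  "tnorm M x v = sqrt (metric M x v v)"

text \<open>Christoffel symbols of the Levi-Civita connection in the chart \<open>c\<close>, as a bilinear map on the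
  model space: the vector \<open>\<Gamma>(a, b)\<close> with
  \<open>g(\<Gamma>(a, b), w) = (D\<^sub>a g(b, w) + D\<^sub>b g(a, w) - D\<^sub>w g(a, b)) / 2\<close> for all \<open>w\<close>.\<close>

definition christoffel ::
  "('a, 'e::euclidean_space) riemannian \<Rightarrow> ('a, 'e) chart \<Rightarrow> 'e \<Rightarrow> 'e \<Rightarrow> 'e \<Rightarrow> 'e" where
  "christoffel M c y a b = (THE z. \<forall>w. metric_coord M c y z w =
     (frechet_derivative (\<lambda>y'. metric_coord M c y' b w) (at y) a
    + frechet_derivative (\<lambda>y'. metric_coord M c y' a w) (at y) b
    - frechet_derivative (\<lambda>y'. metric_coord M c y' a b) (at y) w) / 2)"

definition velocity ::
  "('a, 'e::euclidean_space) riemannian \<Rightarrow> (real \<Rightarrow> 'a) \<Rightarrow> real \<Rightarrow> ('a, 'e) tvec" where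
  "velocity M \<gamma> t = (\<lambda>c. if c \<in> charts_at M (\<gamma> t)
     then vector_derivative (\<lambda>s. snd c (\<gamma> s)) (at t) else 0)"

text \<open>Covariant derivative \<open>DV/dt\<close> of a vector field \<open>V\<close> along the curve \<open>\<gamma>\<close>, given by its
  coordinates in all charts simultaneously.\<close>

definition cov_deriv ::
  "('a, 'e::euclidean_space) riemannian \<Rightarrow> (real \<Rightarrow> 'a) \<Rightarrow>
   (real \<Rightarrow> ('a, 'e) tvec) \<Rightarrow> real \<Rightarrow> ('a, 'e) tvec" where
  "cov_deriv M \<gamma> V t = (\<lambda>c. if c \<in> charts_at M (\<gamma> t)
     then vector_derivative (\<lambda>s. V s c) (at t)
          + christoffel M c (snd c (\<gamma> t)) (velocity M \<gamma> t c) (V t c)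
     else 0)"

text \<open>Covariant derivative \<open>\<nabla>\<^sub>u V\<close> at \<open>x\<close> of a vector field \<open>V\<close>.\<close>

definition cov_deriv_field ::
  "('a, 'e::euclidean_space) riemannian \<Rightarrow> ('a \<Rightarrow> ('a, 'e) tvec) \<Rightarrow> 'a \<Rightarrow>
   ('a, 'e) tvec \<Rightarrow> ('a, 'e) tvec" where
  "cov_deriv_field M V x u = (\<lambda>c. if c \<in> charts_at M x
     then frechet_derivative (\<lambda>y. V (chart_inv c y) c) (at (snd c x)) (u c)
          + christoffel M c (snd c x) (u c) (V x c)
     else 0)"

section \<open>Retractions and niceness\<close>

definition manifold_retraction ::
  "('a, 'e::euclidean_space) riemannian \<Rightarrow> ('a \<times> ('a, 'e) tvec \<Rightarrow> 'a) \<Rightarrow> bool" where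
  "manifold_retraction M R \<longleftrightarrow>
     smooth_map (TM_top M) (TM_atlas M) (mtop M) (atlas M) R \<and>
     (\<forall>x\<in>topspace (mtop M). R (x, tzero) = x \<and>
        (\<forall>c\<in>charts_at M x. ((\<lambda>a. snd c (R (x, tvec_of M c x a))) has_derivative id) (at 0)))"

definition retraction_of_order ::
  "('a, 'e::euclidean_space) riemannian \<Rightarrow> nat \<Rightarrow> ('a \<times> ('a, 'e) tvec \<Rightarrow> 'a) \<Rightarrow> bool" where
  "retraction_of_order M p R \<longleftrightarrow>
     manifold_retraction M R \<and>
     (\<forall>(x, v)\<in>tangent_bundle M. \<forall>i\<in>{2..p}.
        let \<gamma> = \<lambda>t. R (x, tscale t v)
        in (cov_deriv M \<gamma> ^^ (i - 1)) (velocity M \<gamma>) 0 = tzero)"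

definition retr_curve ::
  "('a \<times> ('a, 'e::euclidean_space) tvec \<Rightarrow> 'a) \<Rightarrow> 'a \<Rightarrow>
   ('a, 'e) tvec \<Rightarrow> ('a, 'e) tvec \<Rightarrow> real \<Rightarrow> 'a" where
  "retr_curve R x v u t = R (x, tadd v (tscale t u))"

definition nice ::
  "('a, 'e::euclidean_space) riemannian \<Rightarrow> nat \<Rightarrow> ('a \<times> ('a, 'e) tvec \<Rightarrow> 'a) \<Rightarrow>
   ('a \<times> ('a, 'e) tvec) set \<Rightarrow> bool" where
  "nice M p R W \<longleftrightarrow> W \<subseteq> tangent_bundle M \<and>
     (\<exists>C :: nat \<Rightarrow> real. \<forall>(x, v)\<in>W. \<forall>u\<in>tangent_space M x.
        (\<forall>t\<in>{0..1}.
           tnorm M (R (x, tscale t v)) (velocity M (retr_curve R x (tscale t v) u) 0)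
             \<le> C 0 * tnorm M x u) \<and>
        (\<forall>t\<in>{0..1}.
           tnorm M (R (x, tscale t v))
             (cov_deriv M (\<lambda>s. R (x, tscale s v))
                (\<lambda>s. velocity M (retr_curve R x (tscale s v) u) 0) t)
             \<le> C 1 * tnorm M x v * tnorm M x u) \<and>
        (\<forall>i\<in>{2..p}.
           tnorm M (R (x, v))
             ((cov_deriv M (retr_curve R x v u) ^^ (i - 1)) (velocity M (retr_curve R x v u)) 0)
             \<le> C i * tnorm M x v * tnorm M x u ^ i))"

section \<open>Differential operators for scalar functions\<close>

definition Ck_function ::
  "('a, 'e::euclidean_space) riemannian \<Rightarrow> nat \<Rightarrow> ('a \<Rightarrow> real) \<Rightarrow> bool" where
  "Ck_function M k f \<longleftrightarrow> (\<forall>c\<in>atlas M. Ck_on k (snd c ` fst c) (f \<circ> chart_inv c))"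

definition differential ::
  "('a, 'e::euclidean_space) riemannian \<Rightarrow> ('a \<Rightarrow> real) \<Rightarrow> 'a \<Rightarrow> ('a, 'e) tvec \<Rightarrow> real" where
  "differential M f x u =
     (let c = chart_at M x in frechet_derivative (f \<circ> chart_inv c) (at (snd c x)) (u c))"

definition grad ::
  "('a, 'e::euclidean_space) riemannian \<Rightarrow> ('a \<Rightarrow> real) \<Rightarrow> 'a \<Rightarrow> ('a, 'e) tvec" where
  "grad M f x = (THE w. w \<in> tangent_space M x \<and>
     (\<forall>u\<in>tangent_space M x. metric M x w u = differential M f x u))"

definition Hess ::
  "('a, 'e::euclidean_space) riemannian \<Rightarrow> ('a \<Rightarrow> real) \<Rightarrow> 'a \<Rightarrow>
   ('a, 'e) tvec \<Rightarrow> ('a, 'e) tvec \<Rightarrow> real" where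
  "Hess M f x u w = metric M x (cov_deriv_field M (grad M f) x u) w"

text \<open>\<open>D\<^sup>jF(w)[u\<^sub>1, \<dots>, u\<^sub>j]\<close> for a function \<open>F\<close> on the vector space \<open>T\<^sub>xM\<close>, computed in the linear
  coordinates that a chart induces on \<open>T\<^sub>xM\<close>.\<close>

definition tangent_D ::
  "('a, 'e::euclidean_space) riemannian \<Rightarrow> 'a \<Rightarrow> (('a, 'e) tvec \<Rightarrow> real) \<Rightarrow>
   ('a, 'e) tvec list \<Rightarrow> ('a, 'e) tvec \<Rightarrow> real" where
  "tangent_D M x F us w =
     (let c = chart_at M x
      in iter_frechet (\<lambda>a. F (tvec_of M c x a)) (map (\<lambda>u. u c) us) (w c))"

definition covector_opnorm ::
  "('a, 'e::euclidean_space) riemannian \<Rightarrow> 'a \<Rightarrow> (('a, 'e) tvec \<Rightarrow> real) \<Rightarrow> real" where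
  "covector_opnorm M x L = (SUP u\<in>{u\<in>tangent_space M x. tnorm M x u \<le> 1}. \<bar>L u\<bar>)"

text \<open>Least eigenvalue of the self-adjoint operator on \<open>T\<^sub>xM\<close> that represents the symmetric
  bilinear form \<open>B\<close> with respect to the metric.\<close>

definition lambda_min ::
  "('a, 'e::euclidean_space) riemannian \<Rightarrow> 'a \<Rightarrow>
   (('a, 'e) tvec \<Rightarrow> ('a, 'e) tvec \<Rightarrow> real) \<Rightarrow> real" where
  "lambda_min M x B = Min {l. \<exists>u\<in>tangent_space M x. u \<noteq> tzero \<and>
     (\<forall>w\<in>tangent_space M x. B u w = l * metric M x u w)}"

section \<open>The algorithm p-RAR\<close>

definition taylor_model ::
  "('a, 'e::euclidean_space) riemannian \<Rightarrow> nat \<Rightarrow> ('a \<times> ('a, 'e) tvec \<Rightarrow> 'a) \<Rightarrow>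
   ('a \<Rightarrow> real) \<Rightarrow> 'a \<Rightarrow> ('a, 'e) tvec \<Rightarrow> real" where
  "taylor_model M p R f x v =
     (\<Sum>j=0..p. 1 / fact j * tangent_D M x (\<lambda>w. f (R (x, w))) (replicate j v) tzero)"

definition reg_model ::
  "('a, 'e::euclidean_space) riemannian \<Rightarrow> nat \<Rightarrow> ('a \<times> ('a, 'e) tvec \<Rightarrow> 'a) \<Rightarrow>
   ('a \<Rightarrow> real) \<Rightarrow> real \<Rightarrow> 'a \<Rightarrow> ('a, 'e) tvec \<Rightarrow> real" where
  "reg_model M p R f \<alpha> x v =
     taylor_model M p R f x v + \<alpha> / (real p + 1) * tnorm M x v ^ (p + 1)"

text \<open>\<open>second_order\<close> selects the second-order mode; \<open>eps2\<close> is irrelevant otherwise.\<close>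

record rar_params =
  second_order :: bool
  eps1 :: real
  eps2 :: real
  theta :: real
  alpha_min :: real
  alpha0 :: real
  eta1 :: real
  eta2 :: real
  gamma1 :: real
  gamma2 :: real
  gamma3 :: real

definition rar_params_ok :: "rar_params \<Rightarrow> bool" where
  "rar_params_ok P \<longleftrightarrow>
     0 < eps1 P \<and> (second_order P \<longrightarrow> 0 < eps2 P) \<and> 0 < theta P \<and>
     0 < alpha_min P \<and> alpha_min P \<le> alpha0 P \<and>
     0 < eta1 P \<and> eta1 P \<le> eta2 P \<and> eta2 P < 1 \<and>
     0 < gamma1 P \<and> gamma1 P < 1 \<and> 1 < gamma2 P \<and> gamma2 P < gamma3 P"

definition rar_stop ::
  "('a, 'e::euclidean_space) riemannian \<Rightarrow> ('a \<Rightarrow> real) \<Rightarrow> rar_params \<Rightarrow> 'a \<Rightarrow> bool" where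
  "rar_stop M f P x \<longleftrightarrow>
     tnorm M x (grad M f x) \<le> eps1 P \<and>
     (second_order P \<longrightarrow> lambda_min M x (Hess M f x) \<ge> - eps2 P)"

definition rar_step_ok ::
  "('a, 'e::euclidean_space) riemannian \<Rightarrow> nat \<Rightarrow> ('a \<times> ('a, 'e) tvec \<Rightarrow> 'a) \<Rightarrow>
   ('a \<Rightarrow> real) \<Rightarrow> rar_params \<Rightarrow> real \<Rightarrow> 'a \<Rightarrow> ('a, 'e) tvec \<Rightarrow> bool" where
  "rar_step_ok M p R f P \<alpha> x v \<longleftrightarrow>
     v \<in> tangent_space M x \<and>
     reg_model M p R f \<alpha> x v \<le> reg_model M p R f \<alpha> x tzero \<and>
     covector_opnorm M x (\<lambda>u. tangent_D M x (reg_model M p R f \<alpha> x) [u] v)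
       \<le> theta P * tnorm M x v ^ p \<and>
     (second_order P \<longrightarrow>
        lambda_min M x (\<lambda>u w. tangent_D M x (reg_model M p R f \<alpha> x) [u, w] v)
          \<ge> - theta P * tnorm M x v ^ (p - 1))"

definition rar_rho ::
  "('a, 'e::euclidean_space) riemannian \<Rightarrow> nat \<Rightarrow> ('a \<times> ('a, 'e) tvec \<Rightarrow> 'a) \<Rightarrow>
   ('a \<Rightarrow> real) \<Rightarrow> 'a \<Rightarrow> ('a, 'e) tvec \<Rightarrow> real" where
  "rar_rho M p R f x v = (f x - f (R (x, v))) / (f x - taylor_model M p R f x v)"

definition rar_active ::
  "('a, 'e::euclidean_space) riemannian \<Rightarrow> ('a \<Rightarrow> real) \<Rightarrow> rar_params \<Rightarrow> (nat \<Rightarrow> 'a) \<Rightarrow> nat \<Rightarrow> bool" where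
  "rar_active M f P x i \<longleftrightarrow> (\<forall>j\<le>i. \<not> rar_stop M f P (x j))"

text \<open>Runs are encoded as infinite sequences whose entries after termination are unconstrained; iteration \<open>i\<close>
  is performed iff \<open>rar_active M f P x i\<close>.\<close>

definition rar_run ::
  "('a, 'e::euclidean_space) riemannian \<Rightarrow> nat \<Rightarrow> ('a \<times> ('a, 'e) tvec \<Rightarrow> 'a) \<Rightarrow>
   ('a \<Rightarrow> real) \<Rightarrow> rar_params \<Rightarrow> 'a \<Rightarrow>
   (nat \<Rightarrow> 'a) \<Rightarrow> (nat \<Rightarrow> ('a, 'e) tvec) \<Rightarrow> (nat \<Rightarrow> real) \<Rightarrow> bool" where
  "rar_run M p R f P x0 x v \<alpha> \<longleftrightarrow>
     x0 \<in> topspace (mtop M) \<and> x 0 = x0 \<and> \<alpha> 0 = alpha0 P \<and>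
     (\<forall>i. rar_active M f P x i \<longrightarrow>
        rar_step_ok M p R f P (\<alpha> i) (x i) (v i) \<and>
        (let \<rho> = rar_rho M p R f (x i) (v i) in
           x (Suc i) = (if \<rho> \<ge> eta1 P then R (x i, v i) else x i) \<and>
           (\<rho> \<ge> eta2 P \<longrightarrow> \<alpha> (Suc i) \<in> {max (alpha_min P) (gamma1 P * \<alpha> i)..\<alpha> i}) \<and>
           (eta1 P \<le> \<rho> \<and> \<rho> < eta2 P \<longrightarrow> \<alpha> (Suc i) \<in> {\<alpha> i..gamma2 P * \<alpha> i}) \<and>
           (\<rho> < eta1 P \<longrightarrow> \<alpha> (Suc i) \<in> {gamma2 P * \<alpha> i..gamma3 P * \<alpha> i})))"

definition rar_increments ::
  "('a, 'e::euclidean_space) riemannian \<Rightarrow> ('a \<Rightarrow> real) \<Rightarrow> rar_params \<Rightarrow>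
   (nat \<Rightarrow> 'a) \<Rightarrow> (nat \<Rightarrow> ('a, 'e) tvec) \<Rightarrow> ('a \<times> ('a, 'e) tvec) set" where
  "rar_increments M f P x v = {(x i, v i) | i. rar_active M f P x i}"

end

theory Submission
  imports Defs
begin

text \<open>
  Write the retraction in charts as \<open>F(y, w)\<close>, where \<open>y\<close> are coordinates of the base point and \<open>w\<close> of
  the tangent vector. The iterated covariant derivatives of the velocity of \<open>t \<mapsto> R(v + t u)\<close> at
  \<open>t = 0\<close> are then smooth functions \<open>G\<^sub>i(y, w, u)\<close> that are homogeneous of degree \<open>i + 1\<close> in \<open>u\<close>, so
  compactness of the unit sphere yields locally uniform bounds by \<open>|u|\<^bsup>i + 1\<^esup>\<close>. A retraction of order
  \<open>p\<close> has \<open>G\<^sub>i(y, 0, u) = 0\<close> for \<open>1 \<le> i < p\<close>; near the zero section the mean value theorem along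
  \<open>s \<mapsto> s w\<close> gains the factor \<open>|w|\<close>, and away from it \<open>|w|\<close> is bounded below. The covariant
  derivative of condition (2) is bilinear in the two vectors and is treated in the same way. For p-RAR
  on a compact manifold, the term \<open>\<alpha>|v|\<^bsup>p + 1\<^esup> / (p + 1)\<close> with \<open>\<alpha> \<ge> \<alpha>\<^sub>m\<^sub>i\<^sub>n\<close> outgrows the Taylor polynomial
  of degree \<open>p\<close>, whose coefficients are uniformly bounded. So a step that does not increase the model
  has bounded length, and all increments lie in one compact subset of the tangent bundle.
\<close>

text \<open>The definitions evaluate a covariant derivative in all charts at once, with Christoffel
  symbols given by a definite description. So two facts precede every estimate. The Christoffel
  symbols exist and are smooth in the point; this is read off the linear equation that they solve,
  without an inverse matrix. And the coordinates of velocities and covariant derivatives in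
  different charts fit together to tangent vectors, which rests on the inhomogeneous transformation
  law of the Christoffel symbols and hence on the symmetry of second derivatives. Only then may the
  norm of such a derivative be computed in a single chart around its base point. Two charts occur
  throughout: \<open>c\<close> around the foot of the vector and \<open>d\<close> around its image
  under \<open>R\<close>. In the fibre coordinates of \<open>c\<close> the curves of the theorem are
  straight lines, so derivatives in \<open>t\<close> become derivatives in directions
  \<open>(0, h)\<close>. In condition (2) the factor \<open>|v|\<close> stems from the velocity of
  the line \<open>s v\<close>; in condition (3) it has to be extracted from the behaviour at
  \<open>v = 0\<close>.\<close>

section \<open>Frechet derivatives in Euclidean spaces\<close>

abbreviation fD :: "('a::euclidean_space \<Rightarrow> 'b::euclidean_space) \<Rightarrow> 'a \<Rightarrow> 'a \<Rightarrow> 'b" where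
  "fD f x \<equiv> frechet_derivative f (at x)"

lemma fD_works: "f differentiable (at x) \<Longrightarrow> (f has_derivative fD f x) (at x)"
  by (simp add: frechet_derivative_works)

lemma fD_eqI: "(f has_derivative f') (at x) \<Longrightarrow> fD f x = f'"
  using frechet_derivative_at by metis

lemma has_derivative_cong_open:
  assumes "open S" "x \<in> S" "\<And>y. y \<in> S \<Longrightarrow> f y = g y"
  shows "(f has_derivative f') (at x) \<longleftrightarrow> (g has_derivative f') (at x)"
  using assms has_derivative_transform_within_open[of f f' x UNIV S g]
    has_derivative_transform_within_open[of g f' x UNIV S f] by auto

lemma differentiable_cong_open:
  assumes "open S" "x \<in> S" "\<And>y. y \<in> S \<Longrightarrow> f y = g y"
  shows "f differentiable (at x) \<longleftrightarrow> g differentiable (at x)"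
  using has_derivative_cong_open[OF assms] by (simp add: differentiable_def)

lemma fD_cong_open:
  assumes "open S" "x \<in> S" "\<And>y. y \<in> S \<Longrightarrow> f y = g y"
  shows "fD f x = fD g x"
  using has_derivative_cong_open[OF assms] by (simp add: frechet_derivative_def)

lemma linear_fD: "f differentiable (at x) \<Longrightarrow> linear (fD f x)"
  by (simp add: linear_frechet_derivative)

text \<open>\<open>Ck_on\<close> controls derivatives in fixed directions only. Expanding a moving
  direction in the basis brings expressions such as \<open>fD f x (h x)\<close> back to finitely
  many fixed ones.\<close>

lemma linear_basis_expand:
  fixes L :: "'a::euclidean_space \<Rightarrow> 'b::real_vector"
  assumes "linear L"
  shows "L u = (\<Sum>b\<in>Basis. (u \<bullet> b) *\<^sub>R L b)"
proof -
  have "L u = L (\<Sum>b\<in>Basis. (u \<bullet> b) *\<^sub>R b)" by (simp add: euclidean_representation)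
  then show ?thesis using assms by (simp add: linear_sum linear_cmul o_def)
qed

lemma differentiable_bounded_bilinear:
  assumes "bounded_bilinear B" "f differentiable (at x)" "g differentiable (at x)"
  shows "(\<lambda>x. B (f x) (g x)) differentiable (at x)"
  using bounded_bilinear.FDERIV[OF assms(1)] assms(2,3) unfolding differentiable_def by blast

lemma fD_bounded_bilinear:
  assumes "bounded_bilinear B" "f differentiable (at x)" "g differentiable (at x)"
  shows "fD (\<lambda>x. B (f x) (g x)) x u = B (f x) (fD g x u) + B (fD f x u) (g x)"
  using bounded_bilinear.FDERIV[OF assms(1) fD_works[OF assms(2)] fD_works[OF assms(3)]]
  by (subst fD_eqI) auto

lemma fD_add:
  assumes "f differentiable (at x)" "g differentiable (at x)"
  shows "fD (\<lambda>x. f x + g x) x u = fD f x u + fD g x u"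
  using has_derivative_add[OF fD_works[OF assms(1)] fD_works[OF assms(2)]] by (subst fD_eqI) auto

lemma fD_chain:
  assumes "g differentiable (at (f x))" "f differentiable (at x)"
  shows "fD (\<lambda>x. g (f x)) x u = fD g (f x) (fD f x u)"
  using has_derivative_compose[OF fD_works[OF assms(2)], of g "fD g (f x)"] fD_works[OF assms(1)]
  by (subst fD_eqI) auto

lemma differentiable_chain:
  assumes "g differentiable (at (f x))" "f differentiable (at x)"
  shows "(\<lambda>x. g (f x)) differentiable (at x)"
  using differentiable_chain_at[OF assms(2,1)] by (simp add: o_def)


section \<open>Calculus of \<open>C\<^sup>k\<close> functions\<close>

lemma Ck_on_cong:
  assumes "open S" "Ck_on k S f" "\<And>x. x \<in> S \<Longrightarrow> f x = g x"
  shows "Ck_on k S g"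
  using assms(2,3)
proof (induction k arbitrary: f g)
  case 0
  then show ?case using continuous_on_cong by fastforce
next
  case (Suc k)
  show ?case
    unfolding Ck_on.simps
  proof (intro conjI ballI allI)
    fix x assume "x \<in> S"
    then show "g differentiable (at x)"
      using Suc.prems differentiable_cong_open[OF assms(1), of x f g] by auto
  next
    fix u
    show "Ck_on k S (\<lambda>x. fD g x u)"
    proof (rule Suc.IH)
      show "Ck_on k S (\<lambda>x. fD f x u)" using Suc.prems(1) by simp
      show "fD f x u = fD g x u" if "x \<in> S" for x
        using fD_cong_open[OF assms(1) that, of f g] Suc.prems(2) by simp
    qed
  qed
qed

lemma Ck_on_subset: "Ck_on k S f \<Longrightarrow> T \<subseteq> S \<Longrightarrow> Ck_on k T f"
  by (induction k arbitrary: f) (auto intro: continuous_on_subset)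

lemma Ck_on_imp_continuous_on: "Ck_on k S f \<Longrightarrow> continuous_on S f"
  by (cases k) (auto intro!: continuous_at_imp_continuous_on differentiable_imp_continuous_within)

lemma Ck_on_SucD: "Ck_on (Suc k) S f \<Longrightarrow> Ck_on k S f"
proof (induction k arbitrary: f)
  case 0
  show ?case using Ck_on_imp_continuous_on[OF 0] by simp
next
  case (Suc k)
  show ?case
    unfolding Ck_on.simps(2)[of k]
  proof (intro conjI ballI allI)
    fix x assume "x \<in> S"
    then show "f differentiable (at x)" using Suc.prems by simp
  next
    fix u
    show "Ck_on k S (\<lambda>x. fD f x u)"
      using Suc.prems unfolding Ck_on.simps(2)[of "Suc k"] by (intro Suc.IH) blast
  qed
qed

lemma Ck_on_le: "Ck_on k S f \<Longrightarrow> j \<le> k \<Longrightarrow> Ck_on j S f"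
proof (induction k)
  case (Suc k)
  then show ?case using Ck_on_SucD le_Suc_eq by blast
qed simp

lemma Ck_on_local:
  assumes "\<And>x. x \<in> S \<Longrightarrow> \<exists>T. open T \<and> x \<in> T \<and> Ck_on k T f"
  shows "Ck_on k S f"
  using assms
proof (induction k arbitrary: f)
  case 0
  show ?case
    unfolding Ck_on.simps
  proof (rule continuous_at_imp_continuous_on, rule ballI)
    fix x assume "x \<in> S"
    then obtain T where "open T" "x \<in> T" "continuous_on T f" using 0[of x] by auto
    then show "isCont f x" using continuous_on_eq_continuous_at by blast
  qed
next
  case (Suc k)
  show ?case
    unfolding Ck_on.simps
  proof (intro conjI ballI allI)
    fix x assume "x \<in> S"
    then show "f differentiable (at x)" using Suc.prems[of x] by auto
  next
    fix u
    show "Ck_on k S (\<lambda>x. fD f x u)"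
    proof (rule Suc.IH)
      fix x assume "x \<in> S"
      then show "\<exists>T. open T \<and> x \<in> T \<and> Ck_on k T (\<lambda>x. fD f x u)"
        using Suc.prems[of x] by auto
    qed
  qed
qed

lemma Ck_on_const [simp]: "Ck_on k S (\<lambda>x. c)"
  by (induction k arbitrary: c) simp_all

lemma Ck_on_linear:
  assumes "linear L" shows "Ck_on k S L"
proof (cases k)
  case 0
  then show ?thesis using assms by (simp add: linear_continuous_on linear_linear)
next
  case (Suc j)
  have d: "(L has_derivative L) (at x)" for x
    using assms by (simp add: linear_imp_has_derivative)
  then have "fD L x = L" for x using fD_eqI by blast
  then show ?thesis using Suc d by (auto simp: differentiable_def)
qed

lemma Ck_on_add:
  assumes "Ck_on k S f" "Ck_on k S g" "open S"
  shows "Ck_on k S (\<lambda>x. f x + g x)"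
  using assms(1,2)
proof (induction k arbitrary: f g)
  case 0
  then show ?case by (auto intro: continuous_intros)
next
  case (Suc k)
  show ?case
    unfolding Ck_on.simps
  proof (intro conjI ballI allI)
    fix x assume "x \<in> S"
    then show "(\<lambda>x. f x + g x) differentiable (at x)" using Suc.prems by auto
  next
    fix u
    have "Ck_on k S (\<lambda>x. fD f x u + fD g x u)" using Suc.prems by (intro Suc.IH) auto
    then show "Ck_on k S (\<lambda>x. fD (\<lambda>x. f x + g x) x u)"
      by (rule Ck_on_cong[OF assms(3)]) (use Suc.prems in \<open>auto simp: fD_add\<close>)
  qed
qed

lemma Ck_on_sum:
  assumes "finite I" "\<And>i. i \<in> I \<Longrightarrow> Ck_on k S (f i)" "open S"
  shows "Ck_on k S (\<lambda>x. \<Sum>i\<in>I. f i x)"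
  using assms(1,2) by (induction I rule: finite_induct) (auto intro: Ck_on_add assms(3))

text \<open>In the Leibniz rule each product pairs a derivative with an undifferentiated factor.
  Hence the induction is over arbitrary pairs \<open>f\<close>, \<open>g\<close>, and the
  undifferentiated factor is lowered to the regularity of the other one.\<close>

lemma Ck_on_bounded_bilinear:
  assumes B: "bounded_bilinear B" and "Ck_on k S f" "Ck_on k S g" and S: "open S"
  shows "Ck_on k S (\<lambda>x. B (f x) (g x))"
  using assms(2,3)
proof (induction k arbitrary: f g)
  case 0
  then show ?case using bounded_bilinear.continuous_on[OF B] by auto
next
  case (Suc k)
  show ?case
    unfolding Ck_on.simps
  proof (intro conjI ballI allI)
    fix x assume "x \<in> S"
    then show "(\<lambda>x. B (f x) (g x)) differentiable (at x)"
      using Suc.prems by (auto intro: differentiable_bounded_bilinear[OF B])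
  next
    fix u
    have "Ck_on k S (\<lambda>x. B (f x) (fD g x u) + B (fD f x u) (g x))"
      using Suc.prems Ck_on_SucD[OF Suc.prems(1)] Ck_on_SucD[OF Suc.prems(2)]
      by (intro Ck_on_add Suc.IH S) auto
    then show "Ck_on k S (\<lambda>x. fD (\<lambda>x. B (f x) (g x)) x u)"
      by (rule Ck_on_cong[OF S]) (use Suc.prems in \<open>auto simp: fD_bounded_bilinear[OF B]\<close>)
  qed
qed

lemmas Ck_on_scaleR = Ck_on_bounded_bilinear[OF bounded_bilinear_scaleR]
lemmas Ck_on_inner = Ck_on_bounded_bilinear[OF bounded_bilinear_inner]
lemmas Ck_on_mult = Ck_on_bounded_bilinear[OF bounded_bilinear_mult]

text \<open>The chain rule applies the derivative of \<open>g\<close> to the moving direction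
  \<open>fD f x u\<close>. Expanded in the basis, this is a sum of products of components of
  \<open>fD f x u\<close> with \<open>fD g (f x) b\<close>; the latter are again compositions with
  \<open>f\<close>, so the induction keeps \<open>g\<close> arbitrary.\<close>

lemma Ck_on_compose:
  assumes "Ck_on k T g" "Ck_on k S f" "f ` S \<subseteq> T" and S: "open S"
  shows "Ck_on k S (\<lambda>x. g (f x))"
  using assms(1,2)
proof (induction k arbitrary: g)
  case 0
  then show ?case using assms(3) continuous_on_compose2 by auto
next
  case (Suc k)
  have dg: "g differentiable (at (f x))" if "x \<in> S" for x using Suc.prems(1) that assms(3) by auto
  have df: "f differentiable (at x)" if "x \<in> S" for x using Suc.prems(2) that by auto
  show ?case
    unfolding Ck_on.simps
  proof (intro conjI ballI allI)
    fix x assume "x \<in> S"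
    then show "(\<lambda>x. g (f x)) differentiable (at x)" using dg df differentiable_chain by blast
  next
    fix u
    have "Ck_on k S (\<lambda>x. \<Sum>b\<in>Basis. (fD f x u \<bullet> b) *\<^sub>R fD g (f x) b)"
      using Suc.prems Ck_on_SucD[OF Suc.prems(2)]
      by (intro Ck_on_sum Ck_on_scaleR Ck_on_inner Suc.IH S) auto
    then show "Ck_on k S (\<lambda>x. fD (\<lambda>x. g (f x)) x u)"
    proof (rule Ck_on_cong[OF S])
      fix x assume "x \<in> S"
      then show "(\<Sum>b\<in>Basis. (fD f x u \<bullet> b) *\<^sub>R fD g (f x) b) = fD (\<lambda>x. g (f x)) x u"
        using linear_basis_expand[OF linear_fD[OF dg], of x "fD f x u"] fD_chain dg df by metis
    qed
  qed
qed

lemma Ck_on_Pair: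
  fixes f :: "'a::euclidean_space \<Rightarrow> 'b::euclidean_space" and g :: "'a \<Rightarrow> 'c::euclidean_space"
  assumes "Ck_on k S f" "Ck_on k S g" and S: "open S"
  shows "Ck_on k S (\<lambda>x. (f x, g x))"
proof -
  have "Ck_on k S (\<lambda>x. (f x, 0 :: 'c))"
    by (rule Ck_on_compose[of k UNIV "\<lambda>z. (z, 0)"])
      (use assms in \<open>auto intro!: Ck_on_linear linearI\<close>)
  moreover have "Ck_on k S (\<lambda>x. (0 :: 'b, g x))"
    by (rule Ck_on_compose[of k UNIV "\<lambda>z. (0, z)"])
      (use assms in \<open>auto intro!: Ck_on_linear linearI\<close>)
  ultimately have "Ck_on k S (\<lambda>x. (f x, 0) + (0, g x))"
    using S by (rule Ck_on_add)
  then show ?thesis by simp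
qed

lemma Ck_on_fst: "Ck_on k S fst"
  by (intro Ck_on_linear linear_fst)

lemma Ck_on_snd: "Ck_on k S snd"
  by (intro Ck_on_linear linear_snd)

lemma Ck_on_fst': "Ck_on k S f \<Longrightarrow> open S \<Longrightarrow> Ck_on k S (\<lambda>x. fst (f x))"
  by (rule Ck_on_compose[of _ UNIV fst]) (auto intro: Ck_on_fst)

lemma Ck_on_snd': "Ck_on k S f \<Longrightarrow> open S \<Longrightarrow> Ck_on k S (\<lambda>x. snd (f x))"
  by (rule Ck_on_compose[of _ UNIV snd]) (auto intro: Ck_on_snd)

lemma Ck_on_fD:
  assumes "Ck_on (Suc k) S f" "Ck_on k S h" and S: "open S"
  shows "Ck_on k S (\<lambda>x. fD f x (h x))"
proof -
  have "Ck_on k S (\<lambda>x. \<Sum>b\<in>Basis. (h x \<bullet> b) *\<^sub>R fD f x b)"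
    using assms by (intro Ck_on_sum Ck_on_scaleR Ck_on_inner S) auto
  then show ?thesis
  proof (rule Ck_on_cong[OF S])
    fix x assume "x \<in> S"
    then show "(\<Sum>b\<in>Basis. (h x \<bullet> b) *\<^sub>R fD f x b) = fD f x (h x)"
      using linear_basis_expand[OF linear_fD, of f x "h x"] assms(1) by auto
  qed
qed

section \<open>Smooth functions\<close>

lemma smooth_onD: "smooth_on S f \<Longrightarrow> Ck_on k S f"
  by (simp add: smooth_on_def)

lemma smooth_on_imp_differentiable: "smooth_on S f \<Longrightarrow> x \<in> S \<Longrightarrow> f differentiable (at x)"
  using smooth_onD[of S f 1] by simp

lemma smooth_on_imp_continuous_on: "smooth_on S f \<Longrightarrow> continuous_on S f"
  using smooth_onD[of S f 0] by simp

lemma smooth_on_cong: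
  assumes "open S" "smooth_on S f" "\<And>x. x \<in> S \<Longrightarrow> f x = g x"
  shows "smooth_on S g"
  using assms Ck_on_cong unfolding smooth_on_def by blast

lemma smooth_on_subset: "smooth_on S f \<Longrightarrow> T \<subseteq> S \<Longrightarrow> smooth_on T f"
  unfolding smooth_on_def using Ck_on_subset by blast

lemma smooth_on_const [simp]: "smooth_on S (\<lambda>x. c)"
  by (simp add: smooth_on_def)

lemma smooth_on_linear: "linear L \<Longrightarrow> smooth_on S L"
  by (simp add: smooth_on_def Ck_on_linear)

lemma smooth_on_add: "smooth_on S f \<Longrightarrow> smooth_on S g \<Longrightarrow> open S \<Longrightarrow> smooth_on S (\<lambda>x. f x + g x)"
  by (simp add: smooth_on_def Ck_on_add)

lemma smooth_on_sum:
  "finite I \<Longrightarrow> (\<And>i. i \<in> I \<Longrightarrow> smooth_on S (f i)) \<Longrightarrow> open S \<Longrightarrow> smooth_on S (\<lambda>x. \<Sum>i\<in>I. f i x)"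
  by (simp add: smooth_on_def Ck_on_sum)

lemma smooth_on_scaleR:
  "smooth_on S f \<Longrightarrow> smooth_on S g \<Longrightarrow> open S \<Longrightarrow> smooth_on S (\<lambda>x. f x *\<^sub>R g x)"
  by (simp add: smooth_on_def Ck_on_scaleR)

lemma smooth_on_mult:
  fixes f g :: "'a::euclidean_space \<Rightarrow> real"
  shows "smooth_on S f \<Longrightarrow> smooth_on S g \<Longrightarrow> open S \<Longrightarrow> smooth_on S (\<lambda>x. f x * g x)"
  by (simp add: smooth_on_def Ck_on_mult)

lemma smooth_on_inner:
  "smooth_on S f \<Longrightarrow> smooth_on S g \<Longrightarrow> open S \<Longrightarrow> smooth_on S (\<lambda>x. f x \<bullet> g x)"
  by (simp add: smooth_on_def Ck_on_inner)

lemma smooth_on_compose: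
  "smooth_on T g \<Longrightarrow> smooth_on S f \<Longrightarrow> f ` S \<subseteq> T \<Longrightarrow> open S \<Longrightarrow> smooth_on S (\<lambda>x. g (f x))"
  unfolding smooth_on_def using Ck_on_compose by blast

lemma smooth_on_Pair:
  "smooth_on S f \<Longrightarrow> smooth_on S g \<Longrightarrow> open S \<Longrightarrow> smooth_on S (\<lambda>x. (f x, g x))"
  by (simp add: smooth_on_def Ck_on_Pair)

lemma smooth_on_fst: "smooth_on S f \<Longrightarrow> open S \<Longrightarrow> smooth_on S (\<lambda>x. fst (f x))"
  by (simp add: smooth_on_def Ck_on_fst')

lemma smooth_on_snd: "smooth_on S f \<Longrightarrow> open S \<Longrightarrow> smooth_on S (\<lambda>x. snd (f x))"
  by (simp add: smooth_on_def Ck_on_snd')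

lemma smooth_on_ident [simp]: "smooth_on S (\<lambda>x. x)"
  by (simp add: smooth_on_linear linear_id[unfolded id_def])

lemma smooth_on_fD:
  "smooth_on S f \<Longrightarrow> smooth_on S h \<Longrightarrow> open S \<Longrightarrow> smooth_on S (\<lambda>x. fD f x (h x))"
  unfolding smooth_on_def using Ck_on_fD by blast

section \<open>Derivatives along curves and symmetry of second derivatives\<close>

lemma has_vector_derivative_fD:
  assumes "f differentiable (at (\<gamma> t))" "(\<gamma> has_vector_derivative \<gamma>') (at t)"
  shows "((\<lambda>s. f (\<gamma> s)) has_vector_derivative fD f (\<gamma> t) \<gamma>') (at t)"
proof -
  have "((\<lambda>s. f (\<gamma> s)) has_derivative (\<lambda>h. fD f (\<gamma> t) (h *\<^sub>R \<gamma>'))) (at t)"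
    using has_derivative_compose[of \<gamma> _ t UNIV f] fD_works[OF assms(1)] assms(2)
    unfolding has_vector_derivative_def by blast
  then show ?thesis
    unfolding has_vector_derivative_def using linear_cmul[OF linear_fD[OF assms(1)]] by simp
qed

lemma has_real_derivative_fD_line:
  fixes f :: "'a::euclidean_space \<Rightarrow> real"
  assumes "f differentiable (at (p + s *\<^sub>R a))"
  shows "((\<lambda>s. f (p + s *\<^sub>R a)) has_real_derivative fD f (p + s *\<^sub>R a) a) (at s)"
proof -
  have "((\<lambda>s. p + s *\<^sub>R a) has_vector_derivative a) (at s)"
    by (auto intro!: derivative_eq_intros)
  then show ?thesis
    using has_vector_derivative_fD[of f "\<lambda>s. p + s *\<^sub>R a" s a] assms
    by (simp add: has_real_derivative_iff_has_vector_derivative)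
qed

text \<open>Two mean value theorems in a row: along \<open>a\<close> for the difference of
  \<open>f\<close> in direction \<open>b\<close>, then along \<open>b\<close> for the derivative
  along \<open>a\<close>. The left-hand side is symmetric in \<open>a\<close> and \<open>b\<close>
  and the right-hand side is not, which forces the two orders of differentiation to agree in the
  limit.\<close>

lemma second_difference:
  fixes f :: "'a::euclidean_space \<Rightarrow> real"
  assumes f: "Ck_on 2 S f" and h: "h > 0"
    and S: "\<And>s t. s \<in> {0..h} \<Longrightarrow> t \<in> {0..h} \<Longrightarrow> x + s *\<^sub>R a + t *\<^sub>R b \<in> S"
  obtains s t where "s \<in> {0..h}" "t \<in> {0..h}"
    "f (x + h *\<^sub>R a + h *\<^sub>R b) - f (x + h *\<^sub>R a) - f (x + h *\<^sub>R b) + f x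
      = h * h * fD (\<lambda>y. fD f y a) (x + s *\<^sub>R a + t *\<^sub>R b) b"
proof -
  have d1: "f differentiable (at y)" if "y \<in> S" for y
    using f that by (simp add: numeral_2_eq_2)
  have d2: "(\<lambda>y. fD f y a) differentiable (at y)" if "y \<in> S" for y
    using f that by (simp add: numeral_2_eq_2)
  define \<phi> where "\<phi> s = f (x + h *\<^sub>R b + s *\<^sub>R a) - f (x + s *\<^sub>R a)" for s
  have "(\<phi> has_real_derivative fD f (x + h *\<^sub>R b + s *\<^sub>R a) a - fD f (x + s *\<^sub>R a) a) (at s)"
    if "0 \<le> s" "s \<le> h" for s
    unfolding \<phi>_def
    using S[of s 0] S[of s h] that h
    by (intro DERIV_diff has_real_derivative_fD_line d1) (auto simp: algebra_simps)
  from MVT2[OF h this] obtain s where s: "0 < s" "s < h"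
    and 1: "\<phi> h - \<phi> 0 = (h - 0) * (fD f (x + h *\<^sub>R b + s *\<^sub>R a) a - fD f (x + s *\<^sub>R a) a)"
    by blast
  define \<psi> where "\<psi> t = fD f (x + s *\<^sub>R a + t *\<^sub>R b) a" for t
  have "(\<psi> has_real_derivative fD (\<lambda>y. fD f y a) (x + s *\<^sub>R a + t *\<^sub>R b) b) (at t)"
    if "0 \<le> t" "t \<le> h" for t
    unfolding \<psi>_def
    using S[of s t] that s
    by (intro has_real_derivative_fD_line[of "\<lambda>y. fD f y a"] d2) auto
  from MVT2[OF h this] obtain t where t: "0 < t" "t < h"
    and 2: "\<psi> h - \<psi> 0 = (h - 0) * fD (\<lambda>y. fD f y a) (x + s *\<^sub>R a + t *\<^sub>R b) b" by blast
  have "f (x + h *\<^sub>R a + h *\<^sub>R b) - f (x + h *\<^sub>R a) - f (x + h *\<^sub>R b) + f x = \<phi> h - \<phi> 0"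
    by (simp add: \<phi>_def algebra_simps)
  also have "\<dots> = h * (\<psi> h - \<psi> 0)"
    using 1 by (simp add: \<psi>_def algebra_simps)
  also have "\<dots> = h * h * fD (\<lambda>y. fD f y a) (x + s *\<^sub>R a + t *\<^sub>R b) b"
    using 2 by simp
  finally show ?thesis using s t that[of s t] by auto
qed

lemma second_derivative_symmetric_real:
  fixes f :: "'a::euclidean_space \<Rightarrow> real"
  assumes f: "Ck_on 2 S f" and S: "open S" "x \<in> S"
  shows "fD (\<lambda>y. fD f y b) x a = fD (\<lambda>y. fD f y a) x b"
proof (rule ccontr)
  assume neq: "\<not> ?thesis"
  \<comment> \<open>Half the supposed gap: values within \<open>e\<close> of the two mixed
    derivatives cannot coincide.\<close>
  define e where "e = \<bar>fD (\<lambda>y. fD f y b) x a - fD (\<lambda>y. fD f y a) x b\<bar> / 2"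
  have e: "e > 0" using neq by (simp add: e_def)
  have "isCont (\<lambda>y. fD (\<lambda>y. fD f y b) y a) x" "isCont (\<lambda>y. fD (\<lambda>y. fD f y a) y b) x"
    using f S by (auto simp: numeral_2_eq_2 continuous_on_eq_continuous_at)
  then have "\<forall>\<^sub>F y in nhds x. dist (fD (\<lambda>y. fD f y b) y a) (fD (\<lambda>y. fD f y b) x a) < e"
    "\<forall>\<^sub>F y in nhds x. dist (fD (\<lambda>y. fD f y a) y b) (fD (\<lambda>y. fD f y a) x b) < e"
    using e by (auto simp: continuous_at_imp_continuous_within isCont_def tendsto_iff eventually_at_filter
        elim!: eventually_mono)
  moreover have "\<forall>\<^sub>F y in nhds x. y \<in> S" using S by (simp add: eventually_nhds_in_open)
  ultimately have "\<forall>\<^sub>F y in nhds x. y \<in> S \<and> dist (fD (\<lambda>y. fD f y b) y a) (fD (\<lambda>y. fD f y b) x a) < e \<and>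
     dist (fD (\<lambda>y. fD f y a) y b) (fD (\<lambda>y. fD f y a) x b) < e"
    by eventually_elim auto
  then obtain d where d: "d > 0" and close: "\<And>y. dist y x < d \<Longrightarrow> y \<in> S \<and>
     dist (fD (\<lambda>y. fD f y b) y a) (fD (\<lambda>y. fD f y b) x a) < e \<and>
     dist (fD (\<lambda>y. fD f y a) y b) (fD (\<lambda>y. fD f y a) x b) < e"
    unfolding eventually_nhds_metric by blast
  \<comment> \<open>With this \<open>h\<close> the parallelogram with sides \<open>a\<close> and
    \<open>b\<close> scaled by \<open>h\<close> stays in the ball of radius \<open>d\<close>. The
    added \<open>1\<close> keeps the denominator positive when both vectors are zero.\<close>
  define h where "h = d / (2 * (norm a + norm b + 1))"
  have h: "h > 0" using d by (simp add: h_def add_nonneg_pos)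
  have near: "dist (x + s *\<^sub>R u + t *\<^sub>R w) x < d"
    if "s \<in> {0..h}" "t \<in> {0..h}" "norm u + norm w = norm a + norm b" for s t u w
  proof -
    have "dist (x + s *\<^sub>R u + t *\<^sub>R w) x \<le> s * norm u + t * norm w"
      using that norm_triangle_ineq[of "s *\<^sub>R u" "t *\<^sub>R w"] by (simp add: dist_norm add.assoc)
    also have "\<dots> \<le> h * norm u + h * norm w"
      using that by (intro add_mono mult_right_mono) auto
    also have "\<dots> = h * (norm a + norm b)" using that(3) by (metis distrib_left)
    also have "\<dots> < h * (2 * (norm a + norm b + 1))" using h by (intro mult_strict_left_mono) (auto simp: add_nonneg_pos add_strict_increasing2)
    also have "\<dots> = d" unfolding h_def by (simp add: add_nonneg_pos order_less_imp_not_eq2)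
    finally show ?thesis .
  qed
  obtain s t where st: "s \<in> {0..h}" "t \<in> {0..h}"
    and eq1: "f (x + h *\<^sub>R a + h *\<^sub>R b) - f (x + h *\<^sub>R a) - f (x + h *\<^sub>R b) + f x
      = h * h * fD (\<lambda>y. fD f y a) (x + s *\<^sub>R a + t *\<^sub>R b) b"
    using second_difference[OF f h, of x a b] near[of _ _ a b] close by metis
  obtain s' t' where st': "s' \<in> {0..h}" "t' \<in> {0..h}"
    and eq2: "f (x + h *\<^sub>R b + h *\<^sub>R a) - f (x + h *\<^sub>R b) - f (x + h *\<^sub>R a) + f x
      = h * h * fD (\<lambda>y. fD f y b) (x + s' *\<^sub>R b + t' *\<^sub>R a) a"
    using second_difference[OF f h, of x b a] near[of _ _ b a] close by (metis add.commute)
  have "h * h * fD (\<lambda>y. fD f y a) (x + s *\<^sub>R a + t *\<^sub>R b) b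
     = h * h * fD (\<lambda>y. fD f y b) (x + s' *\<^sub>R b + t' *\<^sub>R a) a"
    unfolding eq1[symmetric] eq2[symmetric] by (simp add: algebra_simps)
  then have "fD (\<lambda>y. fD f y a) (x + s *\<^sub>R a + t *\<^sub>R b) b
     = fD (\<lambda>y. fD f y b) (x + s' *\<^sub>R b + t' *\<^sub>R a) a" using h by simp
  moreover have "dist (fD (\<lambda>y. fD f y a) (x + s *\<^sub>R a + t *\<^sub>R b) b) (fD (\<lambda>y. fD f y a) x b) < e"
    using close near[OF st, of a b] by auto
  moreover have "dist (fD (\<lambda>y. fD f y b) (x + s' *\<^sub>R b + t' *\<^sub>R a) a) (fD (\<lambda>y. fD f y b) x a) < e"
    using close near[OF st', of b a] by auto
  ultimately show False unfolding e_def dist_real_def by (simp add: abs_if split: if_splits)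
qed

lemma fD_inner_left:
  assumes "f differentiable (at x)"
  shows "fD (\<lambda>x. f x \<bullet> c) x u = fD f x u \<bullet> c"
  using has_derivative_inner_left[OF fD_works[OF assms], of c] by (subst fD_eqI) auto

lemma second_derivative_symmetric:
  assumes f: "Ck_on 2 S f" and S: "open S" "x \<in> S"
  shows "fD (\<lambda>y. fD f y b) x a = fD (\<lambda>y. fD f y a) x b"
proof (rule euclidean_eqI)
  fix i
  have d1: "f differentiable (at y)" if "y \<in> S" for y
    using f that by (simp add: numeral_2_eq_2)
  have d2: "(\<lambda>y. fD f y u) differentiable (at x)" for u
    using f S by (simp add: numeral_2_eq_2)
  have "fD (\<lambda>y. fD f y u) x v \<bullet> i = fD (\<lambda>y. fD (\<lambda>y. f y \<bullet> i) y u) x v" for u v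
  proof -
    have "fD (\<lambda>y. fD f y u) x v \<bullet> i = fD (\<lambda>y. fD f y u \<bullet> i) x v"
      using fD_inner_left[OF d2] by simp
    also have "fD (\<lambda>y. fD f y u \<bullet> i) x = fD (\<lambda>y. fD (\<lambda>y. f y \<bullet> i) y u) x"
      by (rule fD_cong_open[OF S]) (simp add: fD_inner_left d1)
    finally show ?thesis .
  qed
  moreover have "Ck_on 2 S (\<lambda>y. f y \<bullet> i)"
    using Ck_on_inner[OF f Ck_on_const S(1)] .
  ultimately show "fD (\<lambda>y. fD f y b) x a \<bullet> i = fD (\<lambda>y. fD f y a) x b \<bullet> i"
    using second_derivative_symmetric_real[OF _ S] by metis
qed


section \<open>Metrics and Christoffel symbols in coordinates\<close>

definition inner_form :: "('e::euclidean_space \<Rightarrow> 'e \<Rightarrow> real) \<Rightarrow> bool" where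
  "inner_form g \<longleftrightarrow> bilinear g \<and> (\<forall>a b. g a b = g b a) \<and> (\<forall>a. a \<noteq> 0 \<longrightarrow> g a a > 0)"

lemma inner_formD:
  assumes "inner_form g"
  shows "linear (g a)" "linear (\<lambda>a. g a b)" "g a b = g b a" "a \<noteq> 0 \<Longrightarrow> g a a > 0" "bilinear g"
  using assms by (auto simp: inner_form_def bilinear_def)

lemma inner_form_cancel:
  assumes g: "inner_form g" and "\<And>w. g a w = g b w"
  shows "a = b"
proof (rule ccontr)
  assume "a \<noteq> b"
  then have "g (a - b) (a - b) > 0" using inner_formD(4)[OF g] by simp
  moreover have "g (a - b) (a - b) = g a (a - b) - g b (a - b)"
    using linear_diff[OF inner_formD(2)[OF g]] .
  ultimately show False using assms(2) by simp
qed

lemma bilinear_basis_expand: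
  fixes B :: "'a::euclidean_space \<Rightarrow> 'b::euclidean_space \<Rightarrow> 'c::real_vector"
  assumes "bilinear B"
  shows "B a b = (\<Sum>i\<in>Basis. \<Sum>j\<in>Basis. ((a \<bullet> i) * (b \<bullet> j)) *\<^sub>R B i j)"
proof -
  have "B a b = (\<Sum>i\<in>Basis. (a \<bullet> i) *\<^sub>R B i b)"
    using linear_basis_expand[of "\<lambda>a. B a b" a] assms by (simp add: bilinear_def)
  also have "\<dots> = (\<Sum>i\<in>Basis. (a \<bullet> i) *\<^sub>R (\<Sum>j\<in>Basis. (b \<bullet> j) *\<^sub>R B i j))"
    using linear_basis_expand[of "B i" b for i] assms by (metis (no_types, lifting) bilinear_def sum.cong)
  finally show ?thesis by (simp add: scaleR_sum_right)
qed

text \<open>\<open>A\<close> represents the form with respect to the Euclidean inner product.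
  Definiteness makes it injective, hence invertible in finite dimension, and \<open>B\<close> is its
  inverse.\<close>

lemma inner_form_riesz:
  fixes g :: "'e::euclidean_space \<Rightarrow> 'e \<Rightarrow> real"
  assumes g: "inner_form g"
  obtains B where "linear B" "\<And>v w. g (B v) w = v \<bullet> w"
proof -
  define A where "A v = (\<Sum>b\<in>Basis. g v b *\<^sub>R b)" for v
  have A: "A v \<bullet> w = g v w" for v w
  proof -
    have "A v \<bullet> w = (\<Sum>b\<in>Basis. (w \<bullet> b) * g v b)"
      by (simp add: A_def inner_sum_left inner_commute[of w] mult.commute)
    then show ?thesis using linear_basis_expand[OF inner_formD(1)[OF g], of v w] by simp
  qed
  have lA: "linear A"
  proof (rule linearI)
    show "A (x + y) = A x + A y" for x y
      by (simp add: A_def linear_add[OF inner_formD(2)[OF g]] scaleR_add_left sum.distrib)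
    show "A (r *\<^sub>R x) = r *\<^sub>R A x" for r x
      by (simp add: A_def linear_cmul[OF inner_formD(2)[OF g]] scaleR_sum_right)
  qed
  have "inj A"
    by (rule injI, rule inner_form_cancel[OF g]) (metis A)
  then obtain B where "linear B" "\<And>x. A (B x) = x"
    using linear_injective_isomorphism[OF lA] by metis
  then show ?thesis using that A by metis
qed

text \<open>A product rule for a factor \<open>k\<close> that is merely continuous: the term with
  the derivative of \<open>k\<close> would be multiplied by \<open>h x = 0\<close>. It serves to
  differentiate a solution of a linear equation that is so far known only to be continuous.\<close>

lemma continuous_mult_differentiable_zero:
  fixes h k :: "'a::euclidean_space \<Rightarrow> real"
  assumes h: "h differentiable (at x)" "h x = 0" and k: "isCont k x"
  shows "(\<lambda>y. k y * h y) differentiable (at x)"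
proof -
  have H: "(h has_derivative fD h x) (at x)" using fD_works h by blast
  have "((\<lambda>y. k y * h y) has_derivative (\<lambda>v. k x * fD h x v)) (at x)"
  proof -
    have 1: "((\<lambda>y. norm (h y - h x - fD h x (y - x)) / norm (y - x)) \<longlongrightarrow> 0) (at x)"
      using H unfolding has_derivative_iff_norm by blast
    obtain K where K: "\<And>v. norm (fD h x v) \<le> norm v * K"
      using bounded_linear.bounded[OF has_derivative_bounded_linear[OF H]] by blast
    have k0: "((\<lambda>y. \<bar>k y - k x\<bar> * K) \<longlongrightarrow> 0) (at x)"
      using k unfolding isCont_def by (auto intro!: tendsto_eq_intros)
    have k1: "((\<lambda>y. \<bar>k y\<bar> * (norm (h y - h x - fD h x (y - x)) / norm (y - x))) \<longlongrightarrow> 0) (at x)"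
      using tendsto_mult[OF tendsto_rabs[OF k[unfolded isCont_def]] 1] by simp
    have "((\<lambda>y. norm (k y * h y - k x * h x - k x * fD h x (y - x)) / norm (y - x)) \<longlongrightarrow> 0) (at x)"
    proof (rule Lim_null_comparison)
      show "((\<lambda>y. \<bar>k y\<bar> * (norm (h y - h x - fD h x (y - x)) / norm (y - x)) + \<bar>k y - k x\<bar> * K) \<longlongrightarrow> 0) (at x)"
        using tendsto_add[OF k1 k0] by simp
      show "\<forall>\<^sub>F y in at x. norm (norm (k y * h y - k x * h x - k x * fD h x (y - x)) / norm (y - x))
        \<le> \<bar>k y\<bar> * (norm (h y - h x - fD h x (y - x)) / norm (y - x)) + \<bar>k y - k x\<bar> * K"
      proof (rule eventually_at_filter[THEN iffD2], rule always_eventually, intro allI impI)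
        fix y assume "y \<noteq> x"
        then have n: "norm (y - x) > 0" by simp
        \<comment> \<open>The first summand is small because of the remainder of \<open>h\<close>,
          the second because \<open>k\<close> is continuous and the derivative of \<open>h\<close>
          is bounded.\<close>
        have "k y * h y - k x * h x - k x * fD h x (y - x)
          = k y * (h y - h x - fD h x (y - x)) + (k y - k x) * fD h x (y - x)"
          using h(2) by (simp add: algebra_simps)
        then have "norm (k y * h y - k x * h x - k x * fD h x (y - x))
          \<le> \<bar>k y\<bar> * norm (h y - h x - fD h x (y - x)) + \<bar>k y - k x\<bar> * (norm (y - x) * K)"
          using K[of "y - x"] by (auto simp: abs_mult intro!: order.trans[OF abs_triangle_ineq] mult_left_mono)
        then have "norm (k y * h y - k x * h x - k x * fD h x (y - x)) / norm (y - x)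
          \<le> (\<bar>k y\<bar> * norm (h y - h x - fD h x (y - x)) + \<bar>k y - k x\<bar> * (norm (y - x) * K)) / norm (y - x)"
          by (rule divide_right_mono) simp
        also have "\<dots> = \<bar>k y\<bar> * (norm (h y - h x - fD h x (y - x)) / norm (y - x)) + \<bar>k y - k x\<bar> * K"
          using n by (simp add: field_simps)
        finally show "norm (norm (k y * h y - k x * h x - k x * fD h x (y - x)) / norm (y - x))
        \<le> \<bar>k y\<bar> * (norm (h y - h x - fD h x (y - x)) / norm (y - x)) + \<bar>k y - k x\<bar> * K" by simp
      qed
    qed
    then show ?thesis
      unfolding has_derivative_iff_norm
      using bounded_linear_compose[OF bounded_linear_mult_right[of "k x"] has_derivative_bounded_linear[OF H]]
      by (simp add: o_def)
  qed
  then show ?thesis by (auto simp: differentiable_def)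
qed


section \<open>The Koszul formula for a metric in one chart\<close>

definition koszul :: "('e::euclidean_space \<Rightarrow> 'e \<Rightarrow> 'e \<Rightarrow> real) \<Rightarrow> 'e \<Rightarrow> 'e \<Rightarrow> 'e \<Rightarrow> 'e \<Rightarrow> real" where
  "koszul g y a b w =
     (fD (\<lambda>y'. g y' b w) y a + fD (\<lambda>y'. g y' a w) y b - fD (\<lambda>y'. g y' a b) y w) / 2"

text \<open>\<open>koszul\<close> is the right-hand side of the Koszul formula for coordinate
  fields, whose brackets vanish. Both notions take a family of forms instead of a manifold, so that
  metrics in different coordinates can be compared directly.\<close>

definition chris :: "('e::euclidean_space \<Rightarrow> 'e \<Rightarrow> 'e \<Rightarrow> real) \<Rightarrow> 'e \<Rightarrow> 'e \<Rightarrow> 'e \<Rightarrow> 'e" where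
  "chris g y a b = (THE z. \<forall>w. g y z w = koszul g y a b w)"

lemma christoffel_eq_chris: "christoffel M c = chris (metric_coord M c)"
  by (simp add: fun_eq_iff christoffel_def chris_def koszul_def)

text \<open>The metric as seen in one chart. Smoothness is assumed for constant arguments
  \<open>a\<close> and \<open>b\<close>; bilinearity and the basis expansion extend it to varying
  ones.\<close>

locale coord_metric =
  fixes S :: "'e::euclidean_space set" and g :: "'e \<Rightarrow> 'e \<Rightarrow> 'e \<Rightarrow> real"
  assumes S: "open S"
    and form: "y \<in> S \<Longrightarrow> inner_form (g y)"
    and smooth: "smooth_on S (\<lambda>y. g y a b)"
begin

lemma subset: "open T \<Longrightarrow> T \<subseteq> S \<Longrightarrow> coord_metric T g"
  using form smooth smooth_on_subset by unfold_locales blast+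

lemma diff_metric: "y \<in> S \<Longrightarrow> (\<lambda>y. g y a b) differentiable (at y)"
  using smooth smooth_on_imp_differentiable by blast

lemma metric_expand:
  "y \<in> S \<Longrightarrow> g y a b = (\<Sum>i\<in>Basis. \<Sum>j\<in>Basis. ((a \<bullet> i) * (b \<bullet> j)) *\<^sub>R g y i j)"
  using bilinear_basis_expand[OF inner_formD(5)[OF form]] by blast

lemma smooth_metric:
  assumes "open T" "smooth_on T \<rho>" "smooth_on T \<alpha>" "smooth_on T \<beta>" "\<rho> ` T \<subseteq> S"
  shows "smooth_on T (\<lambda>z. g (\<rho> z) (\<alpha> z) (\<beta> z))"
proof (rule smooth_on_cong[OF assms(1)])
  show "smooth_on T (\<lambda>z. \<Sum>i\<in>Basis. \<Sum>j\<in>Basis. ((\<alpha> z \<bullet> i) * (\<beta> z \<bullet> j)) *\<^sub>R g (\<rho> z) i j)"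
    using smooth_on_compose[OF smooth assms(2,5,1)]
    by (intro smooth_on_sum smooth_on_scaleR smooth_on_mult smooth_on_inner assms smooth_on_const) auto
  show "(\<Sum>i\<in>Basis. \<Sum>j\<in>Basis. ((\<alpha> z \<bullet> i) * (\<beta> z \<bullet> j)) *\<^sub>R g (\<rho> z) i j) = g (\<rho> z) (\<alpha> z) (\<beta> z)"
    if "z \<in> T" for z
    using metric_expand[of "\<rho> z" "\<alpha> z" "\<beta> z"] assms(5) that by auto
qed

lemma fD_metric_linear: "y \<in> S \<Longrightarrow> linear (fD (\<lambda>y. g y a b) y)"
  using linear_fD[OF diff_metric] .

text \<open>Linear relations between the functions \<open>g y a b\<close> hold on the whole open set
  \<open>S\<close>, hence may be differentiated in \<open>y\<close>.\<close>

lemma fD_metric_bilinear: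
  assumes y: "y \<in> S"
  shows "bilinear (\<lambda>a b. fD (\<lambda>y. g y a b) y h)"
proof -
  have add1: "fD (\<lambda>y. g y (a + a') b) y h = fD (\<lambda>y. g y a b) y h + fD (\<lambda>y. g y a' b) y h" for a a' b
  proof -
    have "fD (\<lambda>y. g y (a + a') b) y = fD (\<lambda>y. g y a b + g y a' b) y"
      by (rule fD_cong_open[OF S y]) (simp add: linear_add[OF inner_formD(2)[OF form]])
    then show ?thesis using fD_add[OF diff_metric diff_metric, OF y y] by simp
  qed
  have cm1: "fD (\<lambda>y. g y (r *\<^sub>R a) b) y h = r * fD (\<lambda>y. g y a b) y h" for r a b
  proof -
    have "fD (\<lambda>y. g y (r *\<^sub>R a) b) y = fD (\<lambda>y. r * g y a b) y"
      by (rule fD_cong_open[OF S y]) (simp add: linear_cmul[OF inner_formD(2)[OF form]])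
    then show ?thesis
      using fD_bounded_bilinear[OF bounded_bilinear_mult differentiable_const diff_metric[OF y], of r] by simp
  qed
  have sym: "fD (\<lambda>y. g y a b) y = fD (\<lambda>y. g y b a) y" for a b
    by (rule fD_cong_open[OF S y]) (metis inner_formD(3)[OF form])
  show ?thesis
    unfolding bilinear_def
  proof (intro conjI allI)
    show "linear (\<lambda>a. fD (\<lambda>y. g y a b) y h)" for b
      by (rule linearI) (simp_all add: add1 cm1)
    then show "linear (\<lambda>b. fD (\<lambda>y. g y a b) y h)" for a
      by (subst sym)
  qed
qed

lemma has_derivative_metric:
  fixes \<rho> \<alpha> \<beta> :: "'x::euclidean_space \<Rightarrow> 'e"
  assumes "\<rho> differentiable (at x)" "\<alpha> differentiable (at x)" "\<beta> differentiable (at x)" "\<rho> x \<in> S"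
  shows "((\<lambda>x. g (\<rho> x) (\<alpha> x) (\<beta> x)) has_derivative
     (\<lambda>h. fD (\<lambda>y. g y (\<alpha> x) (\<beta> x)) (\<rho> x) (fD \<rho> x h)
          + g (\<rho> x) (fD \<alpha> x h) (\<beta> x) + g (\<rho> x) (\<alpha> x) (fD \<beta> x h))) (at x)"
proof -
  have dg: "((\<lambda>x. g (\<rho> x) i j) has_derivative (\<lambda>h. fD (\<lambda>y. g y i j) (\<rho> x) (fD \<rho> x h))) (at x)" for i j
    using has_derivative_compose[OF fD_works[OF assms(1)] fD_works[OF diff_metric[OF assms(4)]]] .
  have "((\<lambda>x. \<Sum>i\<in>Basis. \<Sum>j\<in>Basis. ((\<alpha> x \<bullet> i) * (\<beta> x \<bullet> j)) *\<^sub>R g (\<rho> x) i j) has_derivative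
     (\<lambda>h. \<Sum>i\<in>Basis. \<Sum>j\<in>Basis. ((\<alpha> x \<bullet> i) * (\<beta> x \<bullet> j)) *\<^sub>R fD (\<lambda>y. g y i j) (\<rho> x) (fD \<rho> x h)
        + ((\<alpha> x \<bullet> i) * (fD \<beta> x h \<bullet> j) + (fD \<alpha> x h \<bullet> i) * (\<beta> x \<bullet> j)) *\<^sub>R g (\<rho> x) i j)) (at x)"
    by (intro has_derivative_sum has_derivative_scaleR has_derivative_mult has_derivative_inner_left
        fD_works assms dg)
  moreover have "(\<Sum>i\<in>Basis. \<Sum>j\<in>Basis. ((\<alpha> x \<bullet> i) * (\<beta> x \<bullet> j)) *\<^sub>R fD (\<lambda>y. g y i j) (\<rho> x) (fD \<rho> x h)
        + ((\<alpha> x \<bullet> i) * (fD \<beta> x h \<bullet> j) + (fD \<alpha> x h \<bullet> i) * (\<beta> x \<bullet> j)) *\<^sub>R g (\<rho> x) i j)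
     = fD (\<lambda>y. g y (\<alpha> x) (\<beta> x)) (\<rho> x) (fD \<rho> x h)
          + g (\<rho> x) (fD \<alpha> x h) (\<beta> x) + g (\<rho> x) (\<alpha> x) (fD \<beta> x h)" for h
    using bilinear_basis_expand[OF fD_metric_bilinear[OF assms(4)], of "\<alpha> x" "\<beta> x" "fD \<rho> x h"]
      metric_expand[OF assms(4), of "fD \<alpha> x h" "\<beta> x"] metric_expand[OF assms(4), of "\<alpha> x" "fD \<beta> x h"]
    by (simp add: distrib_right sum.distrib)
  ultimately have D: "((\<lambda>x. \<Sum>i\<in>Basis. \<Sum>j\<in>Basis. ((\<alpha> x \<bullet> i) * (\<beta> x \<bullet> j)) *\<^sub>R g (\<rho> x) i j) has_derivative
     (\<lambda>h. fD (\<lambda>y. g y (\<alpha> x) (\<beta> x)) (\<rho> x) (fD \<rho> x h)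
          + g (\<rho> x) (fD \<alpha> x h) (\<beta> x) + g (\<rho> x) (\<alpha> x) (fD \<beta> x h))) (at x)" by simp
  have "\<rho> \<midarrow>x\<rightarrow> \<rho> x"
    using assms(1) differentiable_imp_continuous_within isCont_def by blast
  then have "\<forall>\<^sub>F z in at x. \<rho> z \<in> S" using topological_tendstoD[OF _ S assms(4)] by blast
  then have ev: "\<forall>\<^sub>F z in at x. (\<Sum>i\<in>Basis. \<Sum>j\<in>Basis. ((\<alpha> z \<bullet> i) * (\<beta> z \<bullet> j)) *\<^sub>R g (\<rho> z) i j)
     = g (\<rho> z) (\<alpha> z) (\<beta> z)"
    by eventually_elim (rule metric_expand[symmetric])
  show ?thesis
    by (rule has_derivative_transform_eventually[OF D ev]) (simp_all add: metric_expand[OF assms(4), of "\<alpha> x" "\<beta> x"])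
qed

text \<open>The minimum of the quadratic form over \<open>Q\<close> times the unit sphere is
  attained and positive; scaling extends the estimate to all vectors.\<close>

lemma coercive:
  assumes "compact Q" "Q \<subseteq> S"
  obtains m where "m > 0" "\<And>y a. y \<in> Q \<Longrightarrow> m * (norm a)\<^sup>2 \<le> g y a a"
proof (cases "Q = {}")
  case True
  then show ?thesis using that[of 1] by simp
next
  case False
  have SU: "open (S \<times> (UNIV :: 'e set))" using S by (simp add: open_Times)
  have "smooth_on (S \<times> UNIV) (\<lambda>z. g (fst z) (snd z) (snd z))"
    by (intro smooth_metric SU smooth_on_fst smooth_on_snd smooth_on_ident) auto
  then have "continuous_on (S \<times> UNIV) (\<lambda>z. g (fst z) (snd z) (snd z))"
    by (rule smooth_on_imp_continuous_on)
  then have cont: "continuous_on (Q \<times> sphere 0 1) (\<lambda>z. g (fst z) (snd z) (snd z))"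
    by (rule continuous_on_subset) (use assms in auto)
  have "compact (Q \<times> sphere (0::'e) 1)" using assms by (simp add: compact_Times)
  moreover have "Q \<times> sphere (0::'e) 1 \<noteq> {}"
  proof -
    have "(SOME i. i \<in> Basis) \<in> sphere (0::'e) 1" using norm_Basis SOME_Basis by (simp add: dist_norm)
    then show ?thesis using False by blast
  qed
  ultimately obtain z where z: "z \<in> Q \<times> sphere 0 1"
    and min: "\<And>w. w \<in> Q \<times> sphere 0 1 \<Longrightarrow> g (fst z) (snd z) (snd z) \<le> g (fst w) (snd w) (snd w)"
    using continuous_attains_inf[OF _ _ cont] by blast
  show ?thesis
  proof (rule that)
    show "g (fst z) (snd z) (snd z) > 0"
    proof (rule inner_formD(4)[OF form])
      show "fst z \<in> S" "snd z \<noteq> 0" using z assms(2) by (auto simp: mem_Times_iff)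
    qed
  next
    fix y a assume y: "y \<in> Q"
    show "g (fst z) (snd z) (snd z) * (norm a)\<^sup>2 \<le> g y a a"
    proof (cases "a = 0")
      case True
      then show ?thesis using linear_0[OF inner_formD(1)[OF form]] y assms(2) by auto
    next
      case False
      let ?u = "a /\<^sub>R norm a"
      have "(y, ?u) \<in> Q \<times> sphere 0 1" using y False by simp
      from min[OF this] have "g (fst z) (snd z) (snd z) \<le> g y ?u ?u" by simp
      then have "g (fst z) (snd z) (snd z) * (norm a)\<^sup>2 \<le> g y ?u ?u * (norm a)\<^sup>2"
        by (rule mult_right_mono) simp
      also have "g y ?u ?u * (norm a)\<^sup>2 = g y (norm a *\<^sub>R ?u) (norm a *\<^sub>R ?u)"
        using y assms(2) linear_cmul[OF inner_formD(1)[OF form], of y] linear_cmul[OF inner_formD(2)[OF form], of y]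
        by (simp add: power2_eq_square subset_iff)
      also have "norm a *\<^sub>R ?u = a" using False by simp
      finally show ?thesis .
    qed
  qed
qed

text \<open>Solutions of \<open>g\<^sub>y(z(y), w) = r\<^sub>y(w)\<close> are as smooth as the data: differentiability reduces to
  inverting the constant form at one point, and the derivative of \<open>z\<close> solves an equation of the
  same kind.\<close>

lemma continuous_solution:
  assumes r: "\<And>w. continuous_on S (\<lambda>y. r y w)"
    and z: "\<And>y w. y \<in> S \<Longrightarrow> g y (z y) w = r y w"
  shows "continuous_on S z"
proof (rule continuous_at_imp_continuous_on, rule ballI)
  fix y0 assume y0: "y0 \<in> S"
  obtain d where d: "d > 0" "cball y0 d \<subseteq> S" using open_contains_cball S y0 by blast
  obtain m where m: "m > 0" "\<And>y a. y \<in> cball y0 d \<Longrightarrow> m * (norm a)\<^sup>2 \<le> g y a a"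
    using coercive[OF compact_cball d(2)] by blast
  define q where "q y w = r y w - g y (z y0) w" for y w
  define B where "B y = (\<Sum>b\<in>Basis. \<bar>q y b\<bar>) / m" for y
  have "isCont (\<lambda>y. r y b) y0" "isCont (\<lambda>y. g y (z y0) b) y0" for b
    using r smooth_on_imp_continuous_on[OF smooth] y0 S continuous_on_eq_continuous_at by blast+
  then have "isCont B y0" unfolding B_def q_def using m(1) by (intro continuous_intros) auto
  moreover have "B y0 = 0" by (simp add: B_def q_def z[OF y0])
  ultimately have B0: "B \<midarrow>y0\<rightarrow> 0" by (simp add: isCont_def)
  have bnd: "norm (z y - z y0) \<le> B y" if y: "y \<in> cball y0 d" for y
  proof -
    have yS: "y \<in> S" using y d by blast
    let ?e = "z y - z y0"
    have lin: "g y ?e w = q y w" for w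
      using linear_diff[OF inner_formD(2)[OF form[OF yS]], of "z y" "z y0" w] z[OF yS] by (simp add: q_def)
    have "m * (norm ?e)\<^sup>2 \<le> g y ?e ?e" by (rule m(2)[OF y])
    also have "\<dots> = (\<Sum>b\<in>Basis. (?e \<bullet> b) *\<^sub>R g y ?e b)"
      by (rule linear_basis_expand[OF inner_formD(1)[OF form[OF yS]]])
    also have "\<dots> \<le> (\<Sum>b\<in>Basis. norm ?e * \<bar>q y b\<bar>)"
    proof (rule sum_mono)
      fix b :: 'e assume b: "b \<in> Basis"
      have "(?e \<bullet> b) *\<^sub>R g y ?e b \<le> \<bar>?e \<bullet> b\<bar> * \<bar>q y b\<bar>"
        unfolding lin by (metis abs_ge_self abs_mult real_scaleR_def)
      also have "\<dots> \<le> norm ?e * \<bar>q y b\<bar>" using Basis_le_norm[OF b] by (intro mult_right_mono) auto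
      finally show "(?e \<bullet> b) *\<^sub>R g y ?e b \<le> norm ?e * \<bar>q y b\<bar>" .
    qed
    also have "\<dots> = norm ?e * (\<Sum>b\<in>Basis. \<bar>q y b\<bar>)" by (simp add: sum_distrib_left)
    also have "(\<Sum>b\<in>Basis. \<bar>q y b\<bar>) = m * B y" using m(1) by (simp add: B_def)
    finally have "m * norm ?e * norm ?e \<le> m * B y * norm ?e" by (simp add: power2_eq_square mult_ac)
    moreover have "B y \<ge> 0" using m(1) by (simp add: B_def sum_nonneg)
    ultimately show ?thesis using m(1) by (cases "?e = 0") auto
  qed
  have "((\<lambda>y. z y - z y0) \<longlongrightarrow> 0) (at y0)"
  proof (rule Lim_null_comparison[OF _ B0])
    have "\<forall>\<^sub>F y in at y0. y \<in> ball y0 d"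
      using d by (intro eventually_at_in_open') auto
    then show "\<forall>\<^sub>F y in at y0. norm (z y - z y0) \<le> B y" by eventually_elim (use bnd in auto)
  qed
  then show "isCont z y0" using LIM_zero_cancel isCont_def by blast
qed

lemma differentiable_solution:
  assumes r: "\<And>y w. y \<in> S \<Longrightarrow> (\<lambda>y. r y w) differentiable (at y)"
    and z: "\<And>y w. y \<in> S \<Longrightarrow> g y (z y) w = r y w" and y0: "y0 \<in> S"
  shows "z differentiable (at y0)"
proof -
  have "continuous_on S (\<lambda>y. r y w)" for w
    using r differentiable_imp_continuous_within by (intro continuous_at_imp_continuous_on) blast
  then have "continuous_on S z" using z continuous_solution by blast
  then have cz: "isCont z y0" using continuous_on_eq_continuous_at S y0 by blast
  obtain B where B: "linear B" "\<And>v w. g y0 (B v) w = v \<bullet> w"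
    using inner_form_riesz[OF form[OF y0]] by blast
  \<comment> \<open>The equation at \<open>y\<close> is rewritten with the form frozen at
    \<open>y0\<close>, and the difference goes to the right. There \<open>z\<close> is only known to
    be continuous, but its cofactors \<open>g y i b - g y0 i b\<close> vanish at \<open>y0\<close>,
    so the products are differentiable at \<open>y0\<close>.\<close>
  define h where "h y b = r y b - (\<Sum>i\<in>Basis. (z y \<bullet> i) * (g y i b - g y0 i b))" for y b
  have h: "g y0 (z y) b = h y b" if y: "y \<in> S" for y b
  proof -
    have "(\<Sum>i\<in>Basis. (z y \<bullet> i) * (g y i b - g y0 i b)) = g y (z y) b - g y0 (z y) b"
      using linear_basis_expand[OF inner_formD(2)[OF form[OF y]], of "z y" b]
        linear_basis_expand[OF inner_formD(2)[OF form[OF y0]], of "z y" b]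
      by (simp add: right_diff_distrib sum_subtractf)
    then show ?thesis using z[OF y] by (simp add: h_def)
  qed
  have eq: "B (\<Sum>b\<in>Basis. h y b *\<^sub>R b) = z y" if y: "y \<in> S" for y
  proof (rule inner_form_cancel[OF form[OF y0]])
    fix w
    have "g y0 (z y) w = (\<Sum>b\<in>Basis. (w \<bullet> b) *\<^sub>R h y b)"
      using linear_basis_expand[OF inner_formD(1)[OF form[OF y0]], of "z y" w] h[OF y] by simp
    then show "g y0 (B (\<Sum>b\<in>Basis. h y b *\<^sub>R b)) w = g y0 (z y) w"
      unfolding B(2) by (simp add: inner_sum_left inner_commute[of w] mult.commute)
  qed
  have "(\<lambda>y. h y b) differentiable (at y0)" for b
    unfolding h_def using cz y0
    by (intro differentiable_diff r differentiable_sum continuous_mult_differentiable_zero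
        diff_metric differentiable_const finite_Basis ballI) (auto intro!: continuous_intros)
  then have "(\<lambda>y. \<Sum>b\<in>Basis. h y b *\<^sub>R b) differentiable (at y0)"
    by (intro differentiable_sum differentiable_scaleR finite_Basis ballI differentiable_const)
  then have "(\<lambda>y. B (\<Sum>b\<in>Basis. h y b *\<^sub>R b)) differentiable (at y0)"
    using linear_imp_differentiable[OF B(1)] by (rule differentiable_chain[rotated])
  then show ?thesis
    using differentiable_cong_open[OF S y0, of "\<lambda>y. B (\<Sum>b\<in>Basis. h y b *\<^sub>R b)" z] eq by blast
qed

lemma Ck_solution:
  assumes "\<And>w. Ck_on k S (\<lambda>y. r y w)" "\<And>y w. y \<in> S \<Longrightarrow> g y (z y) w = r y w"
  shows "Ck_on k S z"
  using assms
proof (induction k arbitrary: r z)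
  case 0
  then show ?case using continuous_solution[of r z] by simp
next
  case (Suc k)
  have dz: "z differentiable (at y)" if "y \<in> S" for y
    using differentiable_solution[of r z y] Suc.prems that by simp
  have zk: "Ck_on k S z" using Suc.IH[of r z] Suc.prems Ck_on_SucD by blast
  show ?case
    unfolding Ck_on.simps
  proof (intro conjI ballI allI)
    fix u
    \<comment> \<open>Differentiating \<open>g y (z y) w = r y w\<close> leaves
      \<open>fD z y u\<close> paired with \<open>w\<close>; the term with the derivative of the
      metric moves to the right. It contains \<open>z\<close> itself, whose regularity of order
      \<open>k\<close> is \<open>zk\<close>.\<close>
    let ?r = "\<lambda>y w. fD (\<lambda>y. r y w) y u - (\<Sum>i\<in>Basis. (z y \<bullet> i) *\<^sub>R fD (\<lambda>y. g y i w) y u)"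
    show "Ck_on k S (\<lambda>y. fD z y u)"
    proof (rule Suc.IH)
      fix w
      have 1: "Ck_on k S (\<lambda>y. \<Sum>i\<in>Basis. (z y \<bullet> i) *\<^sub>R fD (\<lambda>y. g y i w) y u)"
        using zk by (intro Ck_on_sum Ck_on_scaleR Ck_on_inner Ck_on_fD Ck_on_const S
            smooth_onD[OF smooth] finite_Basis)
      have "Ck_on k S (\<lambda>y. fD (\<lambda>y. r y w) y u + (-1) *\<^sub>R (\<Sum>i\<in>Basis. (z y \<bullet> i) *\<^sub>R fD (\<lambda>y. g y i w) y u))"
        using Suc.prems(1) by (intro Ck_on_add Ck_on_scaleR 1 S Ck_on_const) auto
      then show "Ck_on k S (\<lambda>y. ?r y w)" by simp
    next
      fix y w assume y: "y \<in> S"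
      have "fD (\<lambda>y. r y w) y u = fD (\<lambda>y. g y (z y) w) y u"
        using fD_cong_open[OF S y, of "\<lambda>y. g y (z y) w" "\<lambda>y. r y w"] Suc.prems(2) by simp
      also have "\<dots> = fD (\<lambda>y'. g y' (z y) w) y u + g y (fD z y u) w"
        using fD_eqI[OF has_derivative_metric[of "\<lambda>y. y" y z "\<lambda>y. w"]] dz[OF y] y
          linear_0[OF inner_formD(1)[OF form[OF y]]] by simp
      also have "fD (\<lambda>y'. g y' (z y) w) y u = (\<Sum>i\<in>Basis. (z y \<bullet> i) *\<^sub>R fD (\<lambda>y. g y i w) y u)"
        using fD_metric_bilinear[OF y, of u] linear_basis_expand[of "\<lambda>a. fD (\<lambda>y. g y a w) y u" "z y"]
        by (simp add: bilinear_def)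
      finally show "g y (fD z y u) w = ?r y w" by simp
    qed
  qed (use dz in auto)
qed

lemma linear_koszul:
  assumes y: "y \<in> S"
  shows "linear (koszul g y a b)"
proof -
  note bil = fD_metric_bilinear[OF y]
  have 1: "linear (\<lambda>w. fD (\<lambda>y. g y c w) y h)" for c h
    using bil by (simp add: bilinear_def)
  show ?thesis
    by (rule linearI)
      (simp_all add: koszul_def linear_add[OF 1] linear_cmul[OF 1] linear_add[OF fD_metric_linear[OF y]]
        linear_cmul[OF fD_metric_linear[OF y]] field_simps)
qed

text \<open>Existence comes from the Riesz operator applied to the coefficients of the Koszul
  functional, uniqueness from definiteness. This is what gives the description in
  \<open>chris_def\<close> a meaning.\<close>

lemma metric_chris:
  assumes y: "y \<in> S"
  shows "g y (chris g y a b) w = koszul g y a b w"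
proof -
  obtain B where B: "linear B" "\<And>v w. g y (B v) w = v \<bullet> w"
    using inner_form_riesz[OF form[OF y]] by blast
  let ?z = "B (\<Sum>i\<in>Basis. koszul g y a b i *\<^sub>R i)"
  have z: "g y ?z w = koszul g y a b w" for w
    using linear_basis_expand[OF linear_koszul[OF y], of a b w]
    by (simp add: B(2) inner_sum_left inner_commute[of w] mult.commute)
  have "\<forall>w. g y (chris g y a b) w = koszul g y a b w"
    unfolding chris_def
    by (rule theI[of _ ?z]) (use z inner_form_cancel[OF form[OF y]] in auto)
  then show ?thesis by blast
qed

lemma chris_eqI:
  assumes "y \<in> S" "\<And>w. g y z w = koszul g y a b w"
  shows "chris g y a b = z"
  using inner_form_cancel[OF form[OF assms(1)]] metric_chris[OF assms(1)] assms(2) by metis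

lemma bilinear_chris:
  assumes y: "y \<in> S"
  shows "bilinear (chris g y)"
proof -
  note bil = fD_metric_bilinear[OF y, unfolded bilinear_def]
  have l1: "linear (\<lambda>a. fD (\<lambda>y. g y a w) y h)" and l2: "linear (\<lambda>a. fD (\<lambda>y. g y w a) y h)" for w h
    using bil by auto
  note lin = linear_add[OF l1] linear_add[OF l2] linear_cmul[OF l1] linear_cmul[OF l2]
    linear_add[OF fD_metric_linear[OF y]] linear_cmul[OF fD_metric_linear[OF y]]
    linear_add[OF inner_formD(2)[OF form[OF y]]] linear_cmul[OF inner_formD(2)[OF form[OF y]]]
  have k: "koszul g y (a + a') b w = koszul g y a b w + koszul g y a' b w"
    "koszul g y a (b + b') w = koszul g y a b w + koszul g y a b' w"
    "koszul g y (r *\<^sub>R a) b w = r * koszul g y a b w"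
    "koszul g y a (r *\<^sub>R b) w = r * koszul g y a b w" for a a' b b' w r
    unfolding koszul_def lin by (simp_all add: field_simps)
  show ?thesis
    unfolding bilinear_def
    by (intro conjI allI linearI chris_eqI[OF y]; simp add: k lin metric_chris[OF y])
qed

text \<open>The Koszul functional is smooth in the point, and \<open>Ck_solution\<close> passes
  every order of differentiability on to the solution.\<close>

lemma smooth_chris_const: "smooth_on S (\<lambda>y. chris g y a b)"
proof -
  have sm: "smooth_on S (\<lambda>y. fD (\<lambda>y. g y c d) y e)" for c d e
    by (intro smooth_on_fD smooth S smooth_on_const)
  have "smooth_on S (\<lambda>y. koszul g y a b w)" for w
  proof -
    have "smooth_on S (\<lambda>y. (1/2) *\<^sub>R (fD (\<lambda>y'. g y' b w) y a + fD (\<lambda>y'. g y' a w) y b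
      + (-1) *\<^sub>R fD (\<lambda>y'. g y' a b) y w))"
      by (intro smooth_on_scaleR smooth_on_add sm S smooth_on_const)
    then show ?thesis by (simp add: koszul_def)
  qed
  then show ?thesis
    using Ck_solution[of _ "\<lambda>y w. koszul g y a b w" "\<lambda>y. chris g y a b"] metric_chris
    by (auto simp: smooth_on_def)
qed

lemma smooth_chris:
  assumes "open T" "smooth_on T \<rho>" "smooth_on T \<alpha>" "smooth_on T \<beta>" "\<rho> ` T \<subseteq> S"
  shows "smooth_on T (\<lambda>z. chris g (\<rho> z) (\<alpha> z) (\<beta> z))"
proof (rule smooth_on_cong[OF assms(1)])
  show "smooth_on T (\<lambda>z. \<Sum>i\<in>Basis. \<Sum>j\<in>Basis. ((\<alpha> z \<bullet> i) * (\<beta> z \<bullet> j)) *\<^sub>R chris g (\<rho> z) i j)"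
    using smooth_on_compose[OF smooth_chris_const assms(2,5,1)]
    by (intro smooth_on_sum smooth_on_scaleR smooth_on_mult smooth_on_inner assms smooth_on_const) auto
  show "(\<Sum>i\<in>Basis. \<Sum>j\<in>Basis. ((\<alpha> z \<bullet> i) * (\<beta> z \<bullet> j)) *\<^sub>R chris g (\<rho> z) i j)
      = chris g (\<rho> z) (\<alpha> z) (\<beta> z)"
    if "z \<in> T" for z
    using bilinear_basis_expand[OF bilinear_chris, of "\<rho> z" "\<alpha> z" "\<beta> z"] assms(5) that by auto
qed

end

text \<open>Differentiating the isometry relation turns each of the three terms of the Koszul
  formula into one derivative of \<open>g'\<close> and two terms with a second derivative of
  \<open>\<tau>\<close>. By symmetry of second derivatives four of these six cancel in pairs and two
  add up to the inhomogeneous term. Surjectivity lets every test vector be written as an image under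
  \<open>fD \<tau> y\<close>.\<close>

lemma chris_transition:
  assumes "coord_metric S g" "coord_metric S' g'"
    and \<tau>: "smooth_on S \<tau>" "\<tau> ` S \<subseteq> S'"
    and iso: "\<And>y a b. y \<in> S \<Longrightarrow> g y a b = g' (\<tau> y) (fD \<tau> y a) (fD \<tau> y b)"
    and surj: "\<And>y. y \<in> S \<Longrightarrow> surj (fD \<tau> y)" and y: "y \<in> S"
  shows "chris g' (\<tau> y) (fD \<tau> y a) (fD \<tau> y b) + fD (\<lambda>y. fD \<tau> y b) y a = fD \<tau> y (chris g y a b)"
proof -
  interpret G: coord_metric S g by fact
  interpret G': coord_metric S' g' by fact
  have y': "\<tau> y \<in> S'" using \<tau>(2) y by blast
  have d\<tau>: "\<tau> differentiable (at y)" using \<tau>(1) y smooth_on_imp_differentiable by blast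
  have dd\<tau>: "(\<lambda>y. fD \<tau> y b) differentiable (at y)" for b
    using smooth_on_imp_differentiable[OF smooth_on_fD[OF \<tau>(1) smooth_on_const G.S] y] .
  let ?D = "\<lambda>a b. fD (\<lambda>y. fD \<tau> y b) y a"
  have sym: "?D a b = ?D b a" for a b
    using second_derivative_symmetric[OF smooth_onD[OF \<tau>(1)] G.S y] by blast
  have deriv: "fD (\<lambda>y. g y b c) y a = fD (\<lambda>x. g' x (fD \<tau> y b) (fD \<tau> y c)) (\<tau> y) (fD \<tau> y a)
      + g' (\<tau> y) (?D a b) (fD \<tau> y c) + g' (\<tau> y) (fD \<tau> y b) (?D a c)" for a b c
  proof -
    have "fD (\<lambda>y. g y b c) y a = fD (\<lambda>y. g' (\<tau> y) (fD \<tau> y b) (fD \<tau> y c)) y a"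
      using fD_cong_open[OF G.S y, of "\<lambda>y. g y b c"] iso by auto
    then show ?thesis
      using fD_eqI[OF G'.has_derivative_metric[OF d\<tau> dd\<tau> dd\<tau> y']] by metis
  qed
  have g's: "g' (\<tau> y) u v = g' (\<tau> y) v u" for u v
    using inner_formD(3)[OF G'.form[OF y']] .
  show ?thesis
  proof (rule inner_form_cancel[OF G'.form[OF y']])
    fix w'
    obtain w where w: "w' = fD \<tau> y w" using surj[OF y] by blast
    have "g' (\<tau> y) (fD \<tau> y (chris g y a b)) w' = koszul g y a b w"
      unfolding w using iso[OF y] G.metric_chris[OF y] by metis
    also have "\<dots> = koszul g' (\<tau> y) (fD \<tau> y a) (fD \<tau> y b) w' + g' (\<tau> y) (?D a b) w'"
      unfolding koszul_def deriv w
      using sym[of a b] sym[of a w] sym[of b w] g's[of "fD \<tau> y b" "?D w a"] g's[of "?D w b" "fD \<tau> y a"]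
        g's[of "fD \<tau> y a" "?D w b"] g's[of "?D w a" "fD \<tau> y b"]
      by (simp add: field_simps)
    also have "\<dots> = g' (\<tau> y) (chris g' (\<tau> y) (fD \<tau> y a) (fD \<tau> y b) + ?D a b) w'"
      using G'.metric_chris[OF y'] linear_add[OF inner_formD(2)[OF G'.form[OF y']]] by metis
    finally show "g' (\<tau> y) (chris g' (\<tau> y) (fD \<tau> y a) (fD \<tau> y b) + ?D a b) w'
      = g' (\<tau> y) (fD \<tau> y (chris g y a b)) w'" by simp
  qed
qed


lemma has_vector_derivative_cong_nhds:
  fixes f g :: "real \<Rightarrow> 'a::real_normed_vector"
  assumes "\<forall>\<^sub>F s in nhds t. f s = g s"
  shows "(f has_vector_derivative D) (at t) \<longleftrightarrow> (g has_vector_derivative D) (at t)"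
  using assms eventually_nhds_x_imp_x[OF assms]
  by (intro has_vector_derivative_cong_ev) (auto elim: eventually_mono)

text \<open>Derivative of a vector field along a curve after a change of coordinates. The first
  summand, a second derivative of the transition map, is what the Christoffel symbols compensate in
  \<open>cov_deriv_tangent\<close>.\<close>

lemma has_vector_derivative_fD_apply:
  fixes \<tau> :: "'a::euclidean_space \<Rightarrow> 'b::euclidean_space"
  assumes \<tau>: "smooth_on S \<tau>" "open S" "y t \<in> S"
    and y: "(y has_vector_derivative y') (at t)" and a: "(a has_vector_derivative a') (at t)"
  shows "((\<lambda>s. fD \<tau> (y s) (a s)) has_vector_derivative
    fD (\<lambda>x. fD \<tau> x (a t)) (y t) y' + fD \<tau> (y t) a') (at t)"
proof -
  have d\<tau>: "\<tau> differentiable (at x)" if "x \<in> S" for x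
    using smooth_on_imp_differentiable[OF \<tau>(1) that] .
  have dd: "(\<lambda>x. fD \<tau> x i) differentiable (at (y t))" for i
    using smooth_on_imp_differentiable[OF smooth_on_fD[OF \<tau>(1) smooth_on_const \<tau>(2)] \<tau>(3)] .
  have "((\<lambda>s. \<Sum>i\<in>Basis. (a s \<bullet> i) *\<^sub>R fD \<tau> (y s) i) has_vector_derivative
     (\<Sum>i\<in>Basis. (a t \<bullet> i) *\<^sub>R fD (\<lambda>x. fD \<tau> x i) (y t) y' + (a' \<bullet> i) *\<^sub>R fD \<tau> (y t) i)) (at t)"
    by (intro has_vector_derivative_sum has_vector_derivative_scaleR)
      (auto intro!: has_vector_derivative_fD[OF dd y] bounded_linear.has_vector_derivative[OF bounded_linear_inner_left a]
        simp: has_real_derivative_iff_has_vector_derivative)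
  moreover have "(\<Sum>i\<in>Basis. (a t \<bullet> i) *\<^sub>R fD (\<lambda>x. fD \<tau> x i) (y t) y') = fD (\<lambda>x. fD \<tau> x (a t)) (y t) y'"
  proof -
    have "fD (\<lambda>x. fD \<tau> x (a t)) (y t) = fD (\<lambda>x. \<Sum>i\<in>Basis. (a t \<bullet> i) *\<^sub>R fD \<tau> x i) (y t)"
      by (rule fD_cong_open[OF \<tau>(2,3)]) (rule linear_basis_expand[OF linear_fD[OF d\<tau>]])
    moreover have "fD (\<lambda>x. \<Sum>i\<in>Basis. (a t \<bullet> i) *\<^sub>R fD \<tau> x i) (y t) =
       (\<lambda>h. \<Sum>i\<in>Basis. (a t \<bullet> i) *\<^sub>R fD (\<lambda>x. fD \<tau> x i) (y t) h)"
      by (intro fD_eqI has_derivative_sum has_derivative_scaleR_right fD_works dd)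
    ultimately show ?thesis by simp
  qed
  moreover have "(\<Sum>i\<in>Basis. (a' \<bullet> i) *\<^sub>R fD \<tau> (y t) i) = fD \<tau> (y t) a'"
    by (rule linear_basis_expand[symmetric, OF linear_fD[OF d\<tau>[OF \<tau>(3)]]])
  ultimately have D: "((\<lambda>s. \<Sum>i\<in>Basis. (a s \<bullet> i) *\<^sub>R fD \<tau> (y s) i) has_vector_derivative
     fD (\<lambda>x. fD \<tau> x (a t)) (y t) y' + fD \<tau> (y t) a') (at t)"
    by (simp add: sum.distrib)
  have "isCont y t" using y has_vector_derivative_continuous by blast
  then have "(y \<longlongrightarrow> y t) (nhds t)" by (simp add: isCont_def tendsto_at_iff_tendsto_nhds)
  from topological_tendstoD[OF this \<tau>(2,3)]
  have "\<forall>\<^sub>F s in nhds t. (\<Sum>i\<in>Basis. (a s \<bullet> i) *\<^sub>R fD \<tau> (y s) i) = fD \<tau> (y s) (a s)"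
    by eventually_elim (rule linear_basis_expand[symmetric, OF linear_fD[OF d\<tau>]])
  from has_vector_derivative_cong_nhds[OF this] D show ?thesis by (rule iffD1)
qed

section \<open>Charts and tangent spaces\<close>

locale riem =
  fixes M :: "('a, 'e::euclidean_space) riemannian"
  assumes riem: "riemannian_manifold M"
begin

abbreviation cim :: "('a, 'e) chart \<Rightarrow> 'e set" where
  "cim c \<equiv> snd c ` fst c"

abbreviation cdom :: "('a, 'e) chart \<Rightarrow> ('a, 'e) chart \<Rightarrow> 'e set" where
  "cdom c d \<equiv> snd c ` (fst c \<inter> fst d)"

abbreviation tr :: "('a, 'e) chart \<Rightarrow> ('a, 'e) chart \<Rightarrow> 'e \<Rightarrow> 'e" where
  "tr c d \<equiv> snd d \<circ> chart_inv c"

lemma mfd: "smooth_manifold (mtop M) (atlas M)"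
  using riem by (simp add: riemannian_manifold_def)

lemma charts_atD: "c \<in> charts_at M x \<Longrightarrow> c \<in> atlas M" "c \<in> charts_at M x \<Longrightarrow> x \<in> fst c"
  by (auto simp: charts_at_def)

lemma charts_atI: "c \<in> atlas M \<Longrightarrow> x \<in> fst c \<Longrightarrow> c \<in> charts_at M x"
  by (auto simp: charts_at_def)

lemma topspace_eq: "topspace (mtop M) = (\<Union>c\<in>atlas M. fst c)"
  using mfd by (simp add: smooth_manifold_def)

lemma chart_exists: "x \<in> topspace (mtop M) \<Longrightarrow> \<exists>c. c \<in> charts_at M x"
  by (auto simp: topspace_eq charts_at_def)

lemma charts_at_topspace: "c \<in> charts_at M x \<Longrightarrow> x \<in> topspace (mtop M)"
  by (auto simp: topspace_eq charts_at_def)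

context
  fixes c assumes c: "c \<in> atlas M"
begin

lemma openin_fst: "openin (mtop M) (fst c)" and open_cim: "open (cim c)"
  and homeo: "homeomorphic_map (subtopology (mtop M) (fst c)) (top_of_set (cim c)) (snd c)"
  using mfd c by (auto simp: smooth_manifold_def)

lemma fst_subset: "fst c \<subseteq> topspace (mtop M)"
  using openin_fst openin_subset by blast

lemma topspace_subtopology_fst: "topspace (subtopology (mtop M) (fst c)) = fst c"
  using fst_subset by auto

lemma inj_on_chart: "inj_on (snd c) (fst c)"
  using homeo topspace_subtopology_fst homeomorphic_imp_injective_map by metis

lemma chart_inv_chart [simp]: "x \<in> fst c \<Longrightarrow> chart_inv c (snd c x) = x"
  using inj_on_chart by simp

lemma chart_chart_inv: "y \<in> cim c \<Longrightarrow> snd c (chart_inv c y) = y"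
  by (simp add: f_inv_into_f)

lemma chart_inv_in: "y \<in> cim c \<Longrightarrow> chart_inv c y \<in> fst c"
  by (simp add: inv_into_into)

lemma open_chart_image:
  assumes "openin (mtop M) W" shows "open (snd c ` (fst c \<inter> W))"
proof -
  have "openin (subtopology (mtop M) (fst c)) (fst c \<inter> W)"
    using assms by (metis inf.commute openin_subtopology_Int)
  then have "openin (top_of_set (cim c)) (snd c ` (fst c \<inter> W))"
    using homeomorphic_imp_open_map[OF homeo] by (simp add: open_map_def)
  then show ?thesis using open_cim openin_open_trans by blast
qed

lemma open_cdom: "d \<in> atlas M \<Longrightarrow> open (cdom c d)"
  using mfd open_chart_image[of "fst d"] by (simp add: smooth_manifold_def)

lemma smooth_tr: "d \<in> atlas M \<Longrightarrow> smooth_on (cdom c d) (tr c d)"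
  using mfd c by (simp add: smooth_manifold_def)

lemma diff_tr: "d \<in> atlas M \<Longrightarrow> x \<in> fst c \<Longrightarrow> x \<in> fst d \<Longrightarrow> tr c d differentiable (at (snd c x))"
  using smooth_on_imp_differentiable[OF smooth_tr] by blast

lemma tr_chart: "x \<in> fst c \<Longrightarrow> tr c d (snd c x) = snd d x"
  by simp

end

lemma fD_tr_same:
  assumes "c \<in> charts_at M x" shows "fD (tr c c) (snd c x) a = a"
proof -
  have c: "c \<in> atlas M" and x: "snd c x \<in> cim c" using charts_atD[OF assms] by auto
  have "fD (tr c c) (snd c x) = fD (\<lambda>y. y) (snd c x)"
    by (rule fD_cong_open[OF open_cim[OF c] x]) (simp add: chart_chart_inv[OF c])
  then show ?thesis by simp
qed

lemma fD_tr_trans: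
  assumes "c \<in> charts_at M x" "d \<in> charts_at M x" "e \<in> charts_at M x"
  shows "fD (tr d e) (snd d x) (fD (tr c d) (snd c x) a) = fD (tr c e) (snd c x) a"
proof -
  note A = charts_atD[OF assms(1)] charts_atD[OF assms(2)] charts_atD[OF assms(3)]
  have "openin (mtop M) (fst d \<inter> fst e)" using openin_fst A by blast
  from open_chart_image[OF A(1) this] have "open (snd c ` (fst c \<inter> (fst d \<inter> fst e)))" .
  moreover have "snd c x \<in> snd c ` (fst c \<inter> (fst d \<inter> fst e))" using A by blast
  ultimately have "fD (tr c e) (snd c x) = fD (\<lambda>y. tr d e (tr c d y)) (snd c x)"
    by (rule fD_cong_open) (use A in auto)
  moreover have "fD (\<lambda>y. tr d e (tr c d y)) (snd c x) a = fD (tr d e) (tr c d (snd c x)) (fD (tr c d) (snd c x) a)"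
    by (rule fD_chain[OF _ diff_tr[OF A(1,3,2,4)]], unfold tr_chart[OF A(1,2)], rule diff_tr[OF A(3,5,4,6)])
  ultimately show ?thesis using A by simp
qed

lemma linear_fD_tr:
  "c \<in> charts_at M x \<Longrightarrow> d \<in> charts_at M x \<Longrightarrow> linear (fD (tr c d) (snd c x))"
  using linear_fD[OF diff_tr] charts_atD by blast

lemma tvec_of_apply:
  "d \<in> charts_at M x \<Longrightarrow> tvec_of M c x a d = fD (tr c d) (snd c x) a"
  by (simp add: tvec_of_def)

lemma tvec_of_same [simp]: "c \<in> charts_at M x \<Longrightarrow> tvec_of M c x a c = a"
  using tvec_of_apply fD_tr_same by simp

lemma tvec_of_tangent: "c \<in> charts_at M x \<Longrightarrow> tvec_of M c x a \<in> tangent_space M x"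
  unfolding tangent_space_def using fD_tr_trans by (simp add: tvec_of_def)

lemma tangentD:
  "v \<in> tangent_space M x \<Longrightarrow> c \<in> charts_at M x \<Longrightarrow> d \<in> charts_at M x \<Longrightarrow> v d = fD (tr c d) (snd c x) (v c)"
  "v \<in> tangent_space M x \<Longrightarrow> c \<notin> charts_at M x \<Longrightarrow> v c = 0"
  unfolding tangent_space_def by blast+

lemma tvec_of_coord:
  assumes "v \<in> tangent_space M x" "c \<in> charts_at M x"
  shows "tvec_of M c x (v c) = v"
proof
  fix d show "tvec_of M c x (v c) d = v d"
    using tangentD(1)[OF assms, of d] tangentD(2)[OF assms(1), of d] by (simp add: tvec_of_def)
qed

lemma tvec_of_change:
  assumes "c \<in> charts_at M x" "d \<in> charts_at M x"
  shows "tvec_of M d x (fD (tr c d) (snd c x) a) = tvec_of M c x a"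
proof
  fix e show "tvec_of M d x (fD (tr c d) (snd c x) a) e = tvec_of M c x a e"
    using fD_tr_trans[OF assms, of e a] by (simp add: tvec_of_def)
qed

lemma tvec_of_add:
  assumes "c \<in> charts_at M x"
  shows "tvec_of M c x (a + b) = tadd (tvec_of M c x a) (tvec_of M c x b)"
  using linear_add[OF linear_fD_tr[OF assms]] by (auto simp: tvec_of_def tadd_def fun_eq_iff)

lemma tvec_of_scale:
  assumes "c \<in> charts_at M x"
  shows "tvec_of M c x (r *\<^sub>R a) = tscale r (tvec_of M c x a)"
  using linear_cmul[OF linear_fD_tr[OF assms]] by (auto simp: tvec_of_def tscale_def fun_eq_iff)

lemma tvec_of_zero:
  assumes "c \<in> charts_at M x"
  shows "tvec_of M c x 0 = tzero"
  using linear_0[OF linear_fD_tr[OF assms]] by (auto simp: tvec_of_def tzero_def fun_eq_iff)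

lemma metric_props:
  assumes "x \<in> topspace (mtop M)" "u \<in> tangent_space M x"
  shows "v \<in> tangent_space M x \<Longrightarrow> metric M x u v = metric M x v u"
    "v \<in> tangent_space M x \<Longrightarrow> w \<in> tangent_space M x \<Longrightarrow>
       metric M x (tadd u v) w = metric M x u w + metric M x v w"
    "w \<in> tangent_space M x \<Longrightarrow> metric M x (tscale r u) w = r * metric M x u w"
    "u \<noteq> tzero \<Longrightarrow> metric M x u u > 0"
  using riem assms unfolding riemannian_manifold_def by blast+

lemma metric_eq_coord:
  assumes "c \<in> charts_at M x" "v \<in> tangent_space M x" "w \<in> tangent_space M x"
  shows "metric M x v w = metric_coord M c (snd c x) (v c) (w c)"
  using assms by (simp add: metric_coord_def charts_atD tvec_of_coord)

text \<open>Carries the Riemannian axioms over to a chart image, so that the results of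
  \<open>coord_metric\<close> apply in every chart.\<close>

lemma coord_metric_chart:
  assumes c: "c \<in> atlas M" shows "coord_metric (cim c) (metric_coord M c)"
proof
  show "open (cim c)" using open_cim[OF c] .
  show "smooth_on (cim c) (\<lambda>y. metric_coord M c y a b)" for a b
    using riem c unfolding riemannian_manifold_def by blast
  fix y assume "y \<in> cim c"
  then obtain x where x: "x \<in> fst c" "y = snd c x" by blast
  have cx: "c \<in> charts_at M x" using x c by (simp add: charts_at_def)
  have xt: "x \<in> topspace (mtop M)" using charts_at_topspace[OF cx] .
  have eq: "metric_coord M c y a b = metric M x (tvec_of M c x a) (tvec_of M c x b)" for a b
    using x c by (simp add: metric_coord_def)
  note T = tvec_of_tangent[OF cx]
  have sym: "metric_coord M c y a b = metric_coord M c y b a" for a b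
    unfolding eq using metric_props(1)[OF xt T T] .
  have l: "linear (\<lambda>a. metric_coord M c y a b)" for b
    by (rule linearI)
      (simp_all add: eq tvec_of_add[OF cx] tvec_of_scale[OF cx] metric_props(2,3)[OF xt T] T)
  moreover have "linear (metric_coord M c y b)" for b
  proof -
    have "metric_coord M c y b = (\<lambda>a. metric_coord M c y a b)" by (rule ext) (rule sym)
    then show ?thesis using l[of b] by metis
  qed
  moreover have "metric_coord M c y a a > 0" if "a \<noteq> 0" for a
    unfolding eq
  proof (rule metric_props(4)[OF xt T])
    show "tvec_of M c x a \<noteq> tzero" using tvec_of_same[OF cx, of a] that by (auto simp: tzero_def)
  qed
  ultimately show "inner_form (metric_coord M c y)"
    unfolding inner_form_def bilinear_def using sym by blast
qed

lemma christoffel_scale: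
  assumes "d \<in> atlas M" "y \<in> cim d"
  shows "christoffel M d y (r *\<^sub>R a) (s *\<^sub>R b) = (r * s) *\<^sub>R christoffel M d y a b"
  using coord_metric.bilinear_chris[OF coord_metric_chart assms(2)] assms(1)
  by (simp add: christoffel_eq_chris bilinear_lmul bilinear_rmul)

text \<open>On the overlap \<open>cdom c d\<close> the transition map is an isometry of the
  coordinate metrics, since both express the same metric on tangent vectors. Its derivative is
  surjective because the opposite transition provides a right inverse.\<close>

lemma christoffel_transition:
  assumes "c \<in> charts_at M x" "d \<in> charts_at M x"
  shows "christoffel M d (snd d x) (fD (tr c d) (snd c x) a) (fD (tr c d) (snd c x) b)
      + fD (\<lambda>y. fD (tr c d) y b) (snd c x) a
    = fD (tr c d) (snd c x) (christoffel M c (snd c x) a b)"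
proof -
  note A = charts_atD[OF assms(1)] charts_atD[OF assms(2)]
  have *: "coord_metric (cdom c d) (metric_coord M c)"
    by (rule coord_metric.subset[OF coord_metric_chart]) (use A open_cdom in auto)
  have "chris (metric_coord M d) (tr c d (snd c x)) (fD (tr c d) (snd c x) a) (fD (tr c d) (snd c x) b)
      + fD (\<lambda>y. fD (tr c d) y b) (snd c x) a
    = fD (tr c d) (snd c x) (chris (metric_coord M c) (snd c x) a b)"
  proof (rule chris_transition[OF * coord_metric_chart[OF A(3)] smooth_tr])
    show "c \<in> atlas M" "d \<in> atlas M" using A by auto
    show "tr c d ` cdom c d \<subseteq> cim d" using A by auto
    show "snd c x \<in> cdom c d" using A by blast
    fix y assume "y \<in> cdom c d"
    then obtain x where x: "y = snd c x" "x \<in> fst c" "x \<in> fst d" by blast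
    then have C: "c \<in> charts_at M x" "d \<in> charts_at M x" using A by (auto intro: charts_atI)
    show "metric_coord M c y a b = metric_coord M d (tr c d y) (fD (tr c d) y a) (fD (tr c d) y b)" for a b
      using metric_eq_coord[OF C(2) tvec_of_tangent[OF C(1)] tvec_of_tangent[OF C(1)]]
        metric_eq_coord[OF C(1) tvec_of_tangent[OF C(1)] tvec_of_tangent[OF C(1)]] x C A
      by (simp add: tvec_of_apply fD_tr_same)
    show "surj (fD (tr c d) y)"
      using fD_tr_trans[OF C(2,1,2)] fD_tr_same[OF C(2)] x by (intro surjI[of _ "fD (tr d c) (snd d x)"]) simp
  qed
  then show ?thesis using A by (simp add: christoffel_eq_chris)
qed

section \<open>Velocities and covariant derivatives as tangent vectors\<close>

lemma tr_curve_derivative: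
  assumes C: "c \<in> charts_at M (\<gamma> t)" "d \<in> charts_at M (\<gamma> t)"
    and ev: "\<forall>\<^sub>F s in nhds t. \<gamma> s \<in> fst c" "\<forall>\<^sub>F s in nhds t. \<gamma> s \<in> fst d"
    and \<gamma>: "((\<lambda>s. snd c (\<gamma> s)) has_vector_derivative \<gamma>') (at t)"
  shows "((\<lambda>s. snd d (\<gamma> s)) has_vector_derivative fD (tr c d) (snd c (\<gamma> t)) \<gamma>') (at t)"
proof -
  note A = charts_atD[OF C(1)] charts_atD[OF C(2)]
  have "\<forall>\<^sub>F s in nhds t. tr c d (snd c (\<gamma> s)) = snd d (\<gamma> s)"
    using ev(1) by eventually_elim (simp add: A)
  moreover have "((\<lambda>s. tr c d (snd c (\<gamma> s))) has_vector_derivative fD (tr c d) (snd c (\<gamma> t)) \<gamma>') (at t)"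
    by (rule has_vector_derivative_fD[OF diff_tr \<gamma>]) (use A in auto)
  ultimately show ?thesis by (rule has_vector_derivative_cong_nhds[THEN iffD1])
qed

lemma velocity_tangent:
  assumes ev: "\<And>c. c \<in> charts_at M (\<gamma> t) \<Longrightarrow> \<forall>\<^sub>F s in nhds t. \<gamma> s \<in> fst c"
    and \<gamma>: "\<And>c. c \<in> charts_at M (\<gamma> t) \<Longrightarrow> (\<lambda>s. snd c (\<gamma> s)) differentiable (at t)"
  shows "velocity M \<gamma> t \<in> tangent_space M (\<gamma> t)"
  unfolding tangent_space_def
proof (intro CollectI conjI allI ballI impI)
  fix c assume "c \<notin> charts_at M (\<gamma> t)"
  then show "velocity M \<gamma> t c = 0" by (simp add: velocity_def)
next
  fix c d assume C: "c \<in> charts_at M (\<gamma> t)" "d \<in> charts_at M (\<gamma> t)"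
  have "((\<lambda>s. snd c (\<gamma> s)) has_vector_derivative velocity M \<gamma> t c) (at t)"
    using \<gamma>[OF C(1)] C(1) by (simp add: velocity_def vector_derivative_works)
  from tr_curve_derivative[OF C ev[OF C(1)] ev[OF C(2)] this]
  show "velocity M \<gamma> t d = fD (tr c d) (snd c (\<gamma> t)) (velocity M \<gamma> t c)"
    using C by (simp add: velocity_def vector_derivative_at)
qed

text \<open>Differentiating the coordinate change of \<open>V\<close> produces a second derivative
  of the transition map. It cancels against the inhomogeneous term of
  \<open>christoffel_transition\<close>, so the values in all charts belong to one tangent
  vector.\<close>

lemma cov_deriv_tangent:
  assumes ev: "\<And>c. c \<in> charts_at M (\<gamma> t) \<Longrightarrow> \<forall>\<^sub>F s in nhds t. \<gamma> s \<in> fst c"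
    and \<gamma>: "\<And>c. c \<in> charts_at M (\<gamma> t) \<Longrightarrow> (\<lambda>s. snd c (\<gamma> s)) differentiable (at t)"
    and V: "\<And>c. c \<in> charts_at M (\<gamma> t) \<Longrightarrow> (\<lambda>s. V s c) differentiable (at t)"
    and VT: "\<And>s. V s \<in> tangent_space M (\<gamma> s)"
  shows "cov_deriv M \<gamma> V t \<in> tangent_space M (\<gamma> t)"
  unfolding tangent_space_def
proof (intro CollectI conjI allI ballI impI)
  fix c assume "c \<notin> charts_at M (\<gamma> t)"
  then show "cov_deriv M \<gamma> V t c = 0" by (simp add: cov_deriv_def)
next
  fix c d assume C: "c \<in> charts_at M (\<gamma> t)" "d \<in> charts_at M (\<gamma> t)"
  note A = charts_atD[OF C(1)] charts_atD[OF C(2)]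
  let ?T = "fD (tr c d) (snd c (\<gamma> t))" and ?g = "velocity M \<gamma> t c"
  let ?V' = "vector_derivative (\<lambda>s. V s c) (at t)"
  have vT: "velocity M \<gamma> t \<in> tangent_space M (\<gamma> t)" by (rule velocity_tangent) fact+
  have vc: "((\<lambda>s. snd c (\<gamma> s)) has_vector_derivative ?g) (at t)"
    using \<gamma>[OF C(1)] C(1) by (simp add: velocity_def vector_derivative_works)
  have Vc: "((\<lambda>s. V s c) has_vector_derivative ?V') (at t)"
    using V[OF C(1)] by (simp add: vector_derivative_works)
  have "((\<lambda>s. fD (tr c d) (snd c (\<gamma> s)) (V s c)) has_vector_derivative
      fD (\<lambda>y. fD (tr c d) y (V t c)) (snd c (\<gamma> t)) ?g + ?T ?V') (at t)"
    by (rule has_vector_derivative_fD_apply[OF smooth_tr open_cdom _ vc Vc]) (use A in auto)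
  moreover have "\<forall>\<^sub>F s in nhds t. fD (tr c d) (snd c (\<gamma> s)) (V s c) = V s d"
    using ev[OF C(1)] ev[OF C(2)]
    by eventually_elim (rule tangentD(1)[OF VT, symmetric], use A in \<open>auto intro: charts_atI\<close>)
  ultimately have Vd: "((\<lambda>s. V s d) has_vector_derivative
      fD (\<lambda>y. fD (tr c d) y (V t c)) (snd c (\<gamma> t)) ?g + ?T ?V') (at t)"
    by (rule has_vector_derivative_cong_nhds[THEN iffD1, rotated])
  have "cov_deriv M \<gamma> V t d = fD (\<lambda>y. fD (tr c d) y (V t c)) (snd c (\<gamma> t)) ?g + ?T ?V'
      + christoffel M d (snd d (\<gamma> t)) (?T ?g) (?T (V t c))"
    using C vector_derivative_at[OF Vd] tangentD(1)[OF vT C] tangentD(1)[OF VT C] by (simp add: cov_deriv_def)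
  also have "\<dots> = ?T ?V' + ?T (christoffel M c (snd c (\<gamma> t)) ?g (V t c))"
    using christoffel_transition[OF C, of ?g "V t c"] by (simp add: algebra_simps)
  also have "\<dots> = ?T (cov_deriv M \<gamma> V t c)"
    using C linear_add[OF linear_fD_tr[OF C]] by (simp add: cov_deriv_def)
  finally show "cov_deriv M \<gamma> V t d = ?T (cov_deriv M \<gamma> V t c)" .
qed

end


section \<open>Coordinates on the tangent bundle\<close>

text \<open>An explicit inverse of \<open>tangent_chart M c\<close>. It agrees with
  \<open>chart_inv (tangent_chart M c)\<close> over the chart image, but needs no choice, so its
  dependence on \<open>z\<close> can be computed.\<close>

definition tpoint :: "('a, 'e::euclidean_space) riemannian \<Rightarrow> ('a, 'e) chart \<Rightarrow> 'e \<times> 'e \<Rightarrow> 'a \<times> ('a, 'e) tvec" where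
  "tpoint M c z = (chart_inv c (fst z), tvec_of M c (chart_inv c (fst z)) (snd z))"

lemma smooth_on_fD_compose:
  assumes "smooth_on S f" "open S" "smooth_on T \<rho>" "smooth_on T h" "\<rho> ` T \<subseteq> S" "open T"
  shows "smooth_on T (\<lambda>z. fD f (\<rho> z) (h z))"
proof (rule smooth_on_cong[OF assms(6)])
  show "smooth_on T (\<lambda>z. \<Sum>b\<in>Basis. (h z \<bullet> b) *\<^sub>R fD f (\<rho> z) b)"
    by (intro smooth_on_sum smooth_on_scaleR smooth_on_inner smooth_on_const assms finite_Basis
        smooth_on_compose[OF smooth_on_fD[OF assms(1) smooth_on_const assms(2)] assms(3,5,6)])
  show "(\<Sum>b\<in>Basis. (h z \<bullet> b) *\<^sub>R fD f (\<rho> z) b) = fD f (\<rho> z) (h z)" if "z \<in> T" for z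
    by (rule linear_basis_expand[symmetric, OF linear_fD[OF smooth_on_imp_differentiable[OF assms(1)]]])
      (use assms(5) that in blast)
qed

lemma fD_Pair_const:
  fixes f :: "'x::euclidean_space \<times> 'y::euclidean_space \<Rightarrow> 'z::euclidean_space"
  assumes "f differentiable (at (q, b))"
  shows "((\<lambda>x. f (x, b)) has_derivative (\<lambda>h. fD f (q, b) (h, 0))) (at q)"
proof -
  have "((\<lambda>x. (x, b)) has_derivative (\<lambda>h. (h, 0))) (at q)" by (auto intro!: derivative_eq_intros)
  from has_derivative_compose[OF this fD_works[OF assms]] show ?thesis .
qed

text \<open>Homogeneity in the second argument survives differentiation in the first: the relation
  holds on the open set \<open>W\<close>, so both of its sides have the same derivative at
  \<open>q\<close>.\<close>

lemma fD_fst_homogeneous: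
  fixes f :: "'x::euclidean_space \<times> 'y::euclidean_space \<Rightarrow> 'z::euclidean_space"
  assumes "f differentiable (at (q, b))" "f differentiable (at (q, r *\<^sub>R b))" "open W" "q \<in> W"
    and hom: "\<And>q. q \<in> W \<Longrightarrow> f (q, r *\<^sub>R b) = r ^ k *\<^sub>R f (q, b)"
  shows "fD f (q, r *\<^sub>R b) (h, 0) = r ^ k *\<^sub>R fD f (q, b) (h, 0)"
proof -
  have "((\<lambda>q. f (q, r *\<^sub>R b)) has_derivative (\<lambda>h. r ^ k *\<^sub>R fD f (q, b) (h, 0))) (at q)"
    using has_derivative_scaleR_right[OF fD_Pair_const[OF assms(1)], of "r ^ k"]
    by (rule has_derivative_cong_open[OF assms(3,4), THEN iffD1, rotated]) (simp add: hom)
  from has_derivative_unique[OF this fD_Pair_const[OF assms(2)]] show ?thesis by (simp add: fun_eq_iff)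
qed

lemma line_has_vector_derivative:
  "((\<lambda>s. p + s *\<^sub>R h) has_vector_derivative h) (at t)"
  by (auto intro!: derivative_eq_intros)

context riem
begin

lemma chart_inv_charts_at: "c \<in> atlas M \<Longrightarrow> y \<in> cim c \<Longrightarrow> c \<in> charts_at M (chart_inv c y)"
  by (intro charts_atI chart_inv_in)

lemma inj_on_tangent_chart:
  assumes c: "c \<in> atlas M"
  shows "inj_on (snd (tangent_chart M c)) (fst (tangent_chart M c))"
proof (rule inj_onI; clarsimp simp: tangent_chart_def)
  fix x v x' v'
  assume A: "x \<in> fst c" "v \<in> tangent_space M x" "x' \<in> fst c" "v' \<in> tangent_space M x'"
    "snd c x = snd c x'" "v c = v' c"
  then have "x = x'" using inj_on_chart[OF c] by (auto dest: inj_onD)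
  then show "x = x' \<and> v = v'"
    using tvec_of_coord[OF A(2) charts_atI[OF c A(1)]] tvec_of_coord[OF A(4) charts_atI[OF c A(3)]] A(6)
    by metis
qed

lemma tpoint_in:
  assumes "c \<in> atlas M" "fst z \<in> cim c"
  shows "tpoint M c z \<in> fst (tangent_chart M c)"
  using tvec_of_tangent[OF chart_inv_charts_at[OF assms]] chart_inv_in[OF assms]
  by (simp add: tangent_chart_def tpoint_def)

lemma tangent_chart_tpoint:
  assumes "c \<in> atlas M" "fst z \<in> cim c"
  shows "snd (tangent_chart M c) (tpoint M c z) = z"
  using chart_inv_charts_at[OF assms] chart_chart_inv[OF assms]
  by (simp add: tangent_chart_def tpoint_def)

lemma chart_inv_tangent_chart:
  assumes "c \<in> atlas M" "fst z \<in> cim c"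
  shows "chart_inv (tangent_chart M c) z = tpoint M c z"
  using inv_into_f_eq[OF inj_on_tangent_chart[OF assms(1)] tpoint_in[OF assms] tangent_chart_tpoint[OF assms]] .

lemma tpoint_tangent_chart:
  assumes "c \<in> charts_at M x" "v \<in> tangent_space M x"
  shows "tpoint M c (snd c x, v c) = (x, v)"
  using charts_atD[OF assms(1)] tvec_of_coord[OF assms(2,1)] by (simp add: tpoint_def)

lemma topspace_TM: "topspace (TM_top M) = tangent_bundle M"
proof -
  have "\<Union> {{w \<in> fst C. snd C w \<in> Q} | C Q. C \<in> TM_atlas M \<and> open Q} = (\<Union>C\<in>TM_atlas M. fst C)"
  proof (intro antisym subsetI)
    fix w assume "w \<in> (\<Union>C\<in>TM_atlas M. fst C)"
    then obtain C where "C \<in> TM_atlas M" "w \<in> {w \<in> fst C. snd C w \<in> UNIV}" by blast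
    then show "w \<in> \<Union> {{w \<in> fst C. snd C w \<in> Q} | C Q. C \<in> TM_atlas M \<and> open Q}"
      using open_UNIV by blast
  qed blast
  also have "\<dots> = tangent_bundle M"
    by (auto simp: TM_atlas_def tangent_chart_def tangent_bundle_def topspace_eq)
  finally show ?thesis by (simp add: TM_top_def)
qed

lemma openin_TM_chart:
  assumes "c \<in> atlas M" "open Q"
  shows "openin (TM_top M) {w \<in> fst (tangent_chart M c). snd (tangent_chart M c) w \<in> Q}"
proof -
  have "tangent_chart M c \<in> TM_atlas M" using assms(1) by (simp add: TM_atlas_def)
  then show ?thesis
    unfolding TM_top_def using assms(2) by (intro topology_generated_by_Basis) blast
qed

text \<open>It suffices to test generating sets of \<open>TM_top M\<close>. The preimage of the one
  given by \<open>d\<close> and \<open>Q\<close> is the preimage of \<open>Q\<close> under the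
  coordinate change \<open>?h\<close> of the tangent bundle, which is smooth over the
  overlap.\<close>

lemma continuous_tpoint:
  assumes c: "c \<in> atlas M"
  shows "continuous_map (top_of_set (cim c \<times> UNIV)) (TM_top M) (tpoint M c)"
  unfolding TM_top_def
proof (rule continuous_on_generated_topo)
  fix U assume "U \<in> {{w \<in> fst C. snd C w \<in> Q} | C Q. C \<in> TM_atlas M \<and> open Q}"
  then obtain d Q where d: "d \<in> atlas M" "open Q"
    and U: "U = {w \<in> fst (tangent_chart M d). snd (tangent_chart M d) w \<in> Q}"
    unfolding TM_atlas_def by blast
  let ?W = "cdom c d \<times> (UNIV :: 'e set)"
  let ?h = "\<lambda>z. (tr c d (fst z), fD (tr c d) (fst z) (snd z))"
  have oW: "open ?W" using open_cdom[OF c d(1)] by (simp add: open_Times)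
  have "smooth_on ?W ?h"
    by (intro smooth_on_Pair smooth_on_fD_compose[OF smooth_tr[OF c d(1)] open_cdom[OF c d(1)]]
        smooth_on_compose[OF smooth_tr[OF c d(1)]] smooth_on_fst smooth_on_snd smooth_on_ident oW) auto
  then have "open (?W \<inter> ?h -` Q)"
    using smooth_on_imp_continuous_on continuous_open_preimage[OF _ oW d(2)] by blast
  moreover have "tpoint M c -` U \<inter> (cim c \<times> UNIV) = ?W \<inter> ?h -` Q"
  proof (rule set_eqI)
    fix z :: "'e \<times> 'e"
    have mem: "z \<in> ?W \<longleftrightarrow> fst z \<in> cim c \<and> chart_inv c (fst z) \<in> fst d"
      using c by (auto simp: mem_Times_iff image_iff chart_inv_in chart_chart_inv)
    show "z \<in> tpoint M c -` U \<inter> (cim c \<times> UNIV) \<longleftrightarrow> z \<in> ?W \<inter> ?h -` Q"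
    proof (cases "z \<in> ?W")
      case True
      then have A: "c \<in> charts_at M (chart_inv c (fst z))" "d \<in> charts_at M (chart_inv c (fst z))" "fst z \<in> cim c"
        using mem chart_inv_charts_at c d by (auto intro: charts_atI)
      have "snd (tangent_chart M d) (tpoint M c z) = ?h z"
        using tvec_of_apply[OF A(2)] chart_chart_inv[OF c A(3)] by (simp add: tangent_chart_def tpoint_def)
      moreover have "tpoint M c z \<in> fst (tangent_chart M d)"
        using tvec_of_tangent[OF A(1)] charts_atD[OF A(2)] by (simp add: tangent_chart_def tpoint_def)
      ultimately show ?thesis using True A by (simp add: U mem_Times_iff)
    next
      case False
      then show ?thesis using mem by (auto simp: U tangent_chart_def tpoint_def mem_Times_iff)
    qed
  qed
  ultimately have "open (tpoint M c -` U \<inter> (cim c \<times> UNIV))" by (simp only:)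
  then have "openin (top_of_set (cim c \<times> UNIV)) (tpoint M c -` U \<inter> (cim c \<times> UNIV))"
    by (intro open_subset) auto
  then show "openin (top_of_set (cim c \<times> UNIV)) (tpoint M c -` U \<inter> topspace (top_of_set (cim c \<times> UNIV)))"
    by simp
next
  have "tpoint M c z \<in> tangent_bundle M" if "z \<in> cim c \<times> UNIV" for z
  proof -
    have "tpoint M c z \<in> Sigma (fst c) (tangent_space M)"
      using tpoint_in[OF c, of z] that by (auto simp: tangent_chart_def)
    also have "\<dots> \<subseteq> tangent_bundle M"
      unfolding tangent_bundle_def by (rule Sigma_mono[OF fst_subset[OF c] order_refl])
    finally show ?thesis .
  qed
  then show "tpoint M c ` topspace (top_of_set (cim c \<times> UNIV)) \<subseteq>
     \<Union> {{w \<in> fst C. snd C w \<in> Q} | C Q. C \<in> TM_atlas M \<and> open Q}"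
    using topspace_TM unfolding TM_top_def by auto
qed

end


section \<open>Retractions in coordinates\<close>

locale retr = riem M for M :: "('a, 'e::euclidean_space) riemannian" +
  fixes R :: "'a \<times> ('a, 'e) tvec \<Rightarrow> 'a"
  assumes retr: "manifold_retraction M R"
begin

text \<open>The domain on which the coordinate expression \<open>F c d\<close> of the retraction is
  meaningful: vectors over the chart \<open>c\<close> that are mapped into the chart
  \<open>d\<close>.\<close>

definition Om :: "('a, 'e) chart \<Rightarrow> ('a, 'e) chart \<Rightarrow> ('e \<times> 'e) set" where
  "Om c d = {z. fst z \<in> cim c \<and> R (tpoint M c z) \<in> fst d}"

definition F :: "('a, 'e) chart \<Rightarrow> ('a, 'e) chart \<Rightarrow> 'e \<times> 'e \<Rightarrow> 'e" where
  "F c d z = snd d (R (tpoint M c z))"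

text \<open>\<open>G c d i ((y, w), b)\<close> represents, in the chart \<open>d\<close>, the \<open>i\<close>-th covariant derivative of the
  velocity at \<open>t = 0\<close> of the curve that has coordinates \<open>F c d (y, w + t b)\<close>.\<close>

primrec G :: "('a, 'e) chart \<Rightarrow> ('a, 'e) chart \<Rightarrow> nat \<Rightarrow> ('e \<times> 'e) \<times> 'e \<Rightarrow> 'e" where
  "G c d 0 = (\<lambda>z. fD (F c d) (fst z) (0, snd z))"
| "G c d (Suc i) = (\<lambda>z. fD (G c d i) z ((0, snd z), 0)
     + christoffel M d (F c d (fst z)) (fD (F c d) (fst z) (0, snd z)) (G c d i z))"

lemma retraction_zero: "x \<in> topspace (mtop M) \<Longrightarrow> R (x, tzero) = x"
  using retr by (simp add: manifold_retraction_def)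

lemma continuous_R: "continuous_map (TM_top M) (mtop M) R"
  using retr by (simp add: manifold_retraction_def smooth_map_def)

lemma R_topspace: "x \<in> topspace (mtop M) \<Longrightarrow> v \<in> tangent_space M x \<Longrightarrow> R (x, v) \<in> topspace (mtop M)"
  using continuous_R topspace_TM by (auto simp: continuous_map_def tangent_bundle_def)

lemma OmI: "fst z \<in> cim c \<Longrightarrow> d \<in> charts_at M (R (tpoint M c z)) \<Longrightarrow> z \<in> Om c d"
  by (simp add: Om_def charts_atD)

lemma OmD: "z \<in> Om c d \<Longrightarrow> fst z \<in> cim c" "z \<in> Om c d \<Longrightarrow> d \<in> atlas M \<Longrightarrow> d \<in> charts_at M (R (tpoint M c z))"
  by (simp_all add: Om_def charts_atI)

lemma R_chart_exists:
  assumes "c \<in> atlas M" "fst z \<in> cim c"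
  obtains d where "d \<in> atlas M" "z \<in> Om c d"
proof -
  have "R (tpoint M c z) \<in> topspace (mtop M)"
    using R_topspace[of "chart_inv c (fst z)"] tvec_of_tangent chart_inv_charts_at[OF assms] charts_at_topspace
    by (auto simp: tpoint_def)
  then obtain d where "d \<in> charts_at M (R (tpoint M c z))" using chart_exists by blast
  then show ?thesis using that assms OmI charts_atD by blast
qed

context
  fixes c d assumes c: "c \<in> atlas M" and d: "d \<in> atlas M"
begin

lemma open_Om: "open (Om c d)"
proof -
  have "continuous_map (top_of_set (cim c \<times> UNIV)) (mtop M) (R \<circ> tpoint M c)"
    using continuous_map_compose[OF continuous_tpoint[OF c] continuous_R] .
  from openin_continuous_map_preimage[OF this openin_fst[OF d]]
  have "openin (top_of_set (cim c \<times> UNIV)) (Om c d)"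
    by (rule back_subst[of "openin _"]) (auto simp: Om_def mem_Times_iff)
  then show ?thesis using open_cim[OF c] openin_open_trans open_Times open_UNIV by blast
qed

lemma smooth_F: "smooth_on (Om c d) (F c d)"
proof -
  let ?C = "tangent_chart M c"
  have "smooth_on (snd ?C ` {w \<in> fst ?C. R w \<in> fst d}) (snd d \<circ> R \<circ> chart_inv ?C)"
    using retr c d unfolding manifold_retraction_def smooth_map_def TM_atlas_def by blast
  moreover have "Om c d \<subseteq> snd ?C ` {w \<in> fst ?C. R w \<in> fst d}"
  proof
    fix z assume z: "z \<in> Om c d"
    then show "z \<in> snd ?C ` {w \<in> fst ?C. R w \<in> fst d}"
      using tpoint_in[OF c] tangent_chart_tpoint[OF c] by (intro image_eqI[of _ _ "tpoint M c z"]) (auto simp: Om_def)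
  qed
  ultimately have "smooth_on (Om c d) (snd d \<circ> R \<circ> chart_inv ?C)" by (rule smooth_on_subset)
  then show ?thesis
    by (rule smooth_on_cong[OF open_Om]) (simp add: Om_def F_def chart_inv_tangent_chart[OF c])
qed

lemma F_cim: "F c d ` Om c d \<subseteq> cim d"
  by (auto simp: F_def Om_def)

lemma open_Om_Times: "open (Om c d \<times> (UNIV :: 'e set))"
  using open_Om by (simp add: open_Times)

lemma smooth_F_fst: "smooth_on (Om c d \<times> (UNIV :: 'e set)) (\<lambda>z. F c d (fst z))"
  by (rule smooth_on_compose[OF smooth_F]) (auto intro: smooth_on_fst open_Om_Times)

lemma smooth_fD_F:
  assumes "smooth_on T \<rho>" "smooth_on T h" "\<rho> ` T \<subseteq> Om c d" "open T"
  shows "smooth_on T (\<lambda>z. fD (F c d) (\<rho> z) (h z))"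
  using smooth_on_fD_compose[OF smooth_F open_Om assms] .

lemma smooth_G0: "smooth_on (Om c d \<times> UNIV) (\<lambda>z. fD (F c d) (fst z) (0, snd z))"
  by (rule smooth_fD_F)
    (auto intro!: smooth_on_Pair smooth_on_const smooth_on_fst smooth_on_snd smooth_on_ident open_Om_Times)

lemma smooth_G: "smooth_on (Om c d \<times> UNIV) (G c d i)"
proof (induction i)
  case 0
  then show ?case using smooth_G0 by simp
next
  case (Suc i)
  have "smooth_on (Om c d \<times> UNIV) (\<lambda>z. fD (G c d i) z ((0, snd z), 0))"
    by (intro smooth_on_fD Suc smooth_on_Pair smooth_on_const smooth_on_snd smooth_on_ident open_Om_Times)
  moreover have "smooth_on (Om c d \<times> UNIV)
     (\<lambda>z. christoffel M d (F c d (fst z)) (fD (F c d) (fst z) (0, snd z)) (G c d i z))"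
    unfolding christoffel_eq_chris
    by (rule coord_metric.smooth_chris[OF coord_metric_chart[OF d] open_Om_Times smooth_F_fst smooth_G0 Suc])
      (use F_cim in auto)
  ultimately show ?case by (simp add: smooth_on_add open_Om_Times)
qed

end

context
  fixes c d assumes c: "c \<in> atlas M" and d: "d \<in> atlas M"
begin

lemma diff_F: "p \<in> Om c d \<Longrightarrow> F c d differentiable (at p)"
  using smooth_on_imp_differentiable[OF smooth_F[OF c d]] .

lemma diff_G: "p \<in> Om c d \<Longrightarrow> G c d i differentiable (at (p, b))"
  using smooth_on_imp_differentiable[OF smooth_G[OF c d]] by simp

lemma fD_F_scale: "p \<in> Om c d \<Longrightarrow> fD (F c d) p (0, r *\<^sub>R b) = r *\<^sub>R fD (F c d) p (0, b)"
  using linear_cmul[OF linear_fD[OF diff_F], of p r "(0, b)"] by simp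

lemma fD_G_scale: "p \<in> Om c d \<Longrightarrow> fD (G c d i) (p, b) ((0, r *\<^sub>R h), 0) = r *\<^sub>R fD (G c d i) (p, b) ((0, h), 0)"
  using linear_cmul[OF linear_fD[OF diff_G], of p i b r "((0, h), 0)"] by simp

text \<open>Each recursion step raises the degree by one in both summands: the derivative is taken
  in direction \<open>b\<close> itself, and the bilinear Christoffel term pairs
  \<open>G c d i\<close> with a velocity linear in \<open>b\<close>.\<close>

lemma G_homogeneous:
  "p \<in> Om c d \<Longrightarrow> G c d i (p, r *\<^sub>R b) = r ^ Suc i *\<^sub>R G c d i (p, b)"
proof (induction i arbitrary: p)
  case 0
  then show ?case by (simp add: fD_F_scale)
next
  case (Suc i)
  have "fD (G c d i) (p, r *\<^sub>R b) ((0, r *\<^sub>R b), 0) = r ^ Suc i *\<^sub>R fD (G c d i) (p, b) ((0, r *\<^sub>R b), 0)"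
    by (rule fD_fst_homogeneous[OF diff_G diff_G open_Om[OF c d]]) (use Suc in auto)
  moreover have "F c d p \<in> cim d" using F_cim[OF c d] Suc.prems by blast
  ultimately show ?case
    using Suc by (simp add: fD_G_scale fD_F_scale christoffel_scale[OF d] scaleR_add_right mult_ac)
qed

lemma fD_G_homogeneous:
  "p \<in> Om c d \<Longrightarrow> fD (G c d i) (p, r *\<^sub>R b) (h, 0) = r ^ Suc i *\<^sub>R fD (G c d i) (p, b) (h, 0)"
  by (rule fD_fst_homogeneous[OF diff_G diff_G open_Om[OF c d]]) (use G_homogeneous in auto)

end


subsection \<open>Curves\<close>

context
  fixes c p h \<gamma> assumes c: "c \<in> atlas M" and p: "fst p \<in> cim c"
  defines "\<gamma> \<equiv> \<lambda>s. R (tpoint M c (p + s *\<^sub>R (0, h)))"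
begin

lemma line_Om: "d \<in> charts_at M (\<gamma> t) \<Longrightarrow> p + t *\<^sub>R (0, h) \<in> Om c d"
  using p by (intro OmI) (auto simp: \<gamma>_def)

text \<open>Lying in the chart \<open>d\<close> means that the straight line lies in the open set
  \<open>Om c d\<close>, so it persists for nearby parameters.\<close>

lemma line_charts:
  assumes "d \<in> charts_at M (\<gamma> t)"
  shows "\<forall>\<^sub>F s in nhds t. d \<in> charts_at M (\<gamma> s)"
proof -
  have d: "d \<in> atlas M" using charts_atD assms by blast
  have "((\<lambda>s. p + s *\<^sub>R (0, h)) \<longlongrightarrow> p + t *\<^sub>R (0, h)) (nhds t)"
    by (intro tendsto_intros filterlim_ident)
  from topological_tendstoD[OF this open_Om[OF c d] line_Om[OF assms]]
  show ?thesis by eventually_elim (use d OmD in \<open>auto simp: \<gamma>_def\<close>)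
qed

lemma line_fst: "d \<in> charts_at M (\<gamma> t) \<Longrightarrow> \<forall>\<^sub>F s in nhds t. \<gamma> s \<in> fst d"
  using line_charts by (rule eventually_mono[OF _ charts_atD(2)])

lemma line_velocity:
  assumes "d \<in> charts_at M (\<gamma> t)"
  shows "((\<lambda>s. snd d (\<gamma> s)) has_vector_derivative fD (F c d) (p + t *\<^sub>R (0, h)) (0, h)) (at t)"
proof -
  have "((\<lambda>s. F c d (p + s *\<^sub>R (0, h))) has_vector_derivative fD (F c d) (p + t *\<^sub>R (0, h)) (0, h)) (at t)"
    using has_vector_derivative_fD[OF diff_F line_has_vector_derivative] line_Om[OF assms] c charts_atD[OF assms]
    by blast
  then show ?thesis by (simp add: F_def \<gamma>_def)
qed

lemma velocity_line_coord:
  "d \<in> charts_at M (\<gamma> t) \<Longrightarrow> velocity M \<gamma> t d = fD (F c d) (p + t *\<^sub>R (0, h)) (0, h)"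
  using vector_derivative_at[OF line_velocity] by (simp add: velocity_def)

lemma velocity_line_tangent: "velocity M \<gamma> t \<in> tangent_space M (\<gamma> t)"
  by (rule velocity_tangent[OF line_fst])
    (assumption | rule differentiableI_vector[OF line_velocity])+

text \<open>The field \<open>V\<close> is described by coordinate functions \<open>H d\<close> on
  the tangent bundle and is not tied to the direction \<open>h\<close> of the curve. This covers
  both the iterated derivatives, where the two directions coincide, and condition (2), where they
  differ.\<close>

lemma cov_deriv_line:
  assumes V: "\<And>s. V s \<in> tangent_space M (\<gamma> s)"
    and co: "\<And>s d. d \<in> charts_at M (\<gamma> s) \<Longrightarrow> V s d = H d (p + s *\<^sub>R (0, h))"
    and H: "\<And>d q. d \<in> atlas M \<Longrightarrow> q \<in> Om c d \<Longrightarrow> H d differentiable (at q)"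
  shows "cov_deriv M \<gamma> V t \<in> tangent_space M (\<gamma> t)"
    and "d \<in> charts_at M (\<gamma> t) \<Longrightarrow> cov_deriv M \<gamma> V t d = fD (H d) (p + t *\<^sub>R (0, h)) (0, h)
      + christoffel M d (F c d (p + t *\<^sub>R (0, h))) (fD (F c d) (p + t *\<^sub>R (0, h)) (0, h)) (H d (p + t *\<^sub>R (0, h)))"
proof -
  have D: "((\<lambda>s. V s d) has_vector_derivative fD (H d) (p + t *\<^sub>R (0, h)) (0, h)) (at t)"
    if d: "d \<in> charts_at M (\<gamma> t)" for d
  proof -
    have "((\<lambda>s. H d (p + s *\<^sub>R (0, h))) has_vector_derivative fD (H d) (p + t *\<^sub>R (0, h)) (0, h)) (at t)"
      using has_vector_derivative_fD[OF H line_has_vector_derivative] line_Om[OF d] charts_atD[OF d]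
      by blast
    moreover have "\<forall>\<^sub>F s in nhds t. H d (p + s *\<^sub>R (0, h)) = V s d"
      using line_charts[OF d] by eventually_elim (simp add: co)
    ultimately show ?thesis by (rule has_vector_derivative_cong_nhds[THEN iffD1, rotated])
  qed
  show "cov_deriv M \<gamma> V t \<in> tangent_space M (\<gamma> t)"
    by (rule cov_deriv_tangent[OF line_fst _ _ V])
      (assumption | rule differentiableI_vector[OF line_velocity] differentiableI_vector[OF D])+
  show "cov_deriv M \<gamma> V t d = fD (H d) (p + t *\<^sub>R (0, h)) (0, h)
      + christoffel M d (F c d (p + t *\<^sub>R (0, h))) (fD (F c d) (p + t *\<^sub>R (0, h)) (0, h)) (H d (p + t *\<^sub>R (0, h)))"
    if d: "d \<in> charts_at M (\<gamma> t)"
  proof -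
    have "snd d (\<gamma> t) = F c d (p + t *\<^sub>R (0, h))" by (simp add: F_def \<gamma>_def)
    then show ?thesis
      using d vector_derivative_at[OF D[OF d]] velocity_line_coord[OF d] co[OF d] by (simp add: cov_deriv_def)
  qed
qed

text \<open>Both claims are proved together for all \<open>t\<close> and \<open>d\<close>: to
  differentiate once more, the previous field has to be tangent at every parameter and known in
  every chart.\<close>

lemma iter_cov_deriv_line:
  "(cov_deriv M \<gamma> ^^ i) (velocity M \<gamma>) t \<in> tangent_space M (\<gamma> t)"
  "d \<in> charts_at M (\<gamma> t) \<Longrightarrow> (cov_deriv M \<gamma> ^^ i) (velocity M \<gamma>) t d = G c d i (p + t *\<^sub>R (0, h), h)"
proof (induction i arbitrary: t d)
  case 0
  {
    case 1
    show ?case using velocity_line_tangent by simp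
  next
    case 2
    then show ?case using velocity_line_coord by simp
  }
next
  case (Suc i)
  let ?V = "(cov_deriv M \<gamma> ^^ i) (velocity M \<gamma>)"
  have H: "((\<lambda>q. G c d i (q, h)) has_derivative (\<lambda>k. fD (G c d i) (q, h) (k, 0))) (at q)"
    if "d \<in> atlas M" "q \<in> Om c d" for d q
    by (rule fD_Pair_const[OF diff_G[OF c that]])
  then have H': "(\<lambda>q. G c d i (q, h)) differentiable (at q)" if "d \<in> atlas M" "q \<in> Om c d" for d q
    using that unfolding differentiable_def by blast
  note CD = cov_deriv_line[of ?V "\<lambda>d q. G c d i (q, h)", OF Suc.IH(1) Suc.IH(2) H']
  {
    case 1
    show ?case using CD(1) by simp
  next
    case 2
    have "fD (\<lambda>q. G c d i (q, h)) (p + t *\<^sub>R (0, h)) = (\<lambda>k. fD (G c d i) (p + t *\<^sub>R (0, h), h) (k, 0))"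
      by (rule fD_eqI[OF H[OF charts_atD(1)[OF 2] line_Om[OF 2]]])
    then show ?case using CD(2)[OF _ _ _ 2] by simp
  }
qed

end

end


section \<open>Uniform bounds\<close>

text \<open>The bound \<open>P w C\<close> is kept abstract so that the same covering argument
  serves compact sets of points, of tangent vectors and of coordinates.\<close>

lemma compactin_uniform:
  fixes P :: "'w \<Rightarrow> real \<Rightarrow> bool"
  assumes K: "compactin X K"
    and loc: "\<And>k. k \<in> K \<Longrightarrow> \<exists>W C. openin X W \<and> k \<in> W \<and> (\<forall>w\<in>W \<inter> K. P w C)"
    and mono: "\<And>w C C'. w \<in> K \<Longrightarrow> P w C \<Longrightarrow> C \<le> C' \<Longrightarrow> P w C'"
  shows "\<exists>C\<ge>0. \<forall>w\<in>K. P w C"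
proof -
  obtain W C where W: "\<And>k. k \<in> K \<Longrightarrow> openin X (W k) \<and> k \<in> W k \<and> (\<forall>w\<in>W k \<inter> K. P w (C k))"
    using loc by metis
  have "\<forall>U\<in>W ` K. openin X U" "K \<subseteq> \<Union> (W ` K)" using W by auto
  then obtain \<F> where \<F>: "finite \<F>" "\<F> \<subseteq> W ` K" "K \<subseteq> \<Union>\<F>"
    using K unfolding compactin_def by meson
  then obtain I where I: "finite I" "I \<subseteq> K" "\<F> = W ` I" using finite_subset_image by metis
  \<comment> \<open>A sum of absolute values dominates every \<open>C k\<close> and is nonnegative
    even for an empty index set.\<close>
  define B where "B = (\<Sum>k\<in>I. \<bar>C k\<bar>)"
  have "P w B" if w: "w \<in> K" for w
  proof -
    obtain k where k: "k \<in> I" "w \<in> W k" using w \<F>(3) I(3) by blast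
    have "\<bar>C k\<bar> \<le> B" unfolding B_def using k(1) I(1) by (intro member_le_sum) auto
    then have "C k \<le> B" by simp
    then show ?thesis using mono[OF w _ \<open>C k \<le> B\<close>] W[of k] k I(2) w by blast
  qed
  moreover have "B \<ge> 0" by (simp add: B_def sum_nonneg)
  ultimately show ?thesis by blast
qed

lemma unit_vector_decomposition:
  fixes a :: "'a::euclidean_space"
  obtains u where "norm u = 1" "a = norm a *\<^sub>R u"
proof (cases "a = 0")
  case True
  then show ?thesis using that[of "SOME i. i \<in> Basis"] norm_Basis SOME_Basis by auto
next
  case False
  then show ?thesis using that[of "a /\<^sub>R norm a"] by simp
qed

text \<open>Compactness bounds \<open>f\<close> on \<open>Q\<close> times two unit spheres, and
  homogeneity carries the bound to all vectors. Exponent \<open>0\<close> admits a dummy argument,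
  which covers homogeneity in a single vector.\<close>

lemma bihomogeneous_bound:
  fixes f :: "'p::topological_space \<Rightarrow> 'a::euclidean_space \<Rightarrow> 'b::euclidean_space \<Rightarrow> 'c::real_normed_vector"
  assumes Q: "compact Q" and cont: "continuous_on (Q \<times> UNIV \<times> UNIV) (\<lambda>z. f (fst z) (fst (snd z)) (snd (snd z)))"
    and hom: "\<And>p a b r s. p \<in> Q \<Longrightarrow> f p (r *\<^sub>R a) (s *\<^sub>R b) = (r ^ j * s ^ k) *\<^sub>R f p a b"
  obtains C where "C \<ge> 0" "\<And>p a b. p \<in> Q \<Longrightarrow> norm (f p a b) \<le> C * norm a ^ j * norm b ^ k"
proof -
  let ?S = "Q \<times> sphere (0 :: 'a) 1 \<times> sphere (0 :: 'b) 1"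
  let ?g = "\<lambda>z. f (fst z) (fst (snd z)) (snd (snd z))"
  have "compact (?g ` ?S)"
    using Q by (intro compact_continuous_image continuous_on_subset[OF cont] compact_Times) auto
  then have "bounded (?g ` ?S)" by (rule compact_imp_bounded)
  then obtain C where "\<forall>x\<in>?g ` ?S. norm x \<le> C" unfolding bounded_iff by blast
  then have C: "norm (?g z) \<le> C" if "z \<in> ?S" for z using that by blast
  show ?thesis
  proof (rule that[of "max C 0"])
    fix p and a :: 'a and b :: 'b assume p: "p \<in> Q"
    obtain u where u: "norm u = 1" "a = norm a *\<^sub>R u" by (rule unit_vector_decomposition[of a])
    obtain w where w: "norm w = 1" "b = norm b *\<^sub>R w" by (rule unit_vector_decomposition[of b])
    have "f p a b = f p (norm a *\<^sub>R u) (norm b *\<^sub>R w)" using u(2) w(2) by simp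
    also have "\<dots> = (norm a ^ j * norm b ^ k) *\<^sub>R f p u w" by (rule hom[OF p])
    finally have "norm (f p a b) = (norm a ^ j * norm b ^ k) * norm (f p u w)" by simp
    also have "\<dots> \<le> (norm a ^ j * norm b ^ k) * max C 0"
      using C[of "(p, u, w)"] p u w by (intro mult_left_mono) auto
    finally show "norm (f p a b) \<le> max C 0 * norm a ^ j * norm b ^ k" by (simp add: mult_ac)
  qed simp
qed

context riem
begin

lemma tnorm_nonneg:
  assumes "c \<in> charts_at M x" "v \<in> tangent_space M x"
  shows "tnorm M x v \<ge> 0"
proof -
  have "snd c x \<in> cim c" using charts_atD[OF assms(1)] by blast
  from coord_metric.form[OF coord_metric_chart this] charts_atD[OF assms(1)]
  have g: "inner_form (metric_coord M c (snd c x))" by blast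
  have "metric_coord M c (snd c x) (v c) (v c) \<ge> 0"
    using inner_formD(4)[OF g, of "v c"] linear_0[OF inner_formD(1)[OF g]] by (cases "v c = 0") auto
  then show ?thesis using metric_eq_coord[OF assms(1,2,2)] by (simp add: tnorm_def)
qed

text \<open>Coercivity after taking square roots. It converts estimates by coordinate norms at the
  base point into estimates by the Riemannian norm.\<close>

lemma tnorm_lower:
  assumes c: "c \<in> atlas M" and Q: "compact Q" "Q \<subseteq> cim c"
  obtains m where "m > 0" "\<And>x v. x \<in> fst c \<Longrightarrow> snd c x \<in> Q \<Longrightarrow> v \<in> tangent_space M x \<Longrightarrow>
     m * norm (v c) \<le> tnorm M x v"
proof -
  obtain m where m: "m > 0" "\<And>y a. y \<in> Q \<Longrightarrow> m * (norm a)\<^sup>2 \<le> metric_coord M c y a a"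
    using coord_metric.coercive[OF coord_metric_chart[OF c] Q] by blast
  show ?thesis
  proof (rule that[of "sqrt m"])
    fix x v assume x: "x \<in> fst c" "snd c x \<in> Q" and v: "v \<in> tangent_space M x"
    have "sqrt m * norm (v c) = sqrt (m * (norm (v c))\<^sup>2)" by (simp add: real_sqrt_mult)
    also have "\<dots> \<le> tnorm M x v"
      unfolding tnorm_def metric_eq_coord[OF charts_atI[OF c x(1)] v v]
      by (rule real_sqrt_le_mono) (rule m(2)[OF x(2)])
    finally show "sqrt m * norm (v c) \<le> tnorm M x v" .
  qed (use m in simp)
qed

text \<open>Estimates that are local in coordinates \<open>(y, a, t)\<close> become uniform over a compact set of
  points \<open>(x, v)\<close> and all \<open>t \<in> [0, 1]\<close>.\<close>

lemma globalize:
  fixes N :: "'a \<Rightarrow> ('a, 'e) tvec \<Rightarrow> ('a, 'e) tvec \<Rightarrow> real \<Rightarrow> real"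
  assumes K: "compactin (TM_top M) K"
    and loc: "\<And>c y0 a0 t0. c \<in> atlas M \<Longrightarrow> y0 \<in> cim c \<Longrightarrow> \<exists>U C. open U \<and> (y0, a0, t0) \<in> U \<and>
      (\<forall>y a t b. (y, a, t) \<in> U \<longrightarrow> y \<in> cim c \<longrightarrow>
         N (chart_inv c y) (tvec_of M c (chart_inv c y) a) (tvec_of M c (chart_inv c y) b) t
           \<le> C * norm a ^ j * norm b ^ k)"
  shows "\<exists>C. \<forall>(x, v)\<in>K. \<forall>u\<in>tangent_space M x. \<forall>t\<in>{0..1}.
     N x v u t \<le> C * tnorm M x v ^ j * tnorm M x u ^ k"
proof -
  let ?P = "\<lambda>w C. \<forall>u\<in>tangent_space M (fst w). \<forall>t\<in>{0..1}.
     N (fst w) (snd w) u t \<le> C * tnorm M (fst w) (snd w) ^ j * tnorm M (fst w) u ^ k"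
  have KT: "w \<in> K \<Longrightarrow> fst w \<in> topspace (mtop M) \<and> snd w \<in> tangent_space M (fst w)" for w
    using compactin_subset_topspace[OF K] topspace_TM by (auto simp: tangent_bundle_def)
  have "\<exists>C\<ge>0. \<forall>w\<in>K. ?P w C"
  proof (rule compactin_uniform[OF K])
    fix w0 assume w0: "w0 \<in> K"
    obtain c where c: "c \<in> charts_at M (fst w0)" using chart_exists KT[OF w0] by blast
    note C = charts_atD[OF c]
    define y0 a0 where "y0 = snd c (fst w0)" and "a0 = snd w0 c"
    have "y0 \<in> cim c" using C by (simp add: y0_def)
    then obtain r where r: "r > 0" "cball y0 r \<subseteq> cim c" using open_contains_cball open_cim[OF C(1)] by blast
    let ?Q = "cball y0 r \<times> cball a0 r \<times> {0..1::real}"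
    let ?B = "\<lambda>z C. \<forall>b. N (chart_inv c (fst z)) (tvec_of M c (chart_inv c (fst z)) (fst (snd z)))
         (tvec_of M c (chart_inv c (fst z)) b) (snd (snd z)) \<le> C * norm (fst (snd z)) ^ j * norm b ^ k"
    \<comment> \<open>Compactness is used twice. Here it makes the bound uniform in \<open>t\<close>
      and over a small box of coordinates; the enclosing argument then covers \<open>K\<close> by
      such boxes.\<close>
    have "\<exists>B\<ge>0. \<forall>z\<in>?Q. ?B z B"
    proof (rule compactin_uniform)
      show "compactin euclidean ?Q" by (simp add: compact_Times)
    next
      fix z assume z: "z \<in> ?Q"
      then have "fst z \<in> cim c" using r(2) by auto
      from loc[OF C(1) this, of "fst (snd z)" "snd (snd z)"]
      obtain U B where U: "open U" "(fst z, fst (snd z), snd (snd z)) \<in> U"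
        and B: "\<And>y a t b. (y, a, t) \<in> U \<Longrightarrow> y \<in> cim c \<Longrightarrow>
          N (chart_inv c y) (tvec_of M c (chart_inv c y) a) (tvec_of M c (chart_inv c y) b) t
           \<le> B * norm a ^ j * norm b ^ k" by blast
      have "?B w B" if "w \<in> U \<inter> ?Q" for w
        using B[of "fst w" "fst (snd w)" "snd (snd w)"] that r(2) by auto
      then show "\<exists>W C. openin euclidean W \<and> z \<in> W \<and> (\<forall>w\<in>W \<inter> ?Q. ?B w C)"
        using U by (intro exI[of _ U] exI[of _ B]) auto
    next
      fix w C C' assume "?B w C" "C \<le> (C'::real)"
      then show "?B w C'"
        by (meson mult_right_mono norm_ge_zero order_trans zero_le_power)
    qed
    then obtain B where B: "B \<ge> 0" "\<And>z. z \<in> ?Q \<Longrightarrow> ?B z B" by blast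
    obtain m where m: "m > 0" "\<And>x v. x \<in> fst c \<Longrightarrow> snd c x \<in> cball y0 r \<Longrightarrow> v \<in> tangent_space M x \<Longrightarrow>
     m * norm (v c) \<le> tnorm M x v"
      using tnorm_lower[OF C(1) compact_cball r(2)] by blast
    let ?W = "{w \<in> fst (tangent_chart M c). snd (tangent_chart M c) w \<in> ball y0 r \<times> ball a0 r}"
    \<comment> \<open>Each of the \<open>j + k\<close> coordinate norms in the bound is exchanged
      for a Riemannian norm at the price of a factor \<open>1 / m\<close>.\<close>
    have "?P w (B / (m ^ j * m ^ k))" if w: "w \<in> ?W" for w
    proof (intro ballI)
      fix u t assume u: "u \<in> tangent_space M (fst w)" and t: "t \<in> {0..1::real}"
      obtain x v where xv: "w = (x, v)" by (cases w)
      have x: "x \<in> fst c" "snd c x \<in> cball y0 r" and v: "v \<in> tangent_space M x" "v c \<in> cball a0 r"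
        using w by (auto simp: xv tangent_chart_def)
      note ux = u[unfolded xv fst_conv]
      have cx: "c \<in> charts_at M x" using C(1) x(1) by (rule charts_atI)
      have "N x v u t \<le> B * norm (v c) ^ j * norm (u c) ^ k"
        using B(2)[of "(snd c x, v c, t)"] x v t C(1) tvec_of_coord[OF v(1) cx] tvec_of_coord[OF ux cx]
        by (auto dest!: spec[of _ "u c"])
      also have "\<dots> = B / (m ^ j * m ^ k) * ((m * norm (v c)) ^ j * (m * norm (u c)) ^ k)"
        using m(1) by (simp add: power_mult_distrib)
      also have "\<dots> \<le> B / (m ^ j * m ^ k) * (tnorm M x v ^ j * tnorm M x u ^ k)"
        using m(1) B(1) m(2)[OF x v(1)] m(2)[OF x ux] tnorm_nonneg[OF cx v(1)]
        by (intro mult_left_mono mult_mono power_mono) auto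
      finally show "N (fst w) (snd w) u t \<le> B / (m ^ j * m ^ k) * tnorm M (fst w) (snd w) ^ j * tnorm M (fst w) u ^ k"
        by (simp add: xv mult.assoc)
    qed
    moreover have "openin (TM_top M) ?W" by (rule openin_TM_chart[OF C(1)]) (simp add: open_Times)
    moreover have "w0 \<in> ?W"
      using C KT[OF w0] r(1) by (cases w0) (auto simp: tangent_chart_def y0_def a0_def)
    ultimately show "\<exists>W C. openin (TM_top M) W \<and> w0 \<in> W \<and> (\<forall>w\<in>W \<inter> K. ?P w C)"
      by (intro exI[of _ ?W] exI[of _ "B / (m ^ j * m ^ k)"] conjI ballI) (simp_all only: Int_iff)
  next
    fix w C C' assume w: "w \<in> K" "?P w C" "C \<le> (C'::real)"
    obtain c where c: "c \<in> charts_at M (fst w)" using chart_exists KT[OF w(1)] by blast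
    show "?P w C'"
    proof (intro ballI)
      fix u t assume u: "u \<in> tangent_space M (fst w)" and t: "t \<in> {0..1::real}"
      have "N (fst w) (snd w) u t \<le> C * tnorm M (fst w) (snd w) ^ j * tnorm M (fst w) u ^ k"
        using w(2) u t by blast
      also have "\<dots> \<le> C' * tnorm M (fst w) (snd w) ^ j * tnorm M (fst w) u ^ k"
        using w(3) tnorm_nonneg[OF c u] tnorm_nonneg[OF c] KT[OF w(1)] by (intro mult_right_mono) auto
      finally show "N (fst w) (snd w) u t \<le> C' * tnorm M (fst w) (snd w) ^ j * tnorm M (fst w) u ^ k" .
    qed
  qed
  then show ?thesis by (auto simp: case_prod_beta)
qed

end

section \<open>Local estimates for retraction curves\<close>

context retr
begin

lemma retr_curve_coord:
  assumes c: "c \<in> atlas M" and y: "y \<in> cim c"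
  shows "R (chart_inv c y, tscale t (tvec_of M c (chart_inv c y) a)) = R (tpoint M c (y, t *\<^sub>R a))"
    and "retr_curve R (chart_inv c y) (tvec_of M c (chart_inv c y) a) (tvec_of M c (chart_inv c y) b)
      = (\<lambda>s. R (tpoint M c ((y, a) + s *\<^sub>R (0, b))))"
    and "retr_curve R (chart_inv c y) (tscale t (tvec_of M c (chart_inv c y) a)) (tvec_of M c (chart_inv c y) b)
      = (\<lambda>s. R (tpoint M c ((y, t *\<^sub>R a) + s *\<^sub>R (0, b))))"
  by (simp_all add: retr_curve_def fun_eq_iff tpoint_def tvec_of_add[OF chart_inv_charts_at[OF c y]]
      tvec_of_scale[OF chart_inv_charts_at[OF c y]])

text \<open>The opposite comparison to \<open>tnorm_lower\<close>, now at the image point and in the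
  chart \<open>d\<close>: the metric there is bilinear and continuous in \<open>p\<close>, and
  \<open>C\<close> bounds its square.\<close>

lemma fibre_bound:
  assumes c: "c \<in> atlas M" and d: "d \<in> atlas M" and Q: "compact Q" "Q \<subseteq> Om c d"
  obtains K where "K \<ge> 0" "\<And>p \<xi>. p \<in> Q \<Longrightarrow> \<xi> \<in> tangent_space M (R (tpoint M c p)) \<Longrightarrow>
    tnorm M (R (tpoint M c p)) \<xi> \<le> K * norm (\<xi> d)"
proof -
  have ch: "d \<in> charts_at M (R (tpoint M c p))" if "p \<in> Q" for p using OmD(2)[OF _ d] Q(2) that by blast
  have Fd: "F c d p \<in> cim d" if "p \<in> Q" for p using F_cim[OF c d] Q(2) that by blast
  have o: "open (Om c d \<times> (UNIV :: 'e set) \<times> (UNIV :: 'e set))"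
    by (intro open_Times open_Om[OF c d] open_UNIV)
  have "smooth_on (Om c d \<times> UNIV \<times> UNIV) (\<lambda>z. metric_coord M d (F c d (fst z)) (fst (snd z)) (snd (snd z)))"
    by (intro coord_metric.smooth_metric[OF coord_metric_chart[OF d] o]
        smooth_on_compose[OF smooth_F[OF c d]] smooth_on_fst smooth_on_snd smooth_on_ident open_Times open_Om[OF c d] open_UNIV)
      (use F_cim[OF c d] in auto)
  then have "continuous_on (Q \<times> UNIV \<times> UNIV)
      (\<lambda>z. metric_coord M d (F c d (fst z)) (fst (snd z)) (snd (snd z)))"
    by (rule continuous_on_subset[OF smooth_on_imp_continuous_on]) (use Q(2) in auto)
  moreover have "metric_coord M d (F c d p) (r *\<^sub>R a) (s *\<^sub>R b) = (r ^ 1 * s ^ 1) *\<^sub>R metric_coord M d (F c d p) a b"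
    if "p \<in> Q" for p a b r s
    using inner_formD(5)[OF coord_metric.form[OF coord_metric_chart[OF d] Fd[OF that]]]
    by (simp add: bilinear_lmul bilinear_rmul)
  ultimately obtain C where C: "C \<ge> 0" "\<And>p a b. p \<in> Q \<Longrightarrow>
      norm (metric_coord M d (F c d p) a b) \<le> C * norm a ^ 1 * norm b ^ 1"
    using bihomogeneous_bound[OF Q(1), of "\<lambda>p. metric_coord M d (F c d p)" 1 1] by blast
  show ?thesis
  proof (rule that[of "sqrt C"])
    fix p \<xi> assume p: "p \<in> Q" and \<xi>: "\<xi> \<in> tangent_space M (R (tpoint M c p))"
    have "tnorm M (R (tpoint M c p)) \<xi> = sqrt (metric_coord M d (F c d p) (\<xi> d) (\<xi> d))"
      unfolding tnorm_def metric_eq_coord[OF ch[OF p] \<xi> \<xi>] by (simp add: F_def)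
    also have "\<dots> \<le> sqrt (C * (norm (\<xi> d))\<^sup>2)"
      using C(2)[OF p, of "\<xi> d" "\<xi> d"] by (intro real_sqrt_le_mono) (simp add: power2_eq_square mult.assoc)
    also have "\<dots> = sqrt C * norm (\<xi> d)" by (simp add: real_sqrt_mult)
    finally show "tnorm M (R (tpoint M c p)) \<xi> \<le> sqrt C * norm (\<xi> d)" .
  qed (use C(1) in simp)
qed

text \<open>\<open>bihomogeneous_bound\<close> with a dummy argument of degree
  \<open>0\<close>.\<close>

lemma G_bound:
  assumes c: "c \<in> atlas M" and d: "d \<in> atlas M" and Q: "compact Q" "Q \<subseteq> Om c d"
  obtains C where "C \<ge> 0" "\<And>p b. p \<in> Q \<Longrightarrow> norm (G c d i (p, b)) \<le> C * norm b ^ Suc i"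
proof -
  have "continuous_on (Q \<times> UNIV \<times> UNIV) (\<lambda>z :: ('e \<times> 'e) \<times> 'e \<times> 'e. G c d i (fst z, snd (snd z)))"
    by (rule continuous_on_compose2[OF smooth_on_imp_continuous_on[OF smooth_G[OF c d]]])
      (use Q(2) in \<open>auto intro!: continuous_intros\<close>)
  moreover have "G c d i (p, s *\<^sub>R b) = (r ^ 0 * s ^ Suc i) *\<^sub>R G c d i (p, b)" if "p \<in> Q" for p b s and r :: real
    using G_homogeneous[OF c d, of p i s b] that Q(2) by auto
  ultimately obtain C where "C \<ge> 0" "\<And>p (a :: 'e) b. p \<in> Q \<Longrightarrow> norm (G c d i (p, b)) \<le> C * norm a ^ 0 * norm b ^ Suc i"
    using bihomogeneous_bound[OF Q(1), of "\<lambda>p (a :: 'e) b. G c d i (p, b)" 0 "Suc i"] by blast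
  then show ?thesis using that by auto
qed

lemma vanishing_bound:
  assumes c: "c \<in> atlas M" and d: "d \<in> atlas M" and z0: "z0 \<in> Om c d"
    and vanish: "\<And>y b. (y, 0) \<in> Om c d \<Longrightarrow> G c d i ((y, 0), b) = 0"
  obtains r C where "r > 0" "C \<ge> 0" "cball z0 r \<subseteq> Om c d"
    "\<And>p b. p \<in> cball z0 r \<Longrightarrow> norm (G c d i (p, b)) \<le> C * norm (snd p) * norm b ^ Suc i"
proof -
  obtain r0 where r0: "r0 > 0" "cball z0 r0 \<subseteq> Om c d"
    using open_contains_cball open_Om[OF c d] z0 by blast
  show ?thesis
  proof (cases "snd z0 = 0")
    case False
    obtain C where C: "C \<ge> 0" "\<And>p b. p \<in> cball z0 r0 \<Longrightarrow> norm (G c d i (p, b)) \<le> C * norm b ^ Suc i"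
      using G_bound[OF c d compact_cball r0(2)] by blast
    \<comment> \<open>Within distance \<open>?h\<close> of \<open>z0\<close> the fibre part has norm
      at least \<open>?h\<close>, so the missing factor \<open>norm (snd p)\<close> costs only a
      division by \<open>?h\<close>.\<close>
    let ?h = "norm (snd z0) / 2"
    have h: "?h > 0" using False by simp
    show ?thesis
    proof (rule that[of "min r0 ?h" "C / ?h"])
      fix p b assume p: "p \<in> cball z0 (min r0 ?h)"
      have "norm (snd z0 - snd p) \<le> norm (z0 - p)"
        by (metis norm_snd_le prod.collapse snd_diff)
      then have "norm (snd z0 - snd p) \<le> ?h" using p by (simp add: dist_norm)
      then have w: "?h \<le> norm (snd p)" using norm_triangle_sub[of "snd z0" "snd p"] by linarith
      have "norm (G c d i (p, b)) \<le> C * norm b ^ Suc i * 1" using C(2)[of p b] p by simp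
      also have "\<dots> \<le> C * norm b ^ Suc i * (norm (snd p) / ?h)"
        using w h C(1) by (intro mult_left_mono) (auto simp: le_divide_eq)
      finally show "norm (G c d i (p, b)) \<le> C / ?h * norm (snd p) * norm b ^ Suc i"
        by (simp add: mult_ac)
    qed (use r0 h C(1) in \<open>auto intro: divide_nonneg_pos\<close>)
  next
    case True
    \<comment> \<open>The derivative of \<open>G c d i\<close> along the fibre: linear in
      \<open>h\<close>, which yields the factor \<open>norm w\<close> in the mean value estimate,
      and still of degree \<open>Suc i\<close> in \<open>b\<close>.\<close>
    let ?f = "\<lambda>p h b. fD (G c d i) (p, b) ((0, h), 0)"
    have o: "open (Om c d \<times> (UNIV :: 'e set) \<times> (UNIV :: 'e set))"
      by (intro open_Times open_Om[OF c d] open_UNIV)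
    have "smooth_on (Om c d \<times> UNIV \<times> UNIV) (\<lambda>z. ?f (fst z) (fst (snd z)) (snd (snd z)))"
      by (rule smooth_on_fD_compose[OF smooth_G[OF c d] open_Om_Times[OF c d]])
        (auto intro!: smooth_on_Pair smooth_on_fst smooth_on_snd smooth_on_const smooth_on_ident open_Times open_Om[OF c d] open_UNIV)
    then have "continuous_on (cball z0 r0 \<times> UNIV \<times> UNIV) (\<lambda>z. ?f (fst z) (fst (snd z)) (snd (snd z)))"
      by (rule continuous_on_subset[OF smooth_on_imp_continuous_on]) (use r0(2) in auto)
    moreover have "?f p (r *\<^sub>R h) (s *\<^sub>R b) = (r ^ 1 * s ^ Suc i) *\<^sub>R ?f p h b" if "p \<in> cball z0 r0" for p h b r s
    proof -
      have "p \<in> Om c d" using r0(2) that by blast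
      then show ?thesis
        using fD_G_homogeneous[OF c d, of p i s b "(0, r *\<^sub>R h)"] fD_G_scale[OF c d, of p i b r h]
        by (simp add: mult.commute)
    qed
    ultimately obtain C where C: "C \<ge> 0"
      "\<And>p h b. p \<in> cball z0 r0 \<Longrightarrow> norm (?f p h b) \<le> C * norm h ^ 1 * norm b ^ Suc i"
      using bihomogeneous_bound[OF compact_cball, of z0 r0 ?f 1 "Suc i"] by blast
    show ?thesis
    proof (rule that[OF r0(1) C(1) r0(2)])
      fix p b assume p: "p \<in> cball z0 r0"
      define y w where "y = fst p" and "w = snd p"
      have pyw: "p = (y, w)" by (simp add: y_def w_def)
      \<comment> \<open>As \<open>z0\<close> lies on the zero section, projecting \<open>p\<close>
        there does not increase the distance to \<open>z0\<close>. By convexity the segment from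
        \<open>(y, 0)\<close> to \<open>p\<close> stays in the ball.\<close>
      have "dist z0 (y, 0) \<le> dist z0 p"
        using True by (cases z0) (auto simp: pyw dist_Pair_Pair)
      then have "(y, 0) \<in> cball z0 r0" using p by simp
      from convex_contains_segment[THEN iffD1, rule_format, OF convex_cball this p]
      have seg: "(y, s *\<^sub>R w) \<in> cball z0 r0" if "s \<in> {0..1}" for s
      proof -
        have "(y, s *\<^sub>R w) = (1 - s) *\<^sub>R (y, 0) + s *\<^sub>R p" by (simp add: pyw algebra_simps)
        then have "(y, s *\<^sub>R w) \<in> closed_segment (y, 0) p" using that unfolding in_segment by auto
        then show ?thesis using \<open>closed_segment (y, 0) p \<subseteq> cball z0 r0\<close> by blast
      qed
      let ?g = "\<lambda>s. G c d i ((y, s *\<^sub>R w), b)"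
      have "norm (?g 1 - ?g 0) \<le> (C * norm w * norm b ^ Suc i) * norm (1 - 0 :: real)"
      proof (rule differentiable_bound[of "{0..1}"])
        fix s :: real assume s: "s \<in> {0..1}"
        have "((\<lambda>s. ((y, s *\<^sub>R w), b)) has_vector_derivative ((0, w), 0)) (at s)"
          by (auto intro!: derivative_eq_intros simp: has_vector_derivative_def)
        from has_vector_derivative_fD[OF diff_G[OF c d] this] seg[OF s] r0(2)
        have "(?g has_vector_derivative ?f (y, s *\<^sub>R w) w b) (at s)" by blast
        then show "(?g has_derivative (\<lambda>h. h *\<^sub>R ?f (y, s *\<^sub>R w) w b)) (at s within {0..1})"
          unfolding has_vector_derivative_def by (rule has_derivative_at_withinI)
        show "onorm (\<lambda>h. h *\<^sub>R ?f (y, s *\<^sub>R w) w b) \<le> C * norm w * norm b ^ Suc i"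
          using C(2)[OF seg[OF s], where h = w and b = b] C(1) by (intro onorm_bound) (auto simp: mult_left_mono mult.commute)
      qed auto
      moreover have "?g 0 = 0"
        using vanish[of y b] seg[of 0] r0(2) by auto
      ultimately show "norm (G c d i (p, b)) \<le> C * norm (snd p) * norm b ^ Suc i"
        by (simp add: pyw)
    qed
  qed
qed

lemma iter_cov_deriv_zero:
  assumes c: "c \<in> atlas M" and p: "fst p \<in> cim c"
  shows "(cov_deriv M (\<lambda>s. R (tpoint M c (p + s *\<^sub>R (0, b)))) ^^ i)
      (velocity M (\<lambda>s. R (tpoint M c (p + s *\<^sub>R (0, b))))) 0 \<in> tangent_space M (R (tpoint M c p))"
    and "d \<in> charts_at M (R (tpoint M c p)) \<Longrightarrow>
      (cov_deriv M (\<lambda>s. R (tpoint M c (p + s *\<^sub>R (0, b)))) ^^ i)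
      (velocity M (\<lambda>s. R (tpoint M c (p + s *\<^sub>R (0, b))))) 0 d = G c d i (p, b)"
  using iter_cov_deriv_line[OF c p, where h = b and i = i and t = 0] by (simp_all flip: zero_prod_def)

lemma chart_ball_exists:
  assumes c: "c \<in> atlas M" and z: "fst z \<in> cim c"
  obtains d r where "d \<in> atlas M" "r > 0" "cball z r \<subseteq> Om c d" "z \<in> Om c d"
proof -
  obtain d where d: "d \<in> atlas M" "z \<in> Om c d" using R_chart_exists[OF c z] .
  then obtain r where "r > 0" "cball z r \<subseteq> Om c d"
    using open_contains_cball open_Om[OF c d(1)] by blast
  then show ?thesis using that d by blast
qed

lemma open_scaled_ball: "open ((\<lambda>(y, a, t). (y, t *\<^sub>R a)) -` ball (z :: 'e \<times> 'e) r)"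
  by (rule open_vimage) (auto simp: case_prod_beta intro!: continuous_intros)

text \<open>The velocity is \<open>G c d 0\<close> at the point \<open>t v\<close>, linear in the
  direction. The neighbourhood is therefore the preimage of a ball around
  \<open>(y0, t0 *\<^sub>R a0)\<close> under scaling.\<close>

lemma local_velocity_bound:
  assumes c: "c \<in> atlas M" and y0: "y0 \<in> cim c"
  shows "\<exists>U C. open U \<and> (y0, a0, t0) \<in> U \<and> (\<forall>y a t b. (y, a, t) \<in> U \<longrightarrow> y \<in> cim c \<longrightarrow>
    tnorm M (R (chart_inv c y, tscale t (tvec_of M c (chart_inv c y) a)))
      (velocity M (retr_curve R (chart_inv c y) (tscale t (tvec_of M c (chart_inv c y) a))
         (tvec_of M c (chart_inv c y) b)) 0) \<le> C * norm a ^ 0 * norm b ^ 1)"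
proof -
  let ?z = "(y0, t0 *\<^sub>R a0)"
  have "fst ?z \<in> cim c" using y0 by simp
  then obtain d r where d: "d \<in> atlas M" and r: "r > 0" "cball ?z r \<subseteq> Om c d"
    by (rule chart_ball_exists[OF c])
  obtain K where K: "K \<ge> 0" "\<And>p \<xi>. p \<in> cball ?z r \<Longrightarrow> \<xi> \<in> tangent_space M (R (tpoint M c p)) \<Longrightarrow>
    tnorm M (R (tpoint M c p)) \<xi> \<le> K * norm (\<xi> d)"
    using fibre_bound[OF c d compact_cball r(2)] by blast
  obtain C where C: "\<And>p b. p \<in> cball ?z r \<Longrightarrow> norm (G c d 0 (p, b)) \<le> C * norm b ^ Suc 0"
    using G_bound[OF c d compact_cball r(2), of 0] by blast
  have "tnorm M (R (chart_inv c y, tscale t (tvec_of M c (chart_inv c y) a)))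
      (velocity M (retr_curve R (chart_inv c y) (tscale t (tvec_of M c (chart_inv c y) a))
         (tvec_of M c (chart_inv c y) b)) 0) \<le> K * C * norm a ^ 0 * norm b ^ 1"
    if y: "y \<in> cim c" and p: "(y, t *\<^sub>R a) \<in> ball ?z r" for y a t b
  proof -
    let ?p = "(y, t *\<^sub>R a)"
    have p': "?p \<in> cball ?z r" "fst ?p \<in> cim c" using p y by auto
    have dp: "d \<in> charts_at M (R (tpoint M c ?p))" using OmD(2)[OF _ d] r(2) p' by blast
    note I = iter_cov_deriv_zero[OF c p'(2), where b = b and i = 0, unfolded funpow_0]
    have "tnorm M (R (tpoint M c ?p)) (velocity M (\<lambda>s. R (tpoint M c (?p + s *\<^sub>R (0, b)))) 0)
      \<le> K * norm (G c d 0 (?p, b))"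
      using K(2)[OF p'(1) I(1)] unfolding I(2)[OF dp] .
    also have "\<dots> \<le> K * (C * norm b ^ Suc 0)" by (rule mult_left_mono[OF C[OF p'(1)] K(1)])
    finally show ?thesis unfolding retr_curve_coord[OF c y] by (simp add: mult.assoc)
  qed
  then show ?thesis
    using r(1) open_scaled_ball[of ?z r]
    by (intro exI[of _ "(\<lambda>(y, a, t). (y, t *\<^sub>R a)) -` ball ?z r"] exI[of _ "K * C"]) auto
qed

text \<open>The covariant derivative is linear in the velocity of the radial curve, which is linear
  in \<open>a\<close>; this gives the factor \<open>norm a\<close>.\<close>

lemma local_cov_deriv_bound:
  assumes c: "c \<in> atlas M" and y0: "y0 \<in> cim c"
  shows "\<exists>U C. open U \<and> (y0, a0, t0) \<in> U \<and> (\<forall>y a t b. (y, a, t) \<in> U \<longrightarrow> y \<in> cim c \<longrightarrow>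
    tnorm M (R (chart_inv c y, tscale t (tvec_of M c (chart_inv c y) a)))
      (cov_deriv M (\<lambda>s. R (chart_inv c y, tscale s (tvec_of M c (chart_inv c y) a)))
        (\<lambda>s. velocity M (retr_curve R (chart_inv c y) (tscale s (tvec_of M c (chart_inv c y) a))
         (tvec_of M c (chart_inv c y) b)) 0) t) \<le> C * norm a ^ 1 * norm b ^ 1)"
proof -
  let ?z = "(y0, t0 *\<^sub>R a0)"
  have "fst ?z \<in> cim c" using y0 by simp
  then obtain d r where d: "d \<in> atlas M" and r: "r > 0" "cball ?z r \<subseteq> Om c d"
    by (rule chart_ball_exists[OF c])
  obtain K where K: "K \<ge> 0" "\<And>p \<xi>. p \<in> cball ?z r \<Longrightarrow> \<xi> \<in> tangent_space M (R (tpoint M c p)) \<Longrightarrow>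
    tnorm M (R (tpoint M c p)) \<xi> \<le> K * norm (\<xi> d)"
    using fibre_bound[OF c d compact_cball r(2)] by blast
  \<comment> \<open>Coordinates of the covariant derivative: the field is
    \<open>G c d 0 (q, b)\<close>, and it is differentiated along the curve with direction
    \<open>a\<close>.\<close>
  let ?H = "\<lambda>q a b. fD (G c d 0) (q, b) ((0, a), 0)
      + christoffel M d (F c d q) (fD (F c d) q (0, a)) (fD (F c d) q (0, b))"
  have o: "open (Om c d \<times> (UNIV :: 'e set) \<times> (UNIV :: 'e set))"
    by (intro open_Times open_Om[OF c d] open_UNIV)
  have s1: "smooth_on (Om c d \<times> UNIV \<times> UNIV)
      (\<lambda>z :: ('e \<times> 'e) \<times> 'e \<times> 'e. fD (G c d 0) (fst z, snd (snd z)) ((0, fst (snd z)), 0))"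
    by (rule smooth_on_fD_compose[OF smooth_G[OF c d] open_Om_Times[OF c d]])
      (auto intro!: smooth_on_Pair smooth_on_fst smooth_on_snd smooth_on_const smooth_on_ident open_Times open_Om[OF c d] open_UNIV)
  have s2: "smooth_on (Om c d \<times> UNIV \<times> UNIV) (\<lambda>z :: ('e \<times> 'e) \<times> 'e \<times> 'e. F c d (fst z))"
    by (rule smooth_on_compose[OF smooth_F[OF c d]]) (auto intro!: smooth_on_fst smooth_on_ident open_Times open_Om[OF c d] open_UNIV)
  have s3: "smooth_on (Om c d \<times> UNIV \<times> UNIV) (\<lambda>z :: ('e \<times> 'e) \<times> 'e \<times> 'e. fD (F c d) (fst z) (0, fst (snd z)))"
    and s4: "smooth_on (Om c d \<times> UNIV \<times> UNIV) (\<lambda>z :: ('e \<times> 'e) \<times> 'e \<times> 'e. fD (F c d) (fst z) (0, snd (snd z)))"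
    by (rule smooth_fD_F[OF c d];
        auto intro!: smooth_on_Pair smooth_on_fst smooth_on_snd smooth_on_const smooth_on_ident open_Times open_Om[OF c d] open_UNIV)+
  have "smooth_on (Om c d \<times> UNIV \<times> UNIV) (\<lambda>z. ?H (fst z) (fst (snd z)) (snd (snd z)))"
    unfolding christoffel_eq_chris
    by (intro smooth_on_add s1 o coord_metric.smooth_chris[OF coord_metric_chart[OF d] o s2 s3 s4])
      (use F_cim[OF c d] in auto)
  then have cont: "continuous_on (cball ?z r \<times> UNIV \<times> UNIV) (\<lambda>z. ?H (fst z) (fst (snd z)) (snd (snd z)))"
    by (rule continuous_on_subset[OF smooth_on_imp_continuous_on]) (use r(2) in auto)
  have hom: "?H p (\<rho> *\<^sub>R a) (\<sigma> *\<^sub>R b) = (\<rho> ^ 1 * \<sigma> ^ 1) *\<^sub>R ?H p a b" if "p \<in> cball ?z r" for p a b \<rho> \<sigma>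
  proof -
    have p: "p \<in> Om c d" "F c d p \<in> cim d" using r(2) that F_cim[OF c d] by blast+
    then show ?thesis
      using fD_G_homogeneous[OF c d, of p 0 \<sigma> b "(0, \<rho> *\<^sub>R a)"] fD_G_scale[OF c d, of p 0 b \<rho> a]
      by (simp add: fD_F_scale[OF c d] christoffel_scale[OF d] scaleR_add_right mult.commute del: G.simps)
  qed
  obtain C where "C \<ge> 0" and C: "\<And>p a b. p \<in> cball ?z r \<Longrightarrow> norm (?H p a b) \<le> C * norm a ^ 1 * norm b ^ 1"
    using bihomogeneous_bound[of "cball ?z r" ?H 1 1, OF compact_cball cont hom] by blast
  have "tnorm M (R (chart_inv c y, tscale t (tvec_of M c (chart_inv c y) a)))
      (cov_deriv M (\<lambda>s. R (chart_inv c y, tscale s (tvec_of M c (chart_inv c y) a)))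
        (\<lambda>s. velocity M (retr_curve R (chart_inv c y) (tscale s (tvec_of M c (chart_inv c y) a))
         (tvec_of M c (chart_inv c y) b)) 0) t) \<le> K * C * norm a ^ 1 * norm b ^ 1"
    if y: "y \<in> cim c" and p: "(y, t *\<^sub>R a) \<in> ball ?z r" for y a t b
  proof -
    let ?p = "(y, t *\<^sub>R a)"
    have p': "?p \<in> cball ?z r" using p by auto
    have dp: "d \<in> charts_at M (R (tpoint M c ?p))" using OmD(2)[OF _ d] r(2) p' by blast
    let ?\<gamma> = "\<lambda>s. R (tpoint M c (y, s *\<^sub>R a))"
    let ?V = "\<lambda>s. velocity M (\<lambda>t. R (tpoint M c ((y, s *\<^sub>R a) + t *\<^sub>R (0, b)))) 0"
    note I = iter_cov_deriv_zero[OF c, where p = "(y, s *\<^sub>R a)" and b = b and i = 0 for s, unfolded funpow_0 fst_conv, OF y]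
    have H: "((\<lambda>q. G c d 0 (q, b)) has_derivative (\<lambda>k. fD (G c d 0) (q, b) (k, 0))) (at q)"
      if "d \<in> atlas M" "q \<in> Om c d" for d q
      by (rule fD_Pair_const[OF diff_G[OF c that]])
    then have H': "(\<lambda>q. G c d 0 (q, b)) differentiable (at q)" if "d \<in> atlas M" "q \<in> Om c d" for d q
      using that unfolding differentiable_def by blast
    \<comment> \<open>The radial curve starts at the zero vector, and \<open>cov_deriv_line\<close>
      is applied at parameter \<open>t\<close> instead of moving the starting point.\<close>
    have line: "(y, 0) + s *\<^sub>R (0, a) = (y, s *\<^sub>R a)" for s by simp
    note CD = cov_deriv_line[OF c, where p = "(y, 0)" and h = a and V = ?V and H = "\<lambda>d q. G c d 0 (q, b)", unfolded line fst_conv, OF y I(1) I(2) H']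
    have T: "cov_deriv M ?\<gamma> ?V t \<in> tangent_space M (?\<gamma> t)" by (rule CD(1))
    have "cov_deriv M ?\<gamma> ?V t d = ?H ?p a b"
      using CD(2)[OF _ _ _ dp] fD_eqI[OF H[OF d subsetD[OF r(2) p']]] by simp
    then have "tnorm M (?\<gamma> t) (cov_deriv M ?\<gamma> ?V t) \<le> K * norm (?H ?p a b)"
      using K(2)[OF p' T] by simp
    also have "\<dots> \<le> K * (C * norm a ^ 1 * norm b ^ 1)" by (rule mult_left_mono[OF C[OF p'] K(1)])
    finally show ?thesis unfolding retr_curve_coord[OF c y] by (simp add: mult.assoc)
  qed
  then show ?thesis
    using r(1) open_scaled_ball[of ?z r]
    by (intro exI[of _ "(\<lambda>(y, a, t). (y, t *\<^sub>R a)) -` ball ?z r"] exI[of _ "K * C"]) auto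
qed

lemma local_higher_bound:
  assumes c: "c \<in> atlas M" and y0: "y0 \<in> cim c"
    and vanish: "\<And>c d y b. c \<in> atlas M \<Longrightarrow> d \<in> atlas M \<Longrightarrow> (y, 0) \<in> Om c d \<Longrightarrow> G c d i ((y, 0), b) = 0"
  shows "\<exists>U C. open U \<and> (y0, a0, t0 :: real) \<in> U \<and> (\<forall>y a t b. (y, a, t) \<in> U \<longrightarrow> y \<in> cim c \<longrightarrow>
    tnorm M (R (chart_inv c y, tvec_of M c (chart_inv c y) a))
      ((cov_deriv M (retr_curve R (chart_inv c y) (tvec_of M c (chart_inv c y) a) (tvec_of M c (chart_inv c y) b)) ^^ i)
        (velocity M (retr_curve R (chart_inv c y) (tvec_of M c (chart_inv c y) a) (tvec_of M c (chart_inv c y) b))) 0)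
      \<le> C * norm a ^ 1 * norm b ^ Suc i)"
proof -
  let ?z = "(y0, a0)"
  have "fst ?z \<in> cim c" using y0 by simp
  then obtain d where d: "d \<in> atlas M" "?z \<in> Om c d" by (rule R_chart_exists[OF c])
  obtain r C where r: "r > 0" "cball ?z r \<subseteq> Om c d" and
    C: "\<And>p b. p \<in> cball ?z r \<Longrightarrow> norm (G c d i (p, b)) \<le> C * norm (snd p) * norm b ^ Suc i"
    by (rule vanishing_bound[OF c d(1,2) vanish[OF c d(1)]]) blast+
  obtain K where K: "K \<ge> 0" "\<And>p \<xi>. p \<in> cball ?z r \<Longrightarrow> \<xi> \<in> tangent_space M (R (tpoint M c p)) \<Longrightarrow>
    tnorm M (R (tpoint M c p)) \<xi> \<le> K * norm (\<xi> d)"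
    using fibre_bound[OF c d(1) compact_cball r(2)] by blast
  have "tnorm M (R (chart_inv c y, tvec_of M c (chart_inv c y) a))
      ((cov_deriv M (retr_curve R (chart_inv c y) (tvec_of M c (chart_inv c y) a) (tvec_of M c (chart_inv c y) b)) ^^ i)
        (velocity M (retr_curve R (chart_inv c y) (tvec_of M c (chart_inv c y) a) (tvec_of M c (chart_inv c y) b))) 0)
      \<le> K * C * norm a ^ 1 * norm b ^ Suc i"
    if y: "y \<in> cim c" and p: "(y, a) \<in> ball ?z r" for y a b
  proof -
    let ?p = "(y, a)"
    have p': "?p \<in> cball ?z r" "fst ?p \<in> cim c" using p y by auto
    have dp: "d \<in> charts_at M (R (tpoint M c ?p))" using OmD(2)[OF _ d(1)] r(2) p' by blast
    note I = iter_cov_deriv_zero[OF c p'(2), where b = b and i = i]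
    have "tnorm M (R (tpoint M c ?p)) ((cov_deriv M (\<lambda>s. R (tpoint M c (?p + s *\<^sub>R (0, b)))) ^^ i)
        (velocity M (\<lambda>s. R (tpoint M c (?p + s *\<^sub>R (0, b))))) 0) \<le> K * norm (G c d i (?p, b))"
      using K(2)[OF p'(1) I(1)] unfolding I(2)[OF dp] .
    also have "\<dots> \<le> K * (C * norm (snd ?p) * norm b ^ Suc i)" by (rule mult_left_mono[OF C[OF p'(1)] K(1)])
    finally show ?thesis unfolding retr_curve_coord[OF c y] by (simp add: mult.assoc tpoint_def)
  qed
  moreover have "open ((\<lambda>(y, a, t :: real). (y, a)) -` ball ?z r)"
    by (rule open_vimage) (auto simp: case_prod_beta intro!: continuous_intros)
  ultimately show ?thesis
    using r(1)
    by (intro exI[of _ "(\<lambda>(y, a, t). (y, a)) -` ball ?z r"] exI[of _ "K * C"]) auto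
qed

text \<open>Over the zero vector the line in direction \<open>b\<close> is \<open>t b\<close>, the
  curve of the order condition. The index of that condition is \<open>Suc i\<close>, as it counts
  the velocity as the first derivative.\<close>

lemma G_vanishes_at_zero:
  assumes "retraction_of_order M p R" "Suc i \<in> {2..p}" and c: "c \<in> atlas M" and d: "d \<in> atlas M"
    and y: "(y, 0) \<in> Om c d"
  shows "G c d i ((y, 0), b) = 0"
proof -
  let ?x = "chart_inv c y" and ?v = "tvec_of M c (chart_inv c y) b"
  have yc: "y \<in> cim c" using OmD(1)[OF y] by simp
  have "(?x, ?v) \<in> tangent_bundle M"
    using tvec_of_tangent charts_at_topspace chart_inv_charts_at[OF c yc] by (auto simp: tangent_bundle_def)
  then have "(cov_deriv M (\<lambda>t. R (?x, tscale t ?v)) ^^ i) (velocity M (\<lambda>t. R (?x, tscale t ?v))) 0 = tzero"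
    using assms(1,2) unfolding retraction_of_order_def Let_def by fastforce
  moreover have "(\<lambda>t. R (?x, tscale t ?v)) = (\<lambda>s. R (tpoint M c ((y, 0) + s *\<^sub>R (0, b))))"
    unfolding retr_curve_coord(1)[OF c yc] by simp
  ultimately show ?thesis
    using iter_cov_deriv_zero(2)[OF c _ OmD(2)[OF y d], where b = b and i = i] yc by (simp add: tzero_def)
qed

theorem nice_on_compact:
  assumes order: "retraction_of_order M p R" and K: "compactin (TM_top M) K"
  shows "nice M p R K"
proof -
  obtain C0 where C0: "\<forall>(x, v)\<in>K. \<forall>u\<in>tangent_space M x. \<forall>t\<in>{0..1}.
      tnorm M (R (x, tscale t v)) (velocity M (retr_curve R x (tscale t v) u) 0)
        \<le> C0 * tnorm M x v ^ 0 * tnorm M x u ^ 1"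
    using globalize[OF K local_velocity_bound] by blast
  obtain C1 where C1: "\<forall>(x, v)\<in>K. \<forall>u\<in>tangent_space M x. \<forall>t\<in>{0..1}.
      tnorm M (R (x, tscale t v)) (cov_deriv M (\<lambda>s. R (x, tscale s v))
        (\<lambda>s. velocity M (retr_curve R x (tscale s v) u) 0) t)
        \<le> C1 * tnorm M x v ^ 1 * tnorm M x u ^ 1"
    using globalize[OF K local_cov_deriv_bound] by blast
  \<comment> \<open>The range of \<open>t\<close> comes from the format of \<open>globalize\<close>;
    \<open>C'\<close> inserts \<open>t = 0\<close>. For \<open>i \<ge> 2\<close> the exponent
    \<open>Suc (i - 1)\<close> equals \<open>i\<close>.\<close>
  have "\<exists>C. \<forall>(x, v)\<in>K. \<forall>u\<in>tangent_space M x. \<forall>t\<in>{0..1::real}.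
      tnorm M (R (x, v)) ((cov_deriv M (retr_curve R x v u) ^^ (i - 1)) (velocity M (retr_curve R x v u)) 0)
        \<le> C * tnorm M x v ^ 1 * tnorm M x u ^ Suc (i - 1)" if i: "i \<in> {2..p}" for i
  proof (rule globalize[OF K local_higher_bound])
    show "G c d (i - 1) ((y, 0), b) = 0" if "c \<in> atlas M" "d \<in> atlas M" "(y, 0) \<in> Om c d" for c d y b
      by (rule G_vanishes_at_zero[OF order _ that]) (use i in auto)
  qed
  then have "\<forall>i\<in>{2..p}. \<exists>C. \<forall>(x, v)\<in>K. \<forall>u\<in>tangent_space M x. \<forall>t\<in>{0..1::real}.
      tnorm M (R (x, v)) ((cov_deriv M (retr_curve R x v u) ^^ (i - 1)) (velocity M (retr_curve R x v u)) 0)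
        \<le> C * tnorm M x v ^ 1 * tnorm M x u ^ Suc (i - 1)" by (rule ballI)
  from bchoice[OF this] obtain C where C: "\<forall>i\<in>{2..p}. \<forall>(x, v)\<in>K. \<forall>u\<in>tangent_space M x. \<forall>t\<in>{0..1::real}.
      tnorm M (R (x, v)) ((cov_deriv M (retr_curve R x v u) ^^ (i - 1)) (velocity M (retr_curve R x v u)) 0)
        \<le> C i * tnorm M x v ^ 1 * tnorm M x u ^ Suc (i - 1)" by (rule exE)
  have C': "tnorm M (R (x, v)) ((cov_deriv M (retr_curve R x v u) ^^ (i - 1)) (velocity M (retr_curve R x v u)) 0)
        \<le> C i * tnorm M x v * tnorm M x u ^ i"
    if "i \<in> {2..p}" "(x, v) \<in> K" "u \<in> tangent_space M x" for i x v u
  proof -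
    have "Suc (i - 1) = i" using that(1) by simp
    moreover have "(0::real) \<in> {0..1}" by simp
    ultimately show ?thesis
      using bspec[OF bspec[OF bspec[OF C that(1)] that(2), unfolded prod.case] that(3)]
      by (metis power_one_right)
  qed
  have C0': "tnorm M (R (x, tscale t v)) (velocity M (retr_curve R x (tscale t v) u) 0) \<le> C0 * tnorm M x u"
    and C1': "tnorm M (R (x, tscale t v)) (cov_deriv M (\<lambda>s. R (x, tscale s v))
        (\<lambda>s. velocity M (retr_curve R x (tscale s v) u) 0) t) \<le> C1 * tnorm M x v * tnorm M x u"
    if "(x, v) \<in> K" "u \<in> tangent_space M x" "t \<in> {0..1}" for x v u t
    using bspec[OF C0 that(1)] bspec[OF C1 that(1)] that(2,3) by auto
  have sub: "K \<subseteq> tangent_bundle M" using compactin_subset_topspace[OF K] topspace_TM by simp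
  let ?C = "\<lambda>i. if i = 0 then C0 else if i = 1 then C1 else C i"
  have Ci: "?C i = C i" if "i \<in> {2..p}" for i using that by simp
  show ?thesis
    unfolding nice_def
    by (rule conjI, fact sub, rule exI[of _ ?C], clarify, intro conjI ballI)
      (simp_all only: C0' C1' C' Ci if_True if_False one_neq_zero simp_thms)
qed

end


section \<open>Taylor models along a retraction\<close>

text \<open>\<open>dirD h j ((y, a), b)\<close> is the \<open>j\<close>-th derivative of \<open>h (y, \<cdot>)\<close> at \<open>a\<close> in the repeated direction
  \<open>b\<close>, kept as a function of all its arguments.\<close>

primrec dirD :: "('p::euclidean_space \<times> 'e::euclidean_space \<Rightarrow> real) \<Rightarrow> nat \<Rightarrow> ('p \<times> 'e) \<times> 'e \<Rightarrow> real" where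
  "dirD h 0 = (\<lambda>z. h (fst z))"
| "dirD h (Suc j) = (\<lambda>z. fD (dirD h j) z ((0, snd z), 0))"

context
  fixes h :: "'p::euclidean_space \<times> 'e::euclidean_space \<Rightarrow> real" and W k
  assumes W: "open W" and h: "Ck_on k W h"
begin

text \<open>Regularity jointly in base point, vector and direction, one order lost per derivative.
  Joint continuity is what later makes Taylor coefficients bounded uniformly in the base
  point.\<close>

lemma Ck_on_dirD: "j \<le> k \<Longrightarrow> Ck_on (k - j) (W \<times> UNIV) (dirD h j)"
proof (induction j)
  case 0
  have "Ck_on k (W \<times> UNIV) (\<lambda>z :: ('p \<times> 'e) \<times> 'e. h (fst z))"
    by (rule Ck_on_compose[OF h Ck_on_fst]) (auto intro: open_Times W)
  then show ?case by simp
next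
  case (Suc j)
  then have "Ck_on (Suc (k - Suc j)) (W \<times> UNIV) (dirD h j)" by (simp add: Suc_diff_Suc)
  moreover have "Ck_on (k - Suc j) (W \<times> UNIV) (\<lambda>z :: ('p \<times> 'e) \<times> 'e. ((0 :: 'p, snd z), 0 :: 'e))"
    by (intro smooth_onD smooth_on_Pair smooth_on_const smooth_on_snd smooth_on_ident open_Times W open_UNIV)
  ultimately have "Ck_on (k - Suc j) (W \<times> UNIV) (\<lambda>z. fD (dirD h j) z ((0, snd z), 0))"
    by (rule Ck_on_fD) (rule open_Times[OF W open_UNIV])
  then show ?case by (simp only: dirD.simps)
qed

lemma diff_dirD: "j < k \<Longrightarrow> q \<in> W \<Longrightarrow> dirD h j differentiable (at (q, b))"
  using Ck_on_dirD[of j] Ck_on_le[of "k - j" "W \<times> UNIV" "dirD h j" 1] by simp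

lemma dirD_homogeneous: "j \<le> k \<Longrightarrow> q \<in> W \<Longrightarrow> dirD h j (q, r *\<^sub>R b) = r ^ j * dirD h j (q, b)"
proof (induction j arbitrary: q)
  case (Suc j)
  have d: "dirD h j differentiable (at (q, b))" for b using diff_dirD Suc.prems by simp
  have "fD (dirD h j) (q, r *\<^sub>R b) ((0, r *\<^sub>R b), 0) = r ^ j *\<^sub>R fD (dirD h j) (q, b) ((0, r *\<^sub>R b), 0)"
    by (rule fD_fst_homogeneous[OF d d W]) (use Suc in auto)
  then show ?case
    using linear_cmul[OF linear_fD[OF d], of b r "((0, b), 0)"] by simp
qed simp

lemma iter_frechet_eq_dirD:
  "j \<le> k \<Longrightarrow> (y, a) \<in> W \<Longrightarrow> iter_frechet (\<lambda>a. h (y, a)) (replicate j b) a = dirD h j ((y, a), b)"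
proof (induction j arbitrary: a)
  case (Suc j)
  have o: "open {a. (y, a) \<in> W}"
    using open_vimage[OF W, of "\<lambda>a. (y, a)"] by (simp add: vimage_def continuous_intros)
  have d: "dirD h j differentiable (at ((y, a), b))" using diff_dirD Suc.prems by simp
  have "((\<lambda>a. ((y, a), b)) has_derivative (\<lambda>h. ((0, h), 0))) (at a)"
    by (auto intro!: derivative_eq_intros)
  from fD_eqI[OF has_derivative_compose[OF this fD_works[OF d]]]
  have 1: "fD (\<lambda>a. dirD h j ((y, a), b)) a b = fD (dirD h j) ((y, a), b) ((0, b), 0)" by simp
  have "fD (\<lambda>a. iter_frechet (\<lambda>a. h (y, a)) (replicate j b) a) a = fD (\<lambda>a. dirD h j ((y, a), b)) a"
    by (rule fD_cong_open[OF o]) (use Suc in auto)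
  then show ?case using 1 by simp
qed simp

end

text \<open>A linear inner map only changes the direction in the chain rule, without higher-order
  terms. This makes derivatives on a tangent space independent of the chart that coordinatises
  it.\<close>

lemma iter_frechet_linear:
  fixes h :: "'a::euclidean_space \<Rightarrow> real" and L :: "'b::euclidean_space \<Rightarrow> 'a"
  assumes h: "Ck_on k UNIV h" and L: "linear L"
  shows "j \<le> k \<Longrightarrow> Ck_on (k - j) UNIV (iter_frechet h (replicate j u))"
    and "j \<le> k \<Longrightarrow> iter_frechet (\<lambda>a. h (L a)) (replicate j b) a = iter_frechet h (replicate j (L b)) (L a)"
proof -
  show C: "j \<le> k \<Longrightarrow> Ck_on (k - j) UNIV (iter_frechet h (replicate j u))" for j u
  proof (induction j)
    case 0
    have "iter_frechet h [] = h" by (rule ext) simp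
    then show ?case using h by simp
  next
    case (Suc j)
    then have "Ck_on (Suc (k - Suc j)) UNIV (iter_frechet h (replicate j u))" by (simp add: Suc_diff_Suc)
    moreover have "iter_frechet h (replicate (Suc j) u) = (\<lambda>y. fD (iter_frechet h (replicate j u)) y u)"
      by (rule ext) (simp add: fun_eq_iff)
    ultimately show ?case by (simp only: Ck_on.simps)
  qed
  show "j \<le> k \<Longrightarrow> iter_frechet (\<lambda>a. h (L a)) (replicate j b) a = iter_frechet h (replicate j (L b)) (L a)"
  proof (induction j arbitrary: a)
    case (Suc j)
    have d: "iter_frechet h (replicate j (L b)) differentiable (at (L a))"
      using Ck_on_le[OF C[of j "L b"], of 1] Suc.prems by simp
    have "((\<lambda>a. iter_frechet h (replicate j (L b)) (L a)) has_derivative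
        (\<lambda>v. fD (iter_frechet h (replicate j (L b))) (L a) (L v))) (at a)"
      using has_derivative_compose[OF linear_imp_has_derivative[OF L] fD_works[OF d]] .
    from fD_eqI[OF this] show ?case using Suc by simp
  qed simp
qed

lemma nice_subset: "nice M p R K \<Longrightarrow> W \<subseteq> K \<Longrightarrow> nice M p R W"
  unfolding nice_def by (meson subset_iff subset_trans)

section \<open>Compact sets containing all vectors of bounded length\<close>

context riem
begin

lemma chart_at: "x \<in> topspace (mtop M) \<Longrightarrow> chart_at M x \<in> charts_at M x"
  unfolding chart_at_def using chart_exists someI_ex by metis

lemma openin_chart_preimage:
  assumes c: "c \<in> atlas M" and Q: "open Q"
  shows "openin (mtop M) {x \<in> fst c. snd c x \<in> Q}"
proof -
  have "continuous_map (subtopology (mtop M) (fst c)) euclidean (snd c)"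
    using homeomorphic_imp_continuous_map[OF homeo[OF c]] continuous_map_in_subtopology by blast
  from openin_continuous_map_preimage[OF this, of Q] Q
  have "openin (subtopology (mtop M) (fst c)) {x \<in> fst c. snd c x \<in> Q}"
    by (simp only: topspace_subtopology_fst[OF c] open_openin)
  then show ?thesis using openin_open_subtopology[OF openin_fst[OF c]] by blast
qed

lemma chart_ball:
  assumes "x \<in> topspace (mtop M)"
  obtains c r m where "c \<in> atlas M" "r > 0" "x \<in> fst c" "cball (snd c x) r \<subseteq> cim c" "m > 0"
    "\<forall>x' v. x' \<in> fst c \<longrightarrow> snd c x' \<in> cball (snd c x) r \<longrightarrow> v \<in> tangent_space M x' \<longrightarrow> m * norm (v c) \<le> tnorm M x' v"
proof -
  obtain c where c: "c \<in> charts_at M x" using chart_exists assms by blast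
  note C = charts_atD[OF c]
  obtain r where r: "r > 0" "cball (snd c x) r \<subseteq> cim c"
    using open_contains_cball open_cim[OF C(1)] C(2) by blast
  show ?thesis
    by (rule tnorm_lower[OF C(1) compact_cball r(2)]) (rule that[OF C(1) r(1) C(2) r(2)], blast+)
qed

text \<open>Over a small closed coordinate ball the vectors of norm at most \<open>B\<close> lie in
  the image of a compact product under \<open>tpoint\<close>. Finitely many such images suffice, and
  containment in their union is all that is claimed.\<close>

lemma compact_tube:
  assumes "compact_space (mtop M)"
  obtains K where "compactin (TM_top M) K"
    "\<And>x v. x \<in> topspace (mtop M) \<Longrightarrow> v \<in> tangent_space M x \<Longrightarrow> tnorm M x v \<le> B \<Longrightarrow> (x, v) \<in> K"
proof -
  let ?T = "\<lambda>U. {(x, v). x \<in> U \<and> v \<in> tangent_space M x \<and> tnorm M x v \<le> B}"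
  have "\<exists>U K. openin (mtop M) U \<and> x \<in> U \<and> compactin (TM_top M) K \<and> ?T U \<subseteq> K"
    if x: "x \<in> topspace (mtop M)" for x
  proof -
    obtain c r m where c: "c \<in> atlas M" "r > 0" "x \<in> fst c" "cball (snd c x) r \<subseteq> cim c" "m > 0"
      and m: "\<forall>x' v. x' \<in> fst c \<longrightarrow> snd c x' \<in> cball (snd c x) r \<longrightarrow> v \<in> tangent_space M x' \<longrightarrow> m * norm (v c) \<le> tnorm M x' v"
      by (rule chart_ball[OF x])
    let ?U = "{x' \<in> fst c. snd c x' \<in> ball (snd c x) r}"
    \<comment> \<open>The radius \<open>B / m\<close> comes from
      \<open>m * norm (v c) \<le> tnorm M x' v\<close>.\<close>
    let ?K = "tpoint M c ` (cball (snd c x) r \<times> cball 0 (B / m))"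
    have "compactin (top_of_set (cim c \<times> UNIV)) (cball (snd c x) r \<times> cball (0 :: 'e) (B / m))"
      using c(4) by (auto simp: compactin_subtopology intro!: compact_Times)
    from image_compactin[OF this continuous_tpoint[OF c(1)]] have "compactin (TM_top M) ?K" .
    moreover have "?T ?U \<subseteq> ?K"
    proof clarify
      fix x' v assume A: "x' \<in> fst c" "snd c x' \<in> ball (snd c x) r" "v \<in> tangent_space M x'" "tnorm M x' v \<le> B"
      have "m * norm (v c) \<le> B" using m A by fastforce
      then have "norm (v c) \<le> B / m" using c(5) by (simp add: pos_le_divide_eq mult.commute)
      then show "(x', v) \<in> ?K"
        using tpoint_tangent_chart[OF charts_atI[OF c(1) A(1)] A(3)] A(2)
        by (intro image_eqI[of _ _ "(snd c x', v c)"]) auto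
    qed
    moreover have "openin (mtop M) ?U" by (rule openin_chart_preimage[OF c(1) open_ball])
    moreover have "x \<in> ?U" using c(2,3) by simp
    ultimately show ?thesis by blast
  qed
  then have "\<forall>x\<in>topspace (mtop M). \<exists>U K. openin (mtop M) U \<and> x \<in> U \<and> compactin (TM_top M) K \<and> ?T U \<subseteq> K"
    by (rule ballI)
  from bchoice[OF this] obtain U where "\<forall>x\<in>topspace (mtop M). \<exists>K. openin (mtop M) (U x) \<and> x \<in> U x \<and>
      compactin (TM_top M) K \<and> ?T (U x) \<subseteq> K" by (rule exE)
  from bchoice[OF this] obtain K where "\<forall>x\<in>topspace (mtop M). openin (mtop M) (U x) \<and> x \<in> U x \<and>
      compactin (TM_top M) (K x) \<and> ?T (U x) \<subseteq> K x" by (rule exE)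
  then have UK: "openin (mtop M) (U x)" "x \<in> U x" "compactin (TM_top M) (K x)" "?T (U x) \<subseteq> K x"
    if "x \<in> topspace (mtop M)" for x
    using that by (meson bspec)+
  have "\<forall>V\<in>U ` topspace (mtop M). openin (mtop M) V" "topspace (mtop M) \<subseteq> \<Union> (U ` topspace (mtop M))"
    using UK(1,2) by auto
  then obtain \<F> where \<F>: "finite \<F>" "\<F> \<subseteq> U ` topspace (mtop M)" "topspace (mtop M) \<subseteq> \<Union>\<F>"
    using assms unfolding compact_space_def compactin_def by meson
  then obtain I where I: "finite I" "I \<subseteq> topspace (mtop M)" "\<F> = U ` I" using finite_subset_image by metis
  show ?thesis
  proof (rule that[of "\<Union> (K ` I)"])
    show "compactin (TM_top M) (\<Union> (K ` I))" using I UK(3) by (intro compactin_Union) auto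
    fix x v assume x: "x \<in> topspace (mtop M)" "v \<in> tangent_space M x" "tnorm M x v \<le> B"
    then obtain i where i: "i \<in> I" "x \<in> U i" using \<F>(3) I(3) by blast
    then have "(x, v) \<in> ?T (U i)" using x by simp
    then show "(x, v) \<in> \<Union> (K ` I)" using UK(4)[OF subsetD[OF I(2) i(1)]] i(1) by blast
  qed
qed

end

section \<open>Bounds for the Taylor coefficients and the regularised model\<close>

context retr
begin

context
  fixes f k assumes f: "Ck_function M k f"
begin

text \<open>No single chart \<open>d\<close> contains the image of a whole fibre in general, so
  regularity is shown locally on the open sets \<open>Om c d\<close>.\<close>

lemma Ck_pullback:
  assumes c: "c \<in> atlas M"
  shows "Ck_on k (cim c \<times> UNIV) (\<lambda>z. f (R (tpoint M c z)))"
proof (rule Ck_on_local)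
  fix z :: "'e \<times> 'e" assume "z \<in> cim c \<times> UNIV"
  then have "fst z \<in> cim c" by auto
  then obtain d where d: "d \<in> atlas M" "z \<in> Om c d" by (rule R_chart_exists[OF c])
  have "Ck_on k (Om c d) (\<lambda>z. (f \<circ> chart_inv d) (F c d z))"
    using f d(1) unfolding Ck_function_def
    by (intro Ck_on_compose[OF _ smooth_onD[OF smooth_F[OF c d(1)]] F_cim[OF c d(1)] open_Om[OF c d(1)]]) blast
  then have "Ck_on k (Om c d) (\<lambda>z. f (R (tpoint M c z)))"
    by (rule Ck_on_cong[OF open_Om[OF c d(1)]]) (simp add: F_def Om_def d(1))
  then show "\<exists>T. open T \<and> z \<in> T \<and> Ck_on k T (\<lambda>z. f (R (tpoint M c z)))"
    using open_Om[OF c d(1)] d(2) by blast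
qed

text \<open>\<open>tangent_D\<close> uses the arbitrarily chosen \<open>chart_at M x\<close>, which
  need not vary continuously with \<open>x\<close>. The linear change of fibre coordinates replaces
  it by a chart fixed near the point.\<close>

lemma tangent_D_coord:
  assumes c: "c \<in> charts_at M x" and v: "v \<in> tangent_space M x" and j: "j \<le> k"
  shows "tangent_D M x (\<lambda>w. f (R (x, w))) (replicate j v) tzero
    = dirD (\<lambda>z. f (R (tpoint M c z))) j ((snd c x, 0), v c)"
proof -
  let ?d = "chart_at M x"
  have d: "?d \<in> charts_at M x" using chart_at charts_at_topspace[OF c] by blast
  note C = charts_atD[OF c]
  let ?L = "fD (tr ?d c) (snd ?d x)" and ?h = "\<lambda>a. f (R (x, tvec_of M c x a))"
  have L: "linear ?L" by (rule linear_fD_tr[OF d c])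
  have o: "open (cim c \<times> (UNIV :: 'e set))" by (rule open_Times[OF open_cim[OF C(1)] open_UNIV])
  have tp: "(\<lambda>a. f (R (tpoint M c (snd c x, a)))) = ?h" using C by (simp add: tpoint_def)
  have "Ck_on k UNIV (\<lambda>a. f (R (tpoint M c (snd c x, a))))"
    by (rule Ck_on_compose[OF Ck_pullback[OF C(1)] smooth_onD[OF smooth_on_Pair]]) (use C in auto)
  then have h: "Ck_on k UNIV ?h" by (simp only: tp)
  have "tangent_D M x (\<lambda>w. f (R (x, w))) (replicate j v) tzero
     = iter_frechet (\<lambda>a. f (R (x, tvec_of M ?d x a))) (replicate j (v ?d)) 0"
    by (simp add: tangent_D_def Let_def tzero_def)
  also have "(\<lambda>a. f (R (x, tvec_of M ?d x a))) = (\<lambda>a. ?h (?L a))"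
    by (simp only: tvec_of_change[OF d c])
  also have "iter_frechet (\<lambda>a. ?h (?L a)) (replicate j (v ?d)) 0 = iter_frechet ?h (replicate j (?L (v ?d))) (?L 0)"
    by (rule iter_frechet_linear(2)[OF h L j])
  also have "\<dots> = iter_frechet ?h (replicate j (v c)) 0"
    using tangentD(1)[OF v d c] linear_0[OF L] by simp
  also have "\<dots> = dirD (\<lambda>z. f (R (tpoint M c z))) j ((snd c x, 0), v c)"
    unfolding tp[symmetric]
    by (rule iter_frechet_eq_dirD[OF o Ck_pullback[OF C(1)] j]) (use C in auto)
  finally show ?thesis .
qed

text \<open>In a fixed chart the derivative is \<open>dirD\<close>, continuous in the base point and
  homogeneous of degree \<open>j\<close> in the vector; \<open>tnorm_lower\<close> and the
  compactness of the manifold do the rest.\<close>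

lemma tangent_D_bound:
  assumes comp: "compact_space (mtop M)" and j: "j \<le> k"
  shows "\<exists>C\<ge>0. \<forall>x\<in>topspace (mtop M). \<forall>v\<in>tangent_space M x.
    \<bar>tangent_D M x (\<lambda>w. f (R (x, w))) (replicate j v) tzero\<bar> \<le> C * tnorm M x v ^ j"
proof (rule compactin_uniform)
  show "compactin (mtop M) (topspace (mtop M))" using comp by (simp add: compact_space_def)
next
  fix x assume x: "x \<in> topspace (mtop M)"
  obtain c r m where c: "c \<in> atlas M" "r > 0" "x \<in> fst c" "cball (snd c x) r \<subseteq> cim c" "m > 0"
    and m: "\<forall>x' v. x' \<in> fst c \<longrightarrow> snd c x' \<in> cball (snd c x) r \<longrightarrow> v \<in> tangent_space M x' \<longrightarrow> m * norm (v c) \<le> tnorm M x' v"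
    by (rule chart_ball[OF x])
  let ?U = "{x' \<in> fst c. snd c x' \<in> ball (snd c x) r}"
  let ?h = "\<lambda>z. f (R (tpoint M c z))"
  have o: "open (cim c \<times> (UNIV :: 'e set))" by (rule open_Times[OF open_cim[OF c(1)] open_UNIV])
  let ?g = "\<lambda>y (a :: 'e) b. dirD ?h j ((y, 0), b)"
  have "continuous_on ((cim c \<times> UNIV) \<times> UNIV) (dirD ?h j)"
    using Ck_on_imp_continuous_on[OF Ck_on_dirD[OF o Ck_pullback[OF c(1)] j]] .
  then have cont: "continuous_on (cball (snd c x) r \<times> UNIV \<times> UNIV) (\<lambda>z. ?g (fst z) (fst (snd z)) (snd (snd z)))"
    by (rule continuous_on_compose2) (use c(4) in \<open>auto intro!: continuous_intros\<close>)
  have hom: "?g y (\<rho> *\<^sub>R a) (\<sigma> *\<^sub>R b) = (\<rho> ^ 0 * \<sigma> ^ j) *\<^sub>R ?g y a b" if "y \<in> cball (snd c x) r" for y a b \<rho> \<sigma>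
    using dirD_homogeneous[OF o Ck_pullback[OF c(1)] j, of "(y, 0)" \<sigma> b] c(4) that by auto
  obtain C where C: "C \<ge> 0" "\<And>y a b. y \<in> cball (snd c x) r \<Longrightarrow> norm (?g y a b) \<le> C * norm a ^ 0 * norm b ^ j"
    using bihomogeneous_bound[of "cball (snd c x) r" ?g 0 j, OF compact_cball cont hom] by blast
  have "\<bar>tangent_D M x' (\<lambda>w. f (R (x', w))) (replicate j v) tzero\<bar> \<le> C / m ^ j * tnorm M x' v ^ j"
    if x': "x' \<in> ?U" and v: "v \<in> tangent_space M x'" for x' v
  proof -
    have X: "x' \<in> fst c" "snd c x' \<in> cball (snd c x) r" using x' by auto
    have "\<bar>tangent_D M x' (\<lambda>w. f (R (x', w))) (replicate j v) tzero\<bar> \<le> C * norm (v c) ^ j"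
      unfolding tangent_D_coord[OF charts_atI[OF c(1) X(1)] v j] using C(2)[OF X(2), of "v c"] by simp
    also have "\<dots> = C / m ^ j * (m * norm (v c)) ^ j" using c(5) by (simp add: power_mult_distrib)
    also have "\<dots> \<le> C / m ^ j * tnorm M x' v ^ j"
      using m X v C(1) c(5) by (intro mult_left_mono power_mono) auto
    finally show ?thesis .
  qed
  moreover have "openin (mtop M) ?U" by (rule openin_chart_preimage[OF c(1) open_ball])
  moreover have "x \<in> ?U" using c(2,3) by simp
  ultimately show "\<exists>W C. openin (mtop M) W \<and> x \<in> W \<and> (\<forall>w\<in>W \<inter> topspace (mtop M). \<forall>v\<in>tangent_space M w.
    \<bar>tangent_D M w (\<lambda>w'. f (R (w, w'))) (replicate j v) tzero\<bar> \<le> C * tnorm M w v ^ j)"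
    by (intro exI[of _ ?U] exI[of _ "C / m ^ j"] conjI ballI) (simp_all only: Int_iff)
next
  fix x C C' assume A: "x \<in> topspace (mtop M)" "\<forall>v\<in>tangent_space M x.
    \<bar>tangent_D M x (\<lambda>w. f (R (x, w))) (replicate j v) tzero\<bar> \<le> C * tnorm M x v ^ j" "C \<le> (C' :: real)"
  show "\<forall>v\<in>tangent_space M x.
    \<bar>tangent_D M x (\<lambda>w. f (R (x, w))) (replicate j v) tzero\<bar> \<le> C' * tnorm M x v ^ j"
  proof
    fix v assume v: "v \<in> tangent_space M x"
    have "C * tnorm M x v ^ j \<le> C' * tnorm M x v ^ j"
      using A(3) tnorm_nonneg[OF chart_at[OF A(1)] v] by (intro mult_right_mono) auto
    then show "\<bar>tangent_D M x (\<lambda>w. f (R (x, w))) (replicate j v) tzero\<bar> \<le> C' * tnorm M x v ^ j"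
      using A(2) v by fastforce
  qed
qed

text \<open>The regularisation term of degree \<open>k + 1\<close> dominates the Taylor polynomial of degree \<open>k\<close>.\<close>

lemma model_decrease_bound:
  assumes comp: "compact_space (mtop M)" and "\<alpha>min > 0"
  obtains B where "\<And>x v \<alpha>. x \<in> topspace (mtop M) \<Longrightarrow> v \<in> tangent_space M x \<Longrightarrow> \<alpha>min \<le> \<alpha> \<Longrightarrow>
    reg_model M k R f \<alpha> x v \<le> reg_model M k R f \<alpha> x tzero \<Longrightarrow> tnorm M x v \<le> B"
proof -
  let ?D = "\<lambda>x v j. tangent_D M x (\<lambda>w. f (R (x, w))) (replicate j v) tzero"
  have "\<forall>j\<in>{..k}. \<exists>C\<ge>0. \<forall>x\<in>topspace (mtop M). \<forall>v\<in>tangent_space M x. \<bar>?D x v j\<bar> \<le> C * tnorm M x v ^ j"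
    using tangent_D_bound[OF comp] by (intro ballI) (simp only: atMost_iff)
  from bchoice[OF this] obtain C where C: "\<And>j. j \<le> k \<Longrightarrow> C j \<ge> 0"
    "\<And>j x v. j \<le> k \<Longrightarrow> x \<in> topspace (mtop M) \<Longrightarrow> v \<in> tangent_space M x \<Longrightarrow> \<bar>?D x v j\<bar> \<le> C j * tnorm M x v ^ j"
    by (metis atMost_iff)
  \<comment> \<open>For \<open>n = tnorm M x v > 1\<close> the decrease gives
    \<open>\<alpha>min / (k + 1) * n ^ (k + 1) \<le> S * n ^ k\<close>, and dividing by
    \<open>n ^ k\<close> produces the bound; the \<open>max\<close> with \<open>1\<close> covers
    short vectors.\<close>
  define S where "S = (\<Sum>j=1..k. C j)"
  show ?thesis
  proof (rule that[of "max 1 (S * (real k + 1) / \<alpha>min)"])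
    fix x v \<alpha> assume x: "x \<in> topspace (mtop M)" and v: "v \<in> tangent_space M x" and \<alpha>: "\<alpha>min \<le> \<alpha>"
      and dec: "reg_model M k R f \<alpha> x v \<le> reg_model M k R f \<alpha> x tzero"
    let ?c = "chart_at M x"
    have c: "?c \<in> charts_at M x" using chart_at[OF x] .
    have zT: "tzero \<in> tangent_space M x" using tvec_of_tangent[OF c, of 0] tvec_of_zero[OF c] by simp
    have z0: "tnorm M x tzero = 0"
    proof -
      have "snd ?c x \<in> cim ?c" using charts_atD[OF c] by blast
      from coord_metric.form[OF coord_metric_chart[OF charts_atD(1)[OF c]] this]
      have "metric_coord M ?c (snd ?c x) 0 0 = 0" using inner_formD(1) linear_0 by blast
      then show ?thesis unfolding tnorm_def metric_eq_coord[OF c zT zT] by (simp add: tzero_def)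
    qed
    have "tzero ?c = 0" by (simp add: tzero_def)
    then have D0: "?D x w 0 = f x" for w
      using tvec_of_zero[OF c] retraction_zero[OF x] by (simp add: tangent_D_def Let_def)
    have split: "taylor_model M k R f x w = f x + (\<Sum>j=1..k. 1 / fact j * ?D x w j)"
      for w
      unfolding taylor_model_def using D0[of w] by (simp add: sum.atLeast_Suc_atMost)
    \<comment> \<open>The bound of degree \<open>j \<ge> 1\<close> is \<open>0\<close> at the zero
      vector.\<close>
    have "?D x tzero j = 0" if "j \<in> {1..k}" for j
      using C(2)[OF _ x zT, of j] that z0 by (auto simp: zero_power)
    then have "reg_model M k R f \<alpha> x tzero = f x"
      unfolding reg_model_def split z0 by simp
    then have le: "\<alpha> / (real k + 1) * tnorm M x v ^ (k + 1) \<le> - (\<Sum>j=1..k. 1 / fact j * ?D x v j)"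
      using dec unfolding reg_model_def split by simp
    show "tnorm M x v \<le> max 1 (S * (real k + 1) / \<alpha>min)"
    proof (cases "tnorm M x v \<le> 1")
      case False
      let ?n = "tnorm M x v"
      have n: "?n > 1" using False by simp
      \<comment> \<open>Since the norm exceeds \<open>1\<close>, every power up to \<open>k\<close>
        is at most the \<open>k\<close>-th one.\<close>
      have "- (\<Sum>j=1..k. 1 / fact j * ?D x v j) \<le> (\<Sum>j=1..k. C j * ?n ^ k)"
        unfolding sum_negf[symmetric]
      proof (rule sum_mono)
        fix j assume j: "j \<in> {1..k}"
        have "- (1 / fact j * ?D x v j) = 1 / fact j * (- ?D x v j)" by simp
        also have "\<dots> \<le> 1 / fact j * \<bar>?D x v j\<bar>" by (rule mult_left_mono) auto
        also have "\<dots> \<le> 1 * \<bar>?D x v j\<bar>" by (rule mult_right_mono) (simp_all add: fact_ge_1)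
        also have "\<dots> \<le> C j * ?n ^ j" using C(2)[OF _ x v, of j] j by simp
        also have "\<dots> \<le> C j * ?n ^ k" using C(1)[of j] j n by (intro mult_left_mono power_increasing) auto
        finally show "- (1 / fact j * ?D x v j) \<le> C j * ?n ^ k" .
      qed
      also have "\<dots> = S * ?n ^ k" by (simp add: S_def sum_distrib_right)
      finally have "\<alpha> / (real k + 1) * ?n * ?n ^ k \<le> S * ?n ^ k" using le by (simp add: mult_ac)
      then have "\<alpha> / (real k + 1) * ?n \<le> S" by (rule mult_right_le_imp_le) (use n in simp)
      moreover have "\<alpha>min / (real k + 1) * ?n \<le> \<alpha> / (real k + 1) * ?n"
        using \<alpha> n by (intro mult_right_mono divide_right_mono) auto
      ultimately have "\<alpha>min / (real k + 1) * ?n \<le> S" by simp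
      then have "?n \<le> S * (real k + 1) / \<alpha>min" using assms(2) by (simp add: field_simps)
      then show ?thesis by simp
    qed simp
  qed
qed

end

text \<open>The entries of a run are constrained only while it is active, and activity at
  \<open>Suc i\<close> includes activity at \<open>i\<close>. The lower bound on the weights makes
  the length bound for steps independent of \<open>i\<close>.\<close>

lemma rar_run_invariant:
  assumes P: "rar_params_ok P" and run: "rar_run M p R f P x0 x v \<alpha>" and act: "rar_active M f P x i"
  shows "x i \<in> topspace (mtop M) \<and> alpha_min P \<le> \<alpha> i"
  using act
proof (induction i)
  case 0
  then show ?case using run P by (simp add: rar_run_def rar_params_ok_def)
next
  case (Suc i)
  then have act: "rar_active M f P x i" by (simp add: rar_active_def)
  from Suc.IH[OF act] have x: "x i \<in> topspace (mtop M)" and \<alpha>: "alpha_min P \<le> \<alpha> i" by auto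
  define \<rho> where "\<rho> = rar_rho M p R f (x i) (v i)"
  have v: "v i \<in> tangent_space M (x i)"
    and next_x: "x (Suc i) = (if \<rho> \<ge> eta1 P then R (x i, v i) else x i)"
    and a1: "\<rho> \<ge> eta2 P \<Longrightarrow> \<alpha> (Suc i) \<ge> alpha_min P"
    and a2: "eta1 P \<le> \<rho> \<Longrightarrow> \<rho> < eta2 P \<Longrightarrow> \<alpha> (Suc i) \<ge> \<alpha> i"
    and a3: "\<rho> < eta1 P \<Longrightarrow> \<alpha> (Suc i) \<ge> gamma2 P * \<alpha> i"
    using run act by (auto simp: rar_run_def rar_step_ok_def Let_def \<rho>_def)
  have "x (Suc i) \<in> topspace (mtop M)" using next_x R_topspace[OF x v] x by simp
  \<comment> \<open>After a rejected step the weight is multiplied by at least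
    \<open>gamma2 P > 1\<close>; this increases it because it is positive by the induction
    hypothesis.\<close>
  moreover have "\<alpha> i \<le> gamma2 P * \<alpha> i"
    using \<alpha> P mult_right_mono[of 1 "gamma2 P" "\<alpha> i"] by (simp add: rar_params_ok_def)
  then have "alpha_min P \<le> \<alpha> (Suc i)" using a1 a2 a3 \<alpha> by linarith
  ultimately show ?case by simp
qed

theorem nice_on_increments:
  assumes order: "retraction_of_order M p R" and comp: "compact_space (mtop M)"
    and f: "Ck_function M p f" and P: "rar_params_ok P" and run: "rar_run M p R f P x0 x v \<alpha>"
  shows "nice M p R (rar_increments M f P x v)"
proof -
  have "alpha_min P > 0" using P by (simp add: rar_params_ok_def)
  \<comment> \<open>\<open>B\<close> depends on \<open>alpha_min P\<close> but on no iterate, so one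
    compact set \<open>K\<close> serves the whole run.\<close>
  then obtain B where B: "\<And>x v \<alpha>. x \<in> topspace (mtop M) \<Longrightarrow> v \<in> tangent_space M x \<Longrightarrow> alpha_min P \<le> \<alpha> \<Longrightarrow>
    reg_model M p R f \<alpha> x v \<le> reg_model M p R f \<alpha> x tzero \<Longrightarrow> tnorm M x v \<le> B"
    using model_decrease_bound[OF f comp] by blast
  obtain K where K: "compactin (TM_top M) K"
    "\<And>x v. x \<in> topspace (mtop M) \<Longrightarrow> v \<in> tangent_space M x \<Longrightarrow> tnorm M x v \<le> B \<Longrightarrow> (x, v) \<in> K"
    using compact_tube[OF comp] by blast
  have "(x i, v i) \<in> K" if act: "rar_active M f P x i" for i
  proof -
    have "rar_step_ok M p R f P (\<alpha> i) (x i) (v i)" using run act by (simp add: rar_run_def)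
    then show ?thesis
      using rar_run_invariant[OF P run act] by (intro K(2) B[of "x i" "v i" "\<alpha> i"]) (auto simp: rar_step_ok_def)
  qed
  then have "rar_increments M f P x v \<subseteq> K" by (auto simp: rar_increments_def)
  with nice_on_compact[OF order K(1)] show ?thesis by (rule nice_subset)
qed

end

theorem corollary4p16:
  fixes M :: "('a, 'e::euclidean_space) riemannian"
    and p :: nat
    and R :: "'a \<times> ('a, 'e) tvec \<Rightarrow> 'a"
  assumes "p \<ge> 2"
    and "riemannian_manifold M"
    and "retraction_of_order M p R"
  shows "(\<forall>K. compactin (TM_top M) K \<longrightarrow> nice M p R K) \<and>
    (compact_space (mtop M) \<longrightarrow>
      (\<forall>(f :: 'a \<Rightarrow> real) (P :: rar_params) (x0 :: 'a) (x :: nat \<Rightarrow> 'a)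
          (v :: nat \<Rightarrow> ('a, 'e) tvec) (\<alpha> :: nat \<Rightarrow> real).
         Ck_function M p f \<and> rar_params_ok P \<and> rar_run M p R f P x0 x v \<alpha> \<longrightarrow>
         nice M p R (rar_increments M f P x v)))"
proof -
  have "manifold_retraction M R" using assms(3) by (simp add: retraction_of_order_def)
  then interpret retr M R using assms(2) by unfold_locales
  show ?thesis
    using nice_on_compact[OF assms(3)] nice_on_increments[OF assms(3)] by blast
qed

end
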